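(* Let $U\in\mathcal{C}^3(\mathbb{R}^d)$ have a global minimum at $0$ with $U(0)=0$, and suppose $L:=\sup\|D^2U\|<\infty$ and $L_H:=\sup\|D^3U\|<\infty$. Let $T>0$ and $h\ge0$ satisfy $L(T^2+Th)\le1/6$ and, if $h>0$, $T/h\in\mathbb{N}$. Let $\tilde\pi$ be the transition kernel of unadjusted Hamiltonian Monte Carlo with duration $T$ and step size $h$, and $\xi\sim\mathcal N(0,I_d)$. For any $x,y\in\mathbb{R}^d$, let $\Phi:\mathbb{R}^d\to\mathbb{R}^d$ be the map defined by $\tilde q_T(x,v)=\tilde q_T(y,\Phi(v))$ for $v\in\mathbb{R}^d$. Then $$\mathrm{TV}(\delta_x\tilde\pi,\delta_y\tilde\pi)\ \le\ \mathrm{TV}(\mathrm{Law}(\xi),\mathrm{Law}(\Phi(\xi)))\ \le\ \tfrac32\left(T^{-2}+27\,d\,L_H^2\,T^4\right)^{1/2}|x-y|.$$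
   Context: $|\cdot|$ is the Euclidean norm and $\|\cdot\|$ the operator norm of a multilinear form (supremum over unit vectors in each argument). Velocity Verlet: for $h>0$ let $\lfloor t\rfloor_h=\max\{s\in h\mathbb{Z}:s\le t\}$ and $\lceil t\rceil_h=\min\{s\in h\mathbb{Z}:s\ge t\}$; for $h=0$, $\lfloor t\rfloor_h=\lceil t\rceil_h=t$. For $(x,v)\in\mathbb{R}^{2d}$, $(\tilde q_t(x,v),\tilde v_t(x,v))_{t\ge0}$ is the continuous, piecewise differentiable solution of $$\tfrac{d}{dt}\tilde q_t=\tilde v_{\lfloor t\rfloor_h}-(t-\lfloor t\rfloor_h)\nabla U(\tilde q_{\lfloor t\rfloor_h}),\qquad \tfrac{d}{dt}\tilde v_t=-\tfrac12\left(\nabla U(\tilde q_{\lfloor t\rfloor_h})+\nabla U(\tilde q_{\lceil t\rceil_h})\right)$$ with $(\tilde q_0,\tilde v_0)=(x,v)$ (for $h=0$ this is the exact Hamiltonian flow $\dot q=v$, $\dot v=-\nabla U(q)$). The uHMC kernel is $\tilde\pi(x,A)=P[\tilde q_T(x,\xi)\in A]$ with $\xi\sim\mathcal N(0,I_d)$; $\delta_x\tilde\pi=\tilde\pi(x,\cdot)$. The map $\Phi$ is well defined: under the stated condition on $L,T,h$, for any $y,b\in\mathbb{R}^d$ there is exactly one initial velocity $w$ with $\tilde q_T(y,w)=b$. $\mathrm{TV}(\nu,\eta)=\sup_A|\nu(A)-\eta(A)|$ over Borel sets $A$. *)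

theory Defs
  imports "HOL-Probability.Probability"
begin

text \<open>Iterating \<open>fderiv\<close> on \<open>U :: 'a \<Rightarrow> real\<close> gives the derivatives $DU$, $D^2U$, $D^3U$
  as curried bounded multilinear forms. The value is meaningful at points of differentiability.\<close>

definition fderiv :: "('a::real_normed_vector \<Rightarrow> 'b::real_normed_vector) \<Rightarrow> 'a \<Rightarrow> ('a \<Rightarrow>\<^sub>L 'b)"
  where "fderiv f x = Blinfun (frechet_derivative f (at x))"

definition C3 :: "('a::real_normed_vector \<Rightarrow> real) \<Rightarrow> bool"
  where "C3 U \<longleftrightarrow>
    (\<forall>x. U differentiable (at x)) \<and>
    (\<forall>x. fderiv U differentiable (at x)) \<and>
    (\<forall>x. fderiv (fderiv U) differentiable (at x)) \<and>
    continuous_on UNIV (fderiv (fderiv (fderiv U)))"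

definition bilinear_norm :: "('a::real_normed_vector \<Rightarrow>\<^sub>L 'a \<Rightarrow>\<^sub>L real) \<Rightarrow> real"
  where "bilinear_norm B =
    (SUP (u, v) \<in> sphere 0 1 \<times> sphere 0 1. \<bar>blinfun_apply (blinfun_apply B u) v\<bar>)"

definition trilinear_norm :: "('a::real_normed_vector \<Rightarrow>\<^sub>L 'a \<Rightarrow>\<^sub>L 'a \<Rightarrow>\<^sub>L real) \<Rightarrow> real"
  where "trilinear_norm C =
    (SUP (u, v, w) \<in> sphere 0 1 \<times> sphere 0 1 \<times> sphere 0 1.
       \<bar>blinfun_apply (blinfun_apply (blinfun_apply C u) v) w\<bar>)"

definition grad :: "('a::real_inner \<Rightarrow> real) \<Rightarrow> 'a \<Rightarrow> 'a"
  where "grad U x = (THE g. GDERIV U x :> g)"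

definition grid :: "real \<Rightarrow> real set"
  where "grid h = range (\<lambda>k::int. h * of_int k)"

definition grid_floor :: "real \<Rightarrow> real \<Rightarrow> real"
  where "grid_floor h t = (if h = 0 then t else (GREATEST s. s \<in> grid h \<and> s \<le> t))"

definition grid_ceiling :: "real \<Rightarrow> real \<Rightarrow> real"
  where "grid_ceiling h t = (if h = 0 then t else (LEAST s. s \<in> grid h \<and> t \<le> s))"

lemma grid_floor_eq: "h > 0 \<Longrightarrow> grid_floor h t = h * of_int \<lfloor>t / h\<rfloor>"
  unfolding grid_floor_def grid_def
  by (auto intro!: Greatest_equality simp: le_floor_iff field_simps)
     (metis of_int_floor_le pos_le_divide_eq mult.commute)

lemma grid_ceiling_eq: "h > 0 \<Longrightarrow> grid_ceiling h t = h * of_int \<lceil>t / h\<rceil>"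
  unfolding grid_ceiling_def grid_def
  by (auto intro!: Least_equality simp: ceiling_le_iff field_simps)
     (metis le_of_int_ceiling pos_divide_le_eq mult.commute)

text \<open>For \<open>h > 0\<close> the right-hand sides jump at the grid points, so the trajectory is only
  required to be differentiable off the grid (and continuous everywhere). For \<open>h = 0\<close> the
  equations hold at every \<open>t \<ge> 0\<close>, with a one-sided derivative at \<open>t = 0\<close>.\<close>

definition verlet_solution ::
  "('a::real_inner \<Rightarrow> real) \<Rightarrow> real \<Rightarrow> 'a \<Rightarrow> 'a \<Rightarrow> (real \<Rightarrow> 'a) \<Rightarrow> (real \<Rightarrow> 'a) \<Rightarrow> bool"
  where "verlet_solution U h x v q p \<longleftrightarrow>
    continuous_on {0..} q \<and> continuous_on {0..} p \<and> q 0 = x \<and> p 0 = v \<and>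
    (\<forall>t\<ge>0. (h > 0 \<longrightarrow> t \<notin> grid h) \<longrightarrow>
      (q has_vector_derivative
        p (grid_floor h t) - (t - grid_floor h t) *\<^sub>R grad U (q (grid_floor h t)))
        (at t within {0..}) \<and>
      (p has_vector_derivative
        - ((1/2) *\<^sub>R (grad U (q (grid_floor h t)) + grad U (q (grid_ceiling h t)))))
        (at t within {0..}))"

text \<open>The definite description is applied to the position at time \<open>t\<close> because solutions, as
  functions on the whole real line, are arbitrary at negative times.\<close>

definition verlet_pos :: "('a::real_inner \<Rightarrow> real) \<Rightarrow> real \<Rightarrow> real \<Rightarrow> 'a \<Rightarrow> 'a \<Rightarrow> 'a"
  where "verlet_pos U h t x v = (THE a. \<exists>q p. verlet_solution U h x v q p \<and> a = q t)"

definition std_gaussian :: "(real ^ 'n) measure"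
  where "std_gaussian = density lborel (\<lambda>v. ennreal (\<Prod>i\<in>UNIV. std_normal_density (v $ i)))"

definition uhmc_kernel ::
  "(real ^ 'n \<Rightarrow> real) \<Rightarrow> real \<Rightarrow> real \<Rightarrow> real ^ 'n \<Rightarrow> (real ^ 'n) measure"
  where "uhmc_kernel U T h x = distr std_gaussian borel (verlet_pos U h T x)"

definition tv_dist :: "'a::topological_space measure \<Rightarrow> 'a measure \<Rightarrow> real"
  where "tv_dist \<nu> \<eta> = (SUP A \<in> sets borel. \<bar>measure \<nu> A - measure \<eta> A\<bar>)"

end

theory Submission
  imports Defs
begin

text \<open>Positions at the observed times satisfy \<open>q t = x + t *\<^sub>R v - J (\<lambda>s. grad U (q s)) t\<close> with a linear
  operator \<open>J\<close> of norm at most \<open>T\<^sup>2\<close>, both for the exact flow and for the Verlet scheme. Since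
  \<open>L * T\<^sup>2 \<le> 1 / 6\<close>, all estimates are contraction estimates: the velocity-to-position maps are
  diffeomorphisms, and \<open>\<Phi>\<close>, which matches two of them, satisfies
  \<open>\<bar>\<Phi> v - v\<bar> \<le> 5 / 4 * \<bar>x - y\<bar> / T\<close> and \<open>\<bar>D\<Phi>\<^sup>\<plusminus>\<^sup>1 - I\<bar> \<le> 27 / 10 * L_H * T\<^sup>2 * \<bar>x - y\<bar>\<close>.

  For a map with \<open>\<bar>\<Phi> v - v\<bar> \<le> \<beta>\<close> and \<open>\<bar>D\<Phi>\<^sup>\<plusminus>\<^sup>1 - I\<bar> \<le> b\<close> the logarithm of the density of the Gaussian
  pulled back by \<open>\<Phi>\<close> is \<open>- v \<bullet> (\<Phi> v - v) + tr (D\<Phi> v - I)\<close> up to an error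
  \<open>\<beta>\<^sup>2 / 2 + 3 / 2 * d * b\<^sup>2\<close>. The first two terms have Gaussian mean zero by integration by parts, and
  the total variation distance is at most the square root of the error by comparison with the
  Hellinger distance.\<close>

section \<open>Gaussian integration by parts\<close>

text \<open>The first inequality is data processing: both kernels are images under the endpoint map
  of \<open>y\<close>, one of the law of \<open>\<Phi> \<xi>\<close> and the other of the law of
  \<open>\<xi>\<close>. The obstacle in the second is that \<open>x - y\<close> is arbitrary, so the
  bound \<open>b\<close> on \<open>D\<Phi> - I\<close> may exceed 1 and no power series for
  \<open>ln (det D\<Phi>)\<close> can be used. Instead the determinant is bounded below through the
  determinant of the inverse, for which a Gaussian integral gives an upper bound valid for every
  linear map; this is why \<open>D\<Phi>\<close> and its inverse are both controlled. The
  log-density is thus bounded from one side only, and that is enough: the Hellinger affinity needs a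
  lower bound for the square root of the density ratio, and \<open>exp t \<ge> 1 + t\<close> leaves
  only the Gaussian mean of the exponent. The constant 27/10 is (6/5)(3/2)(6/5) / (4/5): the factor
  1 / (1 - 1/6) of a contraction, the distance of two paths with a common endpoint, the growth of a
  linearised path, and the expansion rate of the endpoint map.\<close>

definition gauss :: "real ^ 'n \<Rightarrow> real"
  where "gauss v = (\<Prod>i\<in>UNIV. std_normal_density (v $ i))"

lemma gauss_eq:
  "gauss (v :: real ^ 'n) = (1 / sqrt (2 * pi)) ^ CARD('n) * exp (- (norm v)\<^sup>2 / 2)"
proof -
  have "(norm v)\<^sup>2 = (\<Sum>i\<in>UNIV. (v $ i)\<^sup>2)"
    by (simp add: norm_vec_def L2_set_def sum_nonneg)
  then have "exp (- (norm v)\<^sup>2 / 2) = (\<Prod>i\<in>UNIV. exp (- (v $ i)\<^sup>2 / 2))"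
    by (simp add: exp_sum[symmetric] sum_negf sum_divide_distrib)
  then show ?thesis
    by (simp add: gauss_def std_normal_density_def prod_dividef prod.distrib power_divide)
qed

lemma gauss_pos: "0 < gauss v"
  by (simp add: gauss_eq)

lemma gauss_measurable [measurable]: "gauss \<in> borel_measurable borel"
  unfolding gauss_eq by measurable

lemma prod_Basis_vec:
  "(\<Prod>b\<in>(Basis :: (real ^ 'n) set). f (x \<bullet> b)) = (\<Prod>i\<in>UNIV. f (x $ i))"
proof -
  have B: "(Basis :: (real ^ 'n) set) = range (\<lambda>i. axis i 1)"
    by (auto simp: Basis_vec_def)
  have "inj (\<lambda>i::'n. axis i (1::real))"
    by (auto simp: inj_on_def axis_eq_axis)
  then show ?thesis
    unfolding B by (subst prod.reindex) (auto simp: inner_axis)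
qed

lemma integrable_gauss: "integrable lborel (gauss :: real ^ 'n \<Rightarrow> real)"
  and integral_gauss: "(\<integral>v. gauss (v :: real ^ 'n) \<partial>lborel) = 1"
proof -
  have "(\<integral>\<^sup>+ v. ennreal (gauss (v :: real ^ 'n)) \<partial>lborel)
      = (\<integral>\<^sup>+ v. (\<Prod>b\<in>Basis. ennreal (std_normal_density (v \<bullet> b))) \<partial>(lborel :: (real ^ 'n) measure))"
    by (simp add: prod_Basis_vec gauss_def prod_ennreal)
  also have "\<dots> = (\<Prod>b\<in>(Basis :: (real ^ 'n) set). \<integral>\<^sup>+ x. ennreal (std_normal_density x) \<partial>lborel)"
    by (rule nn_integral_lborel_prod) auto
  also have "(\<integral>\<^sup>+ x. ennreal (std_normal_density x) \<partial>lborel) = 1"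
    by (subst nn_integral_eq_integral) auto
  finally have "(\<integral>\<^sup>+ v. ennreal (gauss (v :: real ^ 'n)) \<partial>lborel) = ennreal 1" by simp
  then have "has_bochner_integral lborel (gauss :: real ^ 'n \<Rightarrow> real) 1"
    by (intro has_bochner_integral_nn_integral) (auto simp: gauss_pos less_imp_le)
  then show "integrable lborel (gauss :: real ^ 'n \<Rightarrow> real)"
      and "(\<integral>v. gauss (v :: real ^ 'n) \<partial>lborel) = 1"
    by (auto simp: has_bochner_integral_iff)
qed

lemma lborel_integral_translate:
  fixes f :: "'a::euclidean_space \<Rightarrow> real"
  assumes [measurable]: "f \<in> borel_measurable borel"
  shows "(\<integral>v. f (c + v) \<partial>lborel) = (\<integral>v. f v \<partial>lborel)"
    and "integrable lborel f \<Longrightarrow> integrable lborel (\<lambda>v. f (c + v))"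
proof -
  have *: "distr lborel borel ((+) c) = (lborel :: 'a measure)"
    using lborel_distr_plus[of c] by (simp add: comp_def)
  show "(\<integral>v. f (c + v) \<partial>lborel) = (\<integral>v. f v \<partial>lborel)"
    by (subst (2) *[symmetric], subst integral_distr) auto
  show "integrable lborel f \<Longrightarrow> integrable lborel (\<lambda>v. f (c + v))"
    by (subst (asm) *[symmetric], subst (asm) integrable_distr_eq) auto
qed

text \<open>Up to a constant this function is \<open>gauss ((1/2) *\<^sub>R v)\<close>, so an affine
  change of variables reduces it to \<open>integrable_gauss\<close>. It serves as the common
  majorant below; the exponent 1/8 instead of 1/2 leaves room for a bounded shift and a quadratic
  factor.\<close>

lemma integrable_exp_neg_norm_sq:
  "integrable lborel (\<lambda>v :: real ^ 'n. exp (- (norm v)\<^sup>2 / 8))"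
proof -
  let ?g = "gauss :: real ^ 'n \<Rightarrow> real"
  have "integrable lborel ?g" by (rule integrable_gauss)
  then have "integrable (density (distr lborel borel (\<lambda>x. 0 + (1/2) *\<^sub>R x)) (\<lambda>_. ennreal (\<bar>1/2\<bar> ^ DIM(real ^ 'n)))) ?g"
    by (subst (asm) lborel_affine[of "1/2" 0]) auto
  then have "integrable lborel (\<lambda>v. (1/2) ^ DIM(real ^ 'n) * ?g ((1/2) *\<^sub>R v))"
    by (subst (asm) integrable_density, simp_all, subst (asm) integrable_distr_eq, simp_all)
  then have "integrable lborel (\<lambda>v. ?g ((1/2) *\<^sub>R v))"
    by simp
  then have "integrable lborel (\<lambda>v :: real ^ 'n. (1 / sqrt (2 * pi)) ^ CARD('n) * exp (- (norm v)\<^sup>2 / 8))"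
    by (simp add: gauss_eq power_divide)
  then have "integrable lborel (\<lambda>v :: real ^ 'n. sqrt (2 * pi) ^ CARD('n) *
      ((1 / sqrt (2 * pi)) ^ CARD('n) * exp (- (norm v)\<^sup>2 / 8)))"
    by (rule integrable_mult_right)
  then show ?thesis
    by (simp add: power_divide)
qed

text \<open>A quadratic factor costs half of the exponent: \<open>(1 + r)\<^sup>2\<close> is at most
  \<open>2 + 2 * r\<^sup>2\<close>, and \<open>1 + s \<le> exp s\<close> at
  \<open>s = r\<^sup>2 / 8\<close> bounds this by \<open>(2 + 16) * exp s\<close>.\<close>

lemma poly_exp_bound:
  fixes r :: real
  shows "(1 + r)\<^sup>2 * exp (- r\<^sup>2 / 4) \<le> 18 * exp (- r\<^sup>2 / 8)"
proof -
  have e: "1 + r\<^sup>2 / 8 \<le> exp (r\<^sup>2 / 8)" by (rule exp_ge_add_one_self)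
  have "2 * (1 * r) \<le> 1\<^sup>2 + r\<^sup>2" using sum_squares_bound[of 1 r] by simp
  then have "(1 + r)\<^sup>2 \<le> 2 + 2 * r\<^sup>2" by (simp add: power2_sum)
  also have "\<dots> \<le> 18 * exp (r\<^sup>2 / 8)" using e zero_le_power2[of r] by linarith
  finally have "(1 + r)\<^sup>2 * exp (- r\<^sup>2 / 4) \<le> 18 * exp (r\<^sup>2 / 8) * exp (- r\<^sup>2 / 4)"
    by (rule mult_right_mono) simp
  also have "\<dots> = 18 * exp (- r\<^sup>2 / 8)" by (simp add: mult_exp_exp)
  finally show ?thesis .
qed

text \<open>A majorant that is uniform over all shifts of length at most 1, needed to dominate
  difference quotients. The shift lowers the exponent from 1/2 to 1/4 and contributes
  \<open>exp (1/2)\<close>; the quadratic factor lowers it to 1/8 by \<open>poly_exp_bound\<close>,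
  and 72 is 4 * 18.\<close>

lemma gauss_shift_bound:
  fixes v e :: "real ^ 'n"
  assumes "norm e \<le> 1"
  shows "(1 + norm (v + e))\<^sup>2 * gauss (v + e)
    \<le> (1 / sqrt (2 * pi)) ^ CARD('n) * (72 * exp (1/2)) * exp (- (norm v)\<^sup>2 / 8)"
proof -
  let ?r = "norm v"
  have "norm v \<le> norm (v + e) + norm e" using norm_triangle_ineq4[of "v + e" e] by simp
  then have "?r\<^sup>2 \<le> (norm (v + e) + norm e)\<^sup>2" by (intro power_mono) auto
  also have "\<dots> \<le> 2 * (norm (v + e))\<^sup>2 + 2 * (norm e)\<^sup>2"
    using sum_squares_bound[of "norm (v + e)" "norm e"] by (simp add: power2_sum)
  also have "(norm e)\<^sup>2 \<le> 1" using assms by (simp add: power_le_one)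
  finally have a: "- (norm (v + e))\<^sup>2 / 2 \<le> 1/2 + - ?r\<^sup>2 / 4" by simp
  have "1 + norm (v + e) \<le> 2 * (1 + ?r)" using norm_triangle_ineq[of v e] assms norm_ge_zero[of v] by (smt (verit))
  then have "(1 + norm (v + e))\<^sup>2 \<le> (2 * (1 + ?r))\<^sup>2" by (intro power_mono) auto
  then have "(1 + norm (v + e))\<^sup>2 \<le> 4 * (1 + ?r)\<^sup>2" by (simp only: power_mult_distrib) simp
  then have "(1 + norm (v + e))\<^sup>2 * exp (- (norm (v + e))\<^sup>2 / 2)
      \<le> (4 * (1 + ?r)\<^sup>2) * exp (1/2 + - ?r\<^sup>2 / 4)"
    using a by (intro mult_mono) auto
  also have "\<dots> = 4 * exp (1/2) * ((1 + ?r)\<^sup>2 * exp (- ?r\<^sup>2 / 4))"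
    unfolding exp_add by simp
  also have "\<dots> \<le> 4 * exp (1/2) * (18 * exp (- ?r\<^sup>2 / 8))"
    by (intro mult_left_mono poly_exp_bound) auto
  finally have "(1 / sqrt (2 * pi)) ^ CARD('n) * ((1 + norm (v + e))\<^sup>2 * exp (- (norm (v + e))\<^sup>2 / 2))
     \<le> (1 / sqrt (2 * pi)) ^ CARD('n) * (4 * exp (1/2) * (18 * exp (- ?r\<^sup>2 / 8)))"
    by (intro mult_left_mono) auto
  then show ?thesis
    unfolding gauss_eq by (simp add: mult_ac)
qed

lemma integrable_gauss_quadratic_growth:
  fixes f :: "real ^ 'n \<Rightarrow> real"
  assumes [measurable]: "f \<in> borel_measurable borel"
    and bd: "\<And>v. \<bar>f v\<bar> \<le> K * (1 + norm v)\<^sup>2"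
  shows "integrable lborel (\<lambda>v. f v * gauss v)"
proof (rule Bochner_Integration.integrable_bound)
  let ?c = "(1 / sqrt (2 * pi)) ^ CARD('n) * (72 * exp (1/2))"
  have K: "0 \<le> K" using bd[of 0] by simp
  show "integrable lborel (\<lambda>v :: real ^ 'n. K * (?c * exp (- (norm v)\<^sup>2 / 8)))"
    using integrable_exp_neg_norm_sq by (intro integrable_mult_right) auto
  show "AE v in lborel. norm (f v * gauss v) \<le> norm (K * (?c * exp (- (norm v)\<^sup>2 / 8)))"
  proof (rule AE_I2)
    fix v :: "real ^ 'n"
    have "\<bar>f v\<bar> * gauss v \<le> (K * (1 + norm v)\<^sup>2) * gauss v"
      using bd gauss_pos[of v] by (intro mult_right_mono) auto
    also have "\<dots> \<le> K * (?c * exp (- (norm v)\<^sup>2 / 8))"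
      using gauss_shift_bound[of 0 v] K by (simp add: mult.assoc mult_left_mono)
    finally show "norm (f v * gauss v) \<le> norm (K * (?c * exp (- (norm v)\<^sup>2 / 8)))"
      using gauss_pos[of v] K by (simp add: abs_mult)
  qed
qed auto

lemma gauss_has_derivative_along:
  "((\<lambda>t. gauss (v + t *\<^sub>R e)) has_real_derivative - ((v + t *\<^sub>R e) \<bullet> e) * gauss (v + t *\<^sub>R e)) (at t)"
proof -
  have *: "((\<lambda>t. (v + t *\<^sub>R e) \<bullet> (v + t *\<^sub>R e)) has_real_derivative 2 * ((v + t *\<^sub>R e) \<bullet> e)) (at t)"
    unfolding has_field_derivative_def
    by (auto intro!: derivative_eq_intros simp: fun_eq_iff algebra_simps inner_commute)
  show ?thesis
    unfolding gauss_eq power2_norm_eq_inner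
    by (rule derivative_eq_intros * refl | simp)+
qed

text \<open>Integration by parts from translation invariance of Lebesgue measure: the integral of
  \<open>k (v + t *\<^sub>R e)\<close>, with \<open>k = f * gauss\<close>, does not depend on \<open>t\<close>; differentiate at \<open>t = 0\<close>.\<close>

lemma gaussian_integration_by_parts:
  fixes f f' :: "real ^ 'n \<Rightarrow> real" and e :: "real ^ 'n"
  assumes cont: "continuous_on UNIV f"
    and e: "norm e \<le> 1"
    and der: "\<And>v. ((\<lambda>t. f (v + t *\<^sub>R e)) has_real_derivative f' v) (at 0)"
    and bd: "\<And>v. \<bar>f v\<bar> \<le> K * (1 + norm v)"
    and bd': "\<And>v. \<bar>f' v\<bar> \<le> K * (1 + norm v)"
  shows "integrable lborel (\<lambda>v. f' v * gauss v)"
    and "integrable lborel (\<lambda>v. (v \<bullet> e) * f v * gauss v)"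
    and "(\<integral>v. f' v * gauss v \<partial>lborel) = (\<integral>v. (v \<bullet> e) * f v * gauss v \<partial>lborel)"
proof -
  define s where "s n = inverse (real (Suc n))" for n
  have s: "0 < s n" "s n \<le> 1" for n by (auto simp: s_def inverse_le_1_iff)
  have s0: "filterlim s (at 0) sequentially"
    unfolding filterlim_at using LIMSEQ_inverse_real_of_nat s(1)
    by (auto simp: s_def[abs_def])
  have K: "0 \<le> K" using bd[of 0] by simp
  have f_meas[measurable]: "f \<in> borel_measurable borel"
    using cont by (rule borel_measurable_continuous_onI)
  have der_t: "((\<lambda>t. f (v + t *\<^sub>R e)) has_real_derivative f' (v + t *\<^sub>R e)) (at t)" for v t
  proof -
    have "((\<lambda>a. f ((v + t *\<^sub>R e) + a *\<^sub>R e)) has_real_derivative f' (v + t *\<^sub>R e)) (at (t + - t))"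
      using der[of "v + t *\<^sub>R e"] by simp
    then have "((\<lambda>a. f ((v + t *\<^sub>R e) + (a + - t) *\<^sub>R e)) has_real_derivative f' (v + t *\<^sub>R e)) (at t)"
      by (subst (asm) DERIV_shift) 
    then show ?thesis by (simp add: algebra_simps)
  qed
  have f'_lim: "(\<lambda>n. (f (v + s n *\<^sub>R e) - f v) / s n) \<longlonglongrightarrow> f' v" for v
  proof -
    have "((\<lambda>t. (f (v + t *\<^sub>R e) - f v) / t) \<longlongrightarrow> f' v) (at 0)"
      using der[of v] by (simp add: DERIV_def)
    then show ?thesis by (rule filterlim_compose) (rule s0)
  qed
  \<comment> \<open>\<open>f'\<close> is given only pointwise, so its measurability is read off from
    the difference quotients along \<open>s n\<close>.\<close>
  have f'_meas[measurable]: "f' \<in> borel_measurable borel"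
    by (rule borel_measurable_LIMSEQ_real[OF f'_lim]) measurable
  have bd2: "\<bar>f' v\<bar> \<le> K * (1 + norm v)\<^sup>2" for v
  proof -
    have "K * (1 + norm v) * 1 \<le> K * (1 + norm v) * (1 + norm v)"
      using K by (intro mult_left_mono) auto
    then show ?thesis using bd'[of v] by (simp add: power2_eq_square mult.assoc)
  qed
  have ve: "\<bar>v \<bullet> e\<bar> \<le> norm v" for v
    using Cauchy_Schwarz_ineq2[of v e] mult_left_mono[OF e norm_ge_zero[of v]] by simp
  have bd3: "\<bar>(v \<bullet> e) * f v\<bar> \<le> K * (1 + norm v)\<^sup>2" for v
  proof -
    have "\<bar>v \<bullet> e\<bar> * \<bar>f v\<bar> \<le> (1 + norm v) * (K * (1 + norm v))"
      using ve[of v] bd[of v] by (intro mult_mono) auto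
    then show ?thesis by (simp add: power2_eq_square abs_mult mult_ac)
  qed
  show i1: "integrable lborel (\<lambda>v. f' v * gauss v)"
    by (rule integrable_gauss_quadratic_growth[OF f'_meas bd2])
  show i2: "integrable lborel (\<lambda>v. (v \<bullet> e) * f v * gauss v)"
    by (rule integrable_gauss_quadratic_growth[OF _ bd3]) measurable
  define k where "k v = f v * gauss v" for v
  define k' where "k' v = f' v * gauss v - (v \<bullet> e) * f v * gauss v" for v
  have [measurable]: "k \<in> borel_measurable borel" "k' \<in> borel_measurable borel"
    unfolding k_def k'_def by measurable
  have k_int: "integrable lborel k"
    unfolding k_def
  proof (rule integrable_gauss_quadratic_growth[OF f_meas])
    show "\<bar>f v\<bar> \<le> K * (1 + norm v)\<^sup>2" for v
    proof -
      have "K * (1 + norm v) * 1 \<le> K * (1 + norm v) * (1 + norm v)"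
        using K by (intro mult_left_mono) auto
      then show ?thesis using bd[of v] by (simp add: power2_eq_square mult.assoc)
    qed
  qed
  have der_k: "((\<lambda>t. k (v + t *\<^sub>R e)) has_real_derivative k' (v + t *\<^sub>R e)) (at t)" for v t
    unfolding k_def k'_def
    by (rule derivative_eq_intros der_t gauss_has_derivative_along refl)+ (simp add: algebra_simps)
  have k'_bd: "\<bar>k' v\<bar> \<le> 2 * K * ((1 + norm v)\<^sup>2 * gauss v)" for v
  proof -
    have "\<bar>k' v\<bar> \<le> \<bar>f' v\<bar> * gauss v + \<bar>(v \<bullet> e) * f v\<bar> * gauss v"
      unfolding k'_def using abs_triangle_ineq4[of "f' v * gauss v" "(v \<bullet> e) * f v * gauss v"] gauss_pos[of v]
      by (simp add: abs_mult)
    also have "\<dots> \<le> (K * (1 + norm v)\<^sup>2) * gauss v + (K * (1 + norm v)\<^sup>2) * gauss v"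
      using bd2[of v] bd3[of v] gauss_pos[of v] by (intro add_mono mult_right_mono) auto
    finally show ?thesis by (simp add: mult_ac)
  qed
  let ?c = "(1 / sqrt (2 * pi)) ^ CARD('n) * (72 * exp (1/2))"
  define W where "W v = 2 * K * (?c * exp (- (norm v)\<^sup>2 / 8))" for v :: "real ^ 'n"
  have W_int: "integrable lborel W"
    unfolding W_def using integrable_exp_neg_norm_sq by (intro integrable_mult_right) auto
  \<comment> \<open>The mean value theorem replaces the quotient by \<open>k'\<close> at a point
    shifted by at most one unit, so the majorant \<open>W\<close> does not depend on
    \<open>n\<close>.\<close>
  have quot_bd: "norm ((k (v + s n *\<^sub>R e) - k v) / s n) \<le> W v" for n v
  proof -
    obtain z where z: "0 < z" "z < s n"
      and eq: "k (v + s n *\<^sub>R e) - k (v + 0 *\<^sub>R e) = (s n - 0) * k' (v + z *\<^sub>R e)"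
      using MVT2[OF s(1)[of n], of "\<lambda>t. k (v + t *\<^sub>R e)" "\<lambda>t. k' (v + t *\<^sub>R e)"] der_k by blast
    have "norm (z *\<^sub>R e) \<le> 1" using z s(2)[of n] e by (simp add: mult_le_one)
    then have "2 * K * ((1 + norm (v + z *\<^sub>R e))\<^sup>2 * gauss (v + z *\<^sub>R e)) \<le> W v"
      unfolding W_def using K by (intro mult_left_mono gauss_shift_bound) auto
    then have "\<bar>k' (v + z *\<^sub>R e)\<bar> \<le> W v"
      using k'_bd[of "v + z *\<^sub>R e"] by simp
    then show ?thesis using eq s(1)[of n] by (simp add: abs_mult)
  qed
  have quot_lim: "(\<lambda>n. (k (v + s n *\<^sub>R e) - k v) / s n) \<longlonglongrightarrow> k' v" for v
  proof -
    have "((\<lambda>t. (k (v + t *\<^sub>R e) - k v) / t) \<longlongrightarrow> k' v) (at 0)"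
      using der_k[of v 0] by (simp add: DERIV_def)
    then show ?thesis by (rule filterlim_compose) (rule s0)
  qed
  have "(\<lambda>n. \<integral>v. (k (v + s n *\<^sub>R e) - k v) / s n \<partial>lborel) \<longlonglongrightarrow> (\<integral>v. k' v \<partial>lborel)"
    by (rule integral_dominated_convergence[where w = W]) (use W_int quot_bd quot_lim in auto)
  moreover have "(\<integral>v. (k (v + s n *\<^sub>R e) - k v) / s n \<partial>lborel) = 0" for n
    using lborel_integral_translate[of k "s n *\<^sub>R e"] k_int
    by (simp add: add.commute)
  ultimately have "(\<lambda>n. 0) \<longlonglongrightarrow> (\<integral>v. k' v \<partial>lborel)"
    by (simp only:)
  then have "(\<integral>v. k' v \<partial>lborel) = 0"
    by (simp add: LIMSEQ_const_iff)
  then show "(\<integral>v. f' v * gauss v \<partial>lborel) = (\<integral>v. (v \<bullet> e) * f v * gauss v \<partial>lborel)"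
    unfolding k'_def using i1 i2 by simp
qed

section \<open>Change of variables and determinants\<close>

text \<open>A directional derivative is a pointwise limit of difference quotients of a continuous
  map. This is what makes the Jacobian determinant, hence the pulled back density,
  measurable.\<close>

lemma borel_measurable_has_derivative:
  fixes \<Phi> :: "'a::euclidean_space \<Rightarrow> 'b::euclidean_space"
  assumes "\<And>v. (\<Phi> has_derivative A v) (at v)"
  shows "(\<lambda>v. A v u) \<in> borel_measurable borel"
proof -
  have "continuous_on UNIV \<Phi>"
    using assms by (meson continuous_at_imp_continuous_on has_derivative_continuous)
  then have [measurable]: "\<Phi> \<in> borel_measurable borel"
    by (rule borel_measurable_continuous_onI)
  define s where "s n = inverse (real (Suc n))" for n
  have s0: "filterlim s (at 0) sequentially"
    unfolding filterlim_at using LIMSEQ_inverse_real_of_nat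
    by (auto simp: s_def[abs_def])
  have "(\<lambda>v. A v u \<bullet> b) \<in> borel_measurable borel" for b
  proof (rule borel_measurable_LIMSEQ_real)
    show "(\<lambda>n. (\<Phi> (v + s n *\<^sub>R u) \<bullet> b - \<Phi> v \<bullet> b) / s n) \<longlonglongrightarrow> A v u \<bullet> b" for v
    proof -
      have lin: "linear (A v)" using assms has_derivative_linear by blast
      have "((\<lambda>t. \<Phi> (v + t *\<^sub>R u)) has_derivative (\<lambda>t. A v (t *\<^sub>R u))) (at 0)"
        by (rule has_derivative_compose[of "\<lambda>t. v + t *\<^sub>R u" "\<lambda>t. t *\<^sub>R u" 0 UNIV \<Phi> "A v"])
          (use assms in \<open>auto intro!: derivative_eq_intros\<close>)
      then have "((\<lambda>t. \<Phi> (v + t *\<^sub>R u) \<bullet> b) has_derivative (\<lambda>t. A v (t *\<^sub>R u) \<bullet> b)) (at 0)"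
        by (rule has_derivative_inner_left)
      then have "((\<lambda>t. \<Phi> (v + t *\<^sub>R u) \<bullet> b) has_real_derivative A v u \<bullet> b) (at 0)"
        by (simp add: has_field_derivative_def linear_cmul[OF lin] mult_commute_abs)
      then have "((\<lambda>t. (\<Phi> (v + t *\<^sub>R u) \<bullet> b - \<Phi> v \<bullet> b) / t) \<longlongrightarrow> A v u \<bullet> b) (at 0)"
        by (simp add: DERIV_def)
      then show ?thesis by (rule filterlim_compose) (rule s0)
    qed
  qed measurable
  then show ?thesis
    by (subst borel_measurable_euclidean_space) auto
qed

lemma borel_measurable_det_matrix:
  fixes \<Phi> :: "real ^ 'n \<Rightarrow> real ^ 'n"
  assumes "\<And>v. (\<Phi> has_derivative A v) (at v)"
  shows "(\<lambda>v. det (matrix (A v))) \<in> borel_measurable borel"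
proof -
  note [measurable] = borel_measurable_has_derivative[OF assms]
  have [measurable]: "(\<lambda>v. A v u $ i) \<in> borel_measurable borel" for u i
  proof -
    have "(\<lambda>v. A v u \<bullet> axis i 1) \<in> borel_measurable borel" by measurable
    then show ?thesis by (simp add: inner_axis)
  qed
  show ?thesis
    unfolding det_def matrix_def by (simp, measurable)
qed

lemma lborel_change_of_variables:
  fixes \<Phi> :: "real ^ 'n::{finite,wellorder} \<Rightarrow> real ^ 'n::{finite,wellorder}" and f :: "_ \<Rightarrow> real"
  assumes der: "\<And>v. (\<Phi> has_derivative A v) (at v)"
    and bij: "bij \<Phi>"
    and f: "integrable lborel f"
  shows "integrable lborel (\<lambda>v. \<bar>det (matrix (A v))\<bar> * f (\<Phi> v))"
    and "(\<integral>v. \<bar>det (matrix (A v))\<bar> * f (\<Phi> v) \<partial>lborel) = (\<integral>v. f v \<partial>lborel)"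
proof -
  have "continuous_on UNIV \<Phi>"
    using der by (meson continuous_at_imp_continuous_on has_derivative_continuous)
  then have [measurable]: "\<Phi> \<in> borel_measurable borel"
    by (rule borel_measurable_continuous_onI)
  note [measurable] = borel_measurable_det_matrix[OF der]
  have [measurable]: "f \<in> borel_measurable borel" using f by auto
  \<comment> \<open>The change of variables theorem concerns vector-valued functions and Lebesgue
    integrability, so \<open>f\<close> is packaged as a vector of dimension one and read back
    through its only component. Borel measurability of both integrands then allows the return from
    \<open>lebesgue\<close> to \<open>lborel\<close>.\<close>
  let ?F = "\<lambda>v. vec (f v) :: real ^ 1"
  let ?g = "\<lambda>v. \<bar>det (matrix (A v))\<bar> * f (\<Phi> v)"
  have i: "integrable lebesgue f" using f by (subst integrable_completion) auto
  have fi: "?F absolutely_integrable_on \<Phi> ` UNIV"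
    using i bij_is_surj[OF bij]
    by (subst absolutely_integrable_componentwise_iff)
       (auto simp: set_integrable_def Basis_vec_def inner_axis)
  have *: "(\<lambda>v. \<bar>det (matrix (A v))\<bar> *\<^sub>R ?F (\<Phi> v)) absolutely_integrable_on UNIV \<and>
     integral UNIV (\<lambda>v. \<bar>det (matrix (A v))\<bar> *\<^sub>R ?F (\<Phi> v)) = integral (\<Phi> ` UNIV) ?F"
    by (subst has_absolute_integral_change_of_variables)
       (use der bij fi in \<open>auto simp: bij_is_inj\<close>)
  have "(\<lambda>v. (\<bar>det (matrix (A v))\<bar> *\<^sub>R ?F (\<Phi> v)) \<bullet> axis 1 1) absolutely_integrable_on UNIV"
    using * by (subst (asm) absolutely_integrable_componentwise_iff) (auto simp: Basis_vec_def)
  then have gi: "integrable lebesgue ?g"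
    by (simp add: set_integrable_def inner_axis)
  then show gl: "integrable lborel ?g"
    by (subst (asm) integrable_completion) auto
  have "integral UNIV (\<lambda>v. (\<bar>det (matrix (A v))\<bar> *\<^sub>R ?F (\<Phi> v)) \<bullet> axis 1 1) = integral UNIV (\<lambda>v. ?F v \<bullet> axis 1 1)"
    using * fi bij_is_surj[OF bij] 
    by (subst (1 2) integral_component_eq)
       (auto dest: set_lebesgue_integral_eq_integral(1))
  then show "(\<integral>v. ?g v \<partial>lborel) = (\<integral>v. f v \<partial>lborel)"
    using gl f by (simp add: inner_axis integral_lborel)
qed

section \<open>Determinant bounds from Gaussian second moments\<close>

text \<open>Integration by parts in direction \<open>e i\<close>, applied to
  \<open>A v \<bullet> A (e i)\<close>, whose derivative in that direction is the constant
  \<open>(norm (A (e i)))\<^sup>2\<close>. Summing over \<open>i\<close> restores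
  \<open>A v \<bullet> A v\<close>, because \<open>v\<close> is the sum of its coordinates times
  \<open>e i\<close>.\<close>

lemma gauss_second_moment:
  fixes A :: "real ^ 'n \<Rightarrow> real ^ 'n"
  assumes "linear A"
  shows "integrable lborel (\<lambda>v. (norm (A v))\<^sup>2 * gauss v)"
    and "(\<integral>v. (norm (A v))\<^sup>2 * gauss v \<partial>lborel) = (\<Sum>i\<in>UNIV. (norm (A (axis i 1)))\<^sup>2)"
proof -
  interpret A: linear A by fact
  have bl: "bounded_linear A" using assms by (simp add: linear_conv_bounded_linear)
  define e where "e i = (axis i 1 :: real ^ 'n)" for i
  have ne: "norm (e i) = 1" for i by (simp add: e_def)
  have ibp: "integrable lborel (\<lambda>v. (norm (A (e i)))\<^sup>2 * gauss (v :: real ^ 'n))"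
     "integrable lborel (\<lambda>v. (v \<bullet> e i) * (A v \<bullet> A (e i)) * gauss v)"
     "(\<integral>v. (norm (A (e i)))\<^sup>2 * gauss (v :: real ^ 'n) \<partial>lborel) = (\<integral>v. (v \<bullet> e i) * (A v \<bullet> A (e i)) * gauss v \<partial>lborel)" for i
  proof -
    have c: "continuous_on UNIV (\<lambda>v. A v \<bullet> A (e i))"
      by (intro continuous_intros bounded_linear.continuous_on[OF bl])
    have d: "((\<lambda>t. A (v + t *\<^sub>R e i) \<bullet> A (e i)) has_real_derivative (norm (A (e i)))\<^sup>2) (at 0)" for v
      by (auto intro!: derivative_eq_intros simp: A.add A.scale inner_add_left power2_norm_eq_inner)
    obtain B where B: "0 < B" "\<And>v. norm (A v) \<le> norm v * B"
      using bounded_linear.pos_bounded[OF bl] by auto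
    have nB: "norm (A (e i)) \<le> B" using B(2)[of "e i"] ne by simp
    have b1: "\<bar>A v \<bullet> A (e i)\<bar> \<le> B\<^sup>2 * (1 + norm v)" for v
    proof -
      have "\<bar>A v \<bullet> A (e i)\<bar> \<le> (norm v * B) * B"
        using Cauchy_Schwarz_ineq2[of "A v" "A (e i)"] mult_mono[OF B(2)[of v] nB] B(1) by simp
      also have "\<dots> \<le> B\<^sup>2 * (1 + norm v)" by (simp add: power2_eq_square algebra_simps)
      finally show ?thesis .
    qed
    have b2: "\<bar>(norm (A (e i)))\<^sup>2\<bar> \<le> B\<^sup>2 * (1 + norm v)" for v :: "real ^ 'n"
    proof -
      have "(norm (A (e i)))\<^sup>2 \<le> B\<^sup>2" using nB by (intro power_mono) auto
      also have "\<dots> \<le> B\<^sup>2 * (1 + norm v)" by (simp add: algebra_simps)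
      finally show ?thesis by simp
    qed
    note r = gaussian_integration_by_parts[OF c _ d b1 b2]
    show "integrable lborel (\<lambda>v. (norm (A (e i)))\<^sup>2 * gauss (v :: real ^ 'n))"
     "integrable lborel (\<lambda>v. (v \<bullet> e i) * (A v \<bullet> A (e i)) * gauss v)"
     "(\<integral>v. (norm (A (e i)))\<^sup>2 * gauss (v :: real ^ 'n) \<partial>lborel) = (\<integral>v. (v \<bullet> e i) * (A v \<bullet> A (e i)) * gauss v \<partial>lborel)"
      using r ne by simp_all
  qed
  have eq: "(norm (A v))\<^sup>2 = (\<Sum>i\<in>UNIV. (v \<bullet> e i) * (A v \<bullet> A (e i)))" for v
  proof -
    have "v = (\<Sum>i\<in>UNIV. (v $ i) *\<^sub>R e i)"
      by (simp add: e_def basis_expansion scalar_mult_eq_scaleR[symmetric])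
    then have "A v = (\<Sum>i\<in>UNIV. (v $ i) *\<^sub>R A (e i))"
      by (metis (no_types, lifting) A.sum A.scale sum.cong)
    then have "A v \<bullet> A v = (\<Sum>i\<in>UNIV. (v $ i) * (A v \<bullet> A (e i)))"
      by (metis (no_types, lifting) inner_sum_right inner_scaleR_right sum.cong)
    then show ?thesis by (simp add: power2_norm_eq_inner e_def inner_axis)
  qed
  show "integrable lborel (\<lambda>v. (norm (A v))\<^sup>2 * gauss v)"
    unfolding eq sum_distrib_right using ibp by (intro Bochner_Integration.integrable_sum) auto
  have "(\<integral>v. (norm (A v))\<^sup>2 * gauss v \<partial>lborel) = (\<Sum>i\<in>UNIV. \<integral>v. (norm (A (e i)))\<^sup>2 * gauss (v :: real ^ 'n) \<partial>lborel)"
    by (subst eq, subst sum_distrib_right, subst Bochner_Integration.integral_sum)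
      (simp_all only: ibp(2,3))
  also have "\<dots> = (\<Sum>i\<in>UNIV. (norm (A (e i)))\<^sup>2)"
    using integrable_gauss[where ?'n = 'n] integral_gauss[where ?'n = 'n] by simp
  finally show "(\<integral>v. (norm (A v))\<^sup>2 * gauss v \<partial>lborel) = (\<Sum>i\<in>UNIV. (norm (A (axis i 1)))\<^sup>2)"
    by (simp add: e_def)
qed

text \<open>Jensen's inequality applied to \<open>\<integral> \<bar>det A\<bar> * gauss (A v) dv = 1\<close>.\<close>

lemma abs_det_le_exp:
  fixes A :: "real ^ 'n::{finite,wellorder} \<Rightarrow> real ^ 'n::{finite,wellorder}"
  assumes "linear A"
  shows "\<bar>det (matrix A)\<bar> \<le> exp (((\<Sum>i\<in>UNIV. (norm (A (axis i 1)))\<^sup>2) - real CARD('n)) / 2)"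
proof (cases "det (matrix A) = 0")
  case False
  let ?F = "\<Sum>i\<in>UNIV. (norm (A (axis i 1)))\<^sup>2"
  let ?D = "\<bar>det (matrix A)\<bar>"
  \<comment> \<open>\<open>m\<close> is the Gaussian mean of
    \<open>((norm v)\<^sup>2 - (norm (A v))\<^sup>2) / 2\<close>, the logarithm of
    \<open>gauss (A v) / gauss v\<close>. With the exponent centred at \<open>m\<close>, the linear
    term of \<open>exp t \<ge> 1 + t\<close> integrates to zero.\<close>
  define m where "m = - (?F - real CARD('n)) / 2"
  have bl: "bounded_linear A" using assms by (simp add: linear_conv_bounded_linear)
  have "inj A" using False assms det_nz_iff_inj by blast
  then have bij: "bij A" using assms linear_injective_imp_surjective bij_def by blast
  note cov = lborel_change_of_variables[OF bounded_linear_imp_has_derivative[OF bl] bij integrable_gauss]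
  note mA = gauss_second_moment[OF assms]
  have m1: "integrable lborel (\<lambda>v :: real ^ 'n::{finite,wellorder}. (norm v)\<^sup>2 * gauss v)"
    "(\<integral>v. (norm v)\<^sup>2 * gauss (v :: real ^ 'n::{finite,wellorder}) \<partial>lborel) = real CARD('n)"
    using gauss_second_moment[OF linear_id] by simp_all
  have pt: "?D * (exp m * (gauss v + ((norm v)\<^sup>2 * gauss v / 2 - (norm (A v))\<^sup>2 * gauss v / 2 - m * gauss v))) \<le> ?D * gauss (A v)" for v
  proof -
    have "gauss (A v) = gauss v * (exp m * exp ((norm v)\<^sup>2 / 2 - (norm (A v))\<^sup>2 / 2 - m))"
      unfolding gauss_eq by (simp add: mult_exp_exp field_simps)
    also have "\<dots> \<ge> gauss v * (exp m * (1 + ((norm v)\<^sup>2 / 2 - (norm (A v))\<^sup>2 / 2 - m)))"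
      using gauss_pos[of v] by (intro mult_left_mono exp_ge_add_one_self) auto
    finally show ?thesis by (intro mult_left_mono) (auto simp: algebra_simps)
  qed
  have "(\<integral>v. ?D * (exp m * (gauss v + ((norm v)\<^sup>2 * gauss v / 2 - (norm (A v))\<^sup>2 * gauss v / 2 - m * gauss v))) \<partial>lborel)
     \<le> (\<integral>v. ?D * gauss (A v) \<partial>lborel)"
    using cov(1) pt
    by (intro integral_mono integrable_mult_right Bochner_Integration.integrable_add
        Bochner_Integration.integrable_diff integrable_divide integrable_gauss mA(1) m1(1)) auto
  also have "\<dots> = 1" using cov(2) integral_gauss by simp
  also have "(\<integral>v. ?D * (exp m * (gauss v + ((norm v)\<^sup>2 * gauss v / 2 - (norm (A v))\<^sup>2 * gauss v / 2 - m * gauss v))) \<partial>lborel)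
     = ?D * (exp m * (1 + (real CARD('n) / 2 - ?F / 2 - m * 1)))"
    using mA m1 integrable_gauss[where ?'n = 'n] integral_gauss[where ?'n = 'n] by simp
  also have "\<dots> = ?D * exp m" by (simp add: m_def field_simps)
  finally have "?D \<le> exp (- m)" by (simp add: exp_minus field_simps)
  moreover have "- m = (?F - real CARD('n)) / 2" by (simp add: m_def field_simps)
  ultimately show ?thesis by (simp only:)
qed simp

section \<open>Total variation distance to the image of a Gaussian\<close>

lemma std_gaussian_eq: "std_gaussian = density lborel (\<lambda>v. ennreal (gauss v))"
  by (simp add: std_gaussian_def gauss_def)

lemma prob_space_std_gaussian: "prob_space (std_gaussian :: (real ^ 'n) measure)"
proof
  show "emeasure std_gaussian (space (std_gaussian :: (real ^ 'n) measure)) = 1"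
    using nn_integral_eq_integral[OF integrable_gauss[where ?'n = 'n]] integral_gauss[where ?'n = 'n]
    by (simp add: std_gaussian_eq emeasure_density less_imp_le[OF gauss_pos])
qed

lemma sets_std_gaussian [simp, measurable_cong]: "sets std_gaussian = sets borel"
  and space_std_gaussian [simp]: "space std_gaussian = UNIV"
  by (auto simp: std_gaussian_def)

lemma measure_std_gaussian:
  assumes [measurable]: "S \<in> sets borel"
  shows "measure std_gaussian S = (\<integral>v. indicator S v * gauss v \<partial>lborel)"
proof -
  have "measure std_gaussian S = (\<integral>v. indicator S v \<partial>std_gaussian)" by simp
  also have "\<dots> = (\<integral>v. indicator S v * gauss v \<partial>lborel)"
    unfolding std_gaussian_eq
    by (subst integral_density) (auto simp: gauss_pos less_imp_le mult.commute)
  finally show ?thesis .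
qed

text \<open>\<open>X\<close> is the Gaussian divergence of \<open>g\<close> up to sign, that is, the
  adjoint of the gradient applied to \<open>g\<close>. Integration by parts in each coordinate
  equates the mean of \<open>v $ i * g v $ i\<close> with that of the i-th diagonal entry of the
  derivative.\<close>

lemma gaussian_divergence_mean_zero:
  fixes g :: "real ^ 'n \<Rightarrow> real ^ 'n"
  assumes der: "\<And>v. (g has_derivative B v) (at v)"
    and bd: "\<And>v. norm (g v) \<le> \<beta>"
    and bdB: "\<And>v u. norm (B v u) \<le> b * norm u"
    and b: "0 \<le> b"
  defines "X \<equiv> \<lambda>v. v \<bullet> g v - (\<Sum>i\<in>UNIV. B v (axis i 1) $ i)"
  shows "integrable lborel (\<lambda>v. X v * gauss v)"
    and "(\<integral>v. X v * gauss v \<partial>lborel) = 0"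
proof -
  define e where "e i = (axis i 1 :: real ^ 'n)" for i
  have ne: "norm (e i) = 1" for i by (simp add: e_def)
  have \<beta>: "0 \<le> \<beta>" using bd norm_ge_zero order_trans by blast
  have ibp: "integrable lborel (\<lambda>v. B v (e i) $ i * gauss v)"
    "integrable lborel (\<lambda>v. v $ i * g v $ i * gauss v)"
    "(\<integral>v. B v (e i) $ i * gauss v \<partial>lborel) = (\<integral>v. v $ i * g v $ i * gauss v \<partial>lborel)" for i
  proof -
    have cont: "continuous_on UNIV g"
      using der by (meson continuous_at_imp_continuous_on has_derivative_continuous)
    have c: "continuous_on UNIV (\<lambda>v. g v \<bullet> e i)"
      by (intro continuous_intros cont)
    have d: "((\<lambda>t. g (v + t *\<^sub>R e i) \<bullet> e i) has_real_derivative B v (e i) \<bullet> e i) (at 0)" for v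
    proof -
      have lin: "linear (B v)" using der has_derivative_linear by blast
      have "((\<lambda>t. g (v + t *\<^sub>R e i)) has_derivative (\<lambda>t. B v (t *\<^sub>R e i))) (at 0)"
        by (rule has_derivative_compose[of "\<lambda>t. v + t *\<^sub>R e i" "\<lambda>t. t *\<^sub>R e i" 0 UNIV g "B v"])
          (use der in \<open>auto intro!: derivative_eq_intros\<close>)
      then have "((\<lambda>t. g (v + t *\<^sub>R e i) \<bullet> e i) has_derivative (\<lambda>t. B v (t *\<^sub>R e i) \<bullet> e i)) (at 0)"
        by (rule has_derivative_inner_left)
      then show ?thesis
        by (simp add: has_field_derivative_def linear_cmul[OF lin] mult_commute_abs)
    qed
    have b1: "\<bar>g v \<bullet> e i\<bar> \<le> (\<beta> + b) * (1 + norm v)" for v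
    proof -
      have "\<bar>g v \<bullet> e i\<bar> \<le> \<beta>"
        using Cauchy_Schwarz_ineq2[of "g v" "e i"] ne bd[of v] by simp
      also have "\<dots> \<le> (\<beta> + b) * (1 + norm v)" using \<beta> b by (simp add: algebra_simps)
      finally show ?thesis .
    qed
    have b2: "\<bar>B v (e i) \<bullet> e i\<bar> \<le> (\<beta> + b) * (1 + norm v)" for v
    proof -
      have "\<bar>B v (e i) \<bullet> e i\<bar> \<le> b"
        using Cauchy_Schwarz_ineq2[of "B v (e i)" "e i"] ne bdB[of v "e i"] by simp
      also have "\<dots> \<le> (\<beta> + b) * (1 + norm v)" using \<beta> b by (simp add: algebra_simps)
      finally show ?thesis .
    qed
    note r = gaussian_integration_by_parts[OF c _ d b1 b2]
    show "integrable lborel (\<lambda>v. B v (e i) $ i * gauss v)"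
      "integrable lborel (\<lambda>v. v $ i * g v $ i * gauss v)"
      "(\<integral>v. B v (e i) $ i * gauss v \<partial>lborel) = (\<integral>v. v $ i * g v $ i * gauss v \<partial>lborel)"
      using r ne by (simp_all add: e_def inner_axis)
  qed
  have X: "X v * gauss v = (\<Sum>i\<in>UNIV. v $ i * g v $ i * gauss v - B v (e i) $ i * gauss v)" for v
    by (simp add: X_def inner_vec_def sum_subtractf sum_distrib_right left_diff_distrib e_def)
  show "integrable lborel (\<lambda>v. X v * gauss v)"
    unfolding X using ibp by auto
  show "(\<integral>v. X v * gauss v \<partial>lborel) = 0"
    unfolding X using ibp by (subst Bochner_Integration.integral_sum) auto
qed

text \<open>Since \<open>A'\<close> inverts \<open>A\<close>, \<open>A' - I\<close> equals
  \<open>- (A - I) - (A' - I) (A - I)\<close>, so passing from the trace of \<open>A' - I\<close> to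
  minus that of \<open>A - I\<close> costs \<open>b\<^sup>2\<close> per basis vector. Expanding
  \<open>(norm (A' e))\<^sup>2\<close> around \<open>e\<close> doubles this and adds another
  \<open>b\<^sup>2\<close>, hence the 3. No smallness of \<open>b\<close> enters.\<close>

lemma trace_inverse_bound:
  fixes A A' :: "real ^ 'n \<Rightarrow> real ^ 'n"
  assumes lin: "linear A'" and inv: "\<And>u. A' (A u) = u"
    and bA: "\<And>u. norm (A u - u) \<le> b * norm u" and bA': "\<And>u. norm (A' u - u) \<le> b * norm u"
    and b: "0 \<le> b"
  shows "((\<Sum>i\<in>UNIV. (norm (A' (axis i 1)))\<^sup>2) - real CARD('n)) / 2
    \<le> 3 / 2 * real CARD('n) * b\<^sup>2 - (\<Sum>i\<in>UNIV. (A (axis i 1) - axis i 1) $ i)"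
proof -
  have "(norm (A' (axis i 1)))\<^sup>2 - 1 \<le> 3 * b\<^sup>2 - 2 * (A (axis i 1) - axis i 1) $ i" for i
  proof -
    define e where "e = (axis i 1 :: real ^ 'n)"
    have ne: "norm e = 1" by (simp add: e_def)
    have dot: "z $ i = e \<bullet> z" for z by (simp add: e_def inner_axis')
    have "A' (A e - e) - (A e - e) = 2 *\<^sub>R e - A e - A' e"
      by (simp add: linear_diff[OF lin] inv scaleR_2)
    then have "e \<bullet> (A' (A e - e) - (A e - e)) = e \<bullet> (2 *\<^sub>R e - A e - A' e)"
      by (rule arg_cong)
    then have key: "e \<bullet> (A' e - e) = - (e \<bullet> (A e - e)) - e \<bullet> (A' (A e - e) - (A e - e))"
      by (simp add: inner_diff_right)
    have "norm (A' (A e - e) - (A e - e)) \<le> b * norm (A e - e)" by (rule bA')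
    also have "\<dots> \<le> b * b" using bA[of e] ne b by (intro mult_left_mono) auto
    finally have "\<bar>e \<bullet> (A' (A e - e) - (A e - e))\<bar> \<le> b\<^sup>2"
      using Cauchy_Schwarz_ineq2[of e "A' (A e - e) - (A e - e)"] ne by (simp add: power2_eq_square)
    then have "e \<bullet> (A' e - e) \<le> b\<^sup>2 - e \<bullet> (A e - e)" using key by linarith
    moreover have "(norm (A' e))\<^sup>2 = 1 + 2 * (e \<bullet> (A' e - e)) + (norm (A' e - e))\<^sup>2"
      using ne by (simp add: power2_norm_eq_inner inner_diff_left inner_diff_right inner_commute norm_eq_1)
    moreover have "(norm (A' e - e))\<^sup>2 \<le> b\<^sup>2"
      using bA'[of e] ne by (intro power_mono) auto
    ultimately have "(norm (A' e))\<^sup>2 - 1 \<le> 3 * b\<^sup>2 - 2 * (e \<bullet> (A e - e))" by linarith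
    then show ?thesis unfolding dot e_def .
  qed
  then have "(\<Sum>i\<in>UNIV. (norm (A' (axis i 1)))\<^sup>2 - 1) \<le> (\<Sum>i\<in>UNIV. 3 * b\<^sup>2 - 2 * (A (axis i 1) - axis i 1) $ i)"
    by (intro sum_mono)
  then show ?thesis
    by (simp only: sum_subtractf sum_distrib_left[symmetric]) simp
qed

text \<open>Young's inequality. Used pointwise on the factors of \<open>\<psi> - gauss\<close> =
  (difference of roots) times (sum of roots), it takes the place of the Cauchy-Schwarz inequality
  for integrals.\<close>

lemma mult_le_weighted_squares:
  fixes a c \<kappa> :: real
  assumes "0 < \<kappa>"
  shows "a * c \<le> a\<^sup>2 / \<kappa> + \<kappa> / 4 * c\<^sup>2"
proof -
  have "0 \<le> (2 * a - \<kappa> * c)\<^sup>2 / (4 * \<kappa>)" using assms by simp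
  also have "\<dots> = a\<^sup>2 / \<kappa> + \<kappa> / 4 * c\<^sup>2 - a * c"
    using assms by (simp add: power2_diff power_mult_distrib field_simps power2_eq_square)
  finally show ?thesis by simp
qed

text \<open>The Hellinger affinity of \<open>\<psi> = \<bar>det D\<Phi>\<bar> * gauss \<circ> \<Phi>\<close> and \<open>gauss\<close> is bounded below by
  \<open>1 - \<kappa>\<^sup>2 / 2\<close>: in \<open>ln (\<psi> / gauss) \<ge> - \<kappa>\<^sup>2 - X\<close> the term \<open>X v = v \<bullet> (\<Phi> v - v) - tr (D\<Phi> v - I)\<close>
  has Gaussian mean zero.\<close>

lemma gaussian_pushforward_wellorder:
  fixes \<Phi> :: "real ^ 'n::{finite,wellorder} \<Rightarrow> real ^ 'n::{finite,wellorder}"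
  assumes bij: "bij \<Phi>"
    and der: "\<And>v. (\<Phi> has_derivative A v) (at v)"
    and lin: "\<And>v. linear (A' v)" and inv: "\<And>v u. A' v (A v u) = u"
    and bd: "\<And>v. norm (\<Phi> v - v) \<le> \<beta>"
    and bA: "\<And>v u. norm (A v u - u) \<le> b * norm u"
    and bA': "\<And>v u. norm (A' v u - u) \<le> b * norm u"
    and \<beta>: "0 < \<beta>" and b: "0 \<le> b" and S[measurable]: "S \<in> sets borel"
  shows "\<bar>measure std_gaussian S - measure std_gaussian (\<Phi> -` S)\<bar>
    \<le> sqrt (\<beta>\<^sup>2 / 2 + 3 / 2 * real CARD('n) * b\<^sup>2)"
proof -
  define \<kappa> where "\<kappa> = sqrt (\<beta>\<^sup>2 / 2 + 3 / 2 * real CARD('n) * b\<^sup>2)"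
  have "0 < \<beta>\<^sup>2 / 2 + 3 / 2 * real CARD('n) * b\<^sup>2"
    using \<beta> b by (intro add_pos_nonneg) auto
  then have \<kappa>: "0 < \<kappa>" "\<kappa>\<^sup>2 = \<beta>\<^sup>2 / 2 + 3 / 2 * real CARD('n) * b\<^sup>2"
    by (auto simp: \<kappa>_def)
  define \<psi> where "\<psi> v = \<bar>det (matrix (A v))\<bar> * gauss (\<Phi> v)" for v
  have \<psi>0: "0 \<le> \<psi> v" for v using gauss_pos[of "\<Phi> v"] by (simp add: \<psi>_def)
  have "continuous_on UNIV \<Phi>"
    using der by (meson continuous_at_imp_continuous_on has_derivative_continuous)
  then have \<Phi>_meas[measurable]: "\<Phi> \<in> borel_measurable borel"
    by (rule borel_measurable_continuous_onI)
  note [measurable] = borel_measurable_det_matrix[OF der]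
  have [measurable]: "\<psi> \<in> borel_measurable borel" unfolding \<psi>_def by measurable
  have \<psi>_int: "integrable lborel \<psi>" and \<psi>_1: "(\<integral>v. \<psi> v \<partial>lborel) = 1"
    using lborel_change_of_variables[OF der bij integrable_gauss] integral_gauss
    by (simp_all add: \<psi>_def[abs_def])
  define X where "X v = v \<bullet> (\<Phi> v - v) - (\<Sum>i\<in>UNIV. (A v (axis i 1) - axis i 1) $ i)" for v
  have der': "((\<lambda>v. \<Phi> v - v) has_derivative (\<lambda>u. A v u - u)) (at v)" for v
    by (intro derivative_intros der)
  have X_int: "integrable lborel (\<lambda>v. X v * gauss v)" and X_0: "(\<integral>v. X v * gauss v \<partial>lborel) = 0"
    using gaussian_divergence_mean_zero[OF der' bd bA b] by (simp_all add: X_def)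
  have low: "gauss v * exp (- (\<kappa>\<^sup>2 + X v)) \<le> \<psi> v" for v
  proof -
    have linA: "linear (A v)" using der has_derivative_linear by blast
    have "matrix (A' v) ** matrix (A v) = mat 1"
      using matrix_compose[OF linA lin[of v]] by (simp add: comp_def inv matrix_id_mat_1 flip: id_def)
    then have "det (matrix (A' v)) * det (matrix (A v)) = 1"
      by (metis det_I det_mul)
    then have d1: "\<bar>det (matrix (A' v))\<bar> * \<bar>det (matrix (A v))\<bar> = 1"
      by (simp flip: abs_mult)
    let ?tr = "\<Sum>i\<in>UNIV. (A v (axis i 1) - axis i 1) $ i"
    \<comment> \<open>A lower bound for the determinant of \<open>A v\<close> is an upper bound for
      that of its inverse, and the latter is available for any linear map.\<close>
    have "\<bar>det (matrix (A' v))\<bar> \<le> exp (3 / 2 * real CARD('n) * b\<^sup>2 - ?tr)"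
      using abs_det_le_exp[OF lin[of v]] trace_inverse_bound[OF lin inv bA bA' b, of v]
      by (meson exp_le_cancel_iff order_trans)
    then have "1 \<le> exp (3 / 2 * real CARD('n) * b\<^sup>2 - ?tr) * \<bar>det (matrix (A v))\<bar>"
      using mult_right_mono[of _ _ "\<bar>det (matrix (A v))\<bar>"] d1 by fastforce
    then have det: "exp (?tr - 3 / 2 * real CARD('n) * b\<^sup>2) \<le> \<bar>det (matrix (A v))\<bar>"
      by (simp only: exp_diff) (simp add: field_simps)
    have "(norm (\<Phi> v))\<^sup>2 = (norm v)\<^sup>2 + 2 * (v \<bullet> (\<Phi> v - v)) + (norm (\<Phi> v - v))\<^sup>2"
      by (simp add: power2_norm_eq_inner inner_diff_left inner_diff_right inner_commute)
    moreover have "(norm (\<Phi> v - v))\<^sup>2 \<le> \<beta>\<^sup>2" using bd by (intro power_mono) auto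
    ultimately have "- (norm v)\<^sup>2 / 2 + - (v \<bullet> (\<Phi> v - v) + \<beta>\<^sup>2 / 2) \<le> - (norm (\<Phi> v))\<^sup>2 / 2" by simp
    then have "exp (- (norm v)\<^sup>2 / 2) * exp (- (v \<bullet> (\<Phi> v - v) + \<beta>\<^sup>2 / 2)) \<le> exp (- (norm (\<Phi> v))\<^sup>2 / 2)"
      by (simp only: mult_exp_exp exp_le_cancel_iff)
    then have ga: "gauss v * exp (- (v \<bullet> (\<Phi> v - v) + \<beta>\<^sup>2 / 2)) \<le> gauss (\<Phi> v)"
      unfolding gauss_eq mult.assoc by (intro mult_left_mono) auto
    have "gauss v * exp (- (\<kappa>\<^sup>2 + X v))
        = exp (?tr - 3 / 2 * real CARD('n) * b\<^sup>2) * (gauss v * exp (- (v \<bullet> (\<Phi> v - v) + \<beta>\<^sup>2 / 2)))"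
      unfolding \<kappa>(2) X_def mult.left_commute[of _ "gauss v"] mult_exp_exp by (simp add: algebra_simps)
    also have "\<dots> \<le> \<bar>det (matrix (A v))\<bar> * gauss (\<Phi> v)"
      using det ga gauss_pos[of v] by (intro mult_mono) auto
    finally show ?thesis by (simp add: \<psi>_def)
  qed
  define \<rho> where "\<rho> v = sqrt (\<psi> v) * sqrt (gauss v)" for v
  have [measurable]: "\<rho> \<in> borel_measurable borel" unfolding \<rho>_def by measurable
  have \<rho>_le: "2 * \<rho> v \<le> \<psi> v + gauss v" for v
    using sum_squares_bound[of "sqrt (\<psi> v)" "sqrt (gauss v)"] \<psi>0[of v] gauss_pos[of v]
    by (simp add: \<rho>_def)
  have \<rho>0: "0 \<le> \<rho> v" for v using \<psi>0[of v] gauss_pos[of v] by (simp add: \<rho>_def)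
  have \<rho>_int: "integrable lborel \<rho>"
  proof (rule Bochner_Integration.integrable_bound)
    show "integrable lborel (\<lambda>v. \<psi> v + gauss v)" using \<psi>_int integrable_gauss by auto
    show "AE v in lborel. norm (\<rho> v) \<le> norm (\<psi> v + gauss v)"
    proof (rule AE_I2)
      fix v show "norm (\<rho> v) \<le> norm (\<psi> v + gauss v)"
        using \<rho>_le[of v] \<rho>0[of v] by simp
    qed
  qed auto
  \<comment> \<open>The root halves the exponent of \<open>low\<close>; then
    \<open>exp t \<ge> 1 + t\<close> makes the bound affine in \<open>X\<close>, so that only the
    mean of \<open>X\<close>, which is zero, survives integration.\<close>
  have \<rho>_low: "gauss v - (\<kappa>\<^sup>2 / 2 * gauss v + X v * gauss v / 2) \<le> \<rho> v" for v
  proof -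
    have "gauss v - (\<kappa>\<^sup>2 / 2 * gauss v + X v * gauss v / 2) = gauss v * (1 + (- (\<kappa>\<^sup>2 + X v) / 2))"
      by (simp add: field_simps)
    also have "\<dots> \<le> gauss v * exp (- (\<kappa>\<^sup>2 + X v) / 2)"
      using gauss_pos[of v] by (intro mult_left_mono exp_ge_add_one_self) auto
    also have "\<dots> = sqrt ((gauss v * exp (- (\<kappa>\<^sup>2 + X v) / 2))\<^sup>2)"
      using gauss_pos[of v] by simp
    also have "(gauss v * exp (- (\<kappa>\<^sup>2 + X v) / 2))\<^sup>2 = gauss v * exp (- (\<kappa>\<^sup>2 + X v)) * gauss v"
      by (simp add: power_mult_distrib power2_eq_square mult_exp_exp field_simps)
    also have "sqrt \<dots> \<le> sqrt (\<psi> v * gauss v)"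
      using low[of v] gauss_pos[of v] by (intro real_sqrt_le_mono mult_right_mono) auto
    finally show ?thesis by (simp add: \<rho>_def real_sqrt_mult)
  qed
  have "1 - \<kappa>\<^sup>2 / 2 = (\<integral>v. gauss v - (\<kappa>\<^sup>2 / 2 * gauss v + X v * gauss v / 2) \<partial>lborel)"
    using integrable_gauss[where ?'n = 'n] integral_gauss[where ?'n = 'n] X_int X_0 by simp
  also have "\<dots> \<le> (\<integral>v. \<rho> v \<partial>lborel)"
    by (intro integral_mono Bochner_Integration.integrable_diff Bochner_Integration.integrable_add
        integrable_mult_right integrable_divide integrable_gauss X_int \<rho>_int \<rho>_low)
  finally have aff: "1 - \<kappa>\<^sup>2 / 2 \<le> (\<integral>v. \<rho> v \<partial>lborel)" .
  have d_bd: "\<bar>\<psi> v - gauss v\<bar> \<le> (\<psi> v + gauss v - 2 * \<rho> v) / \<kappa> + \<kappa> / 2 * (\<psi> v + gauss v)" for v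
  proof -
    let ?p = "sqrt (\<psi> v)" and ?q = "sqrt (gauss v)"
    have sq: "?p\<^sup>2 = \<psi> v" "?q\<^sup>2 = gauss v" using \<psi>0[of v] gauss_pos[of v] by auto
    let ?a = "\<bar>?p - ?q\<bar>" and ?c = "?p + ?q"
    have c0: "0 \<le> ?c" using \<psi>0[of v] gauss_pos[of v] by (simp add: less_imp_le)
    have "(?p - ?q) * ?c = ?p\<^sup>2 - ?q\<^sup>2" by (simp add: power2_eq_square algebra_simps)
    then have "\<bar>\<psi> v - gauss v\<bar> = ?a * ?c" using c0 by (metis abs_mult abs_of_nonneg sq)
    also have "\<dots> \<le> ?a\<^sup>2 / \<kappa> + \<kappa> / 4 * ?c\<^sup>2"
      by (rule mult_le_weighted_squares[OF \<kappa>(1)])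
    also have "?a\<^sup>2 = \<psi> v + gauss v - 2 * \<rho> v"
      by (simp add: power2_diff sq \<rho>_def)
    also have "?c\<^sup>2 \<le> 2 * (\<psi> v + gauss v)"
      using \<rho>_le[of v] by (simp add: power2_sum sq \<rho>_def)
    finally have "\<bar>\<psi> v - gauss v\<bar>
        \<le> (\<psi> v + gauss v - 2 * \<rho> v) / \<kappa> + \<kappa> / 4 * (2 * (\<psi> v + gauss v))"
      using \<kappa>(1) by (simp add: mult_left_mono)
    also have "\<kappa> / 4 * (2 * (\<psi> v + gauss v)) = \<kappa> / 2 * (\<psi> v + gauss v)"
      by (simp add: field_simps)
    finally show ?thesis .
  qed
  have d_int: "integrable lborel (\<lambda>v. \<psi> v - gauss v)" using \<psi>_int integrable_gauss by auto
  have "(\<integral>v. \<bar>\<psi> v - gauss v\<bar> \<partial>lborel)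
      \<le> (\<integral>v. (\<psi> v + gauss v - 2 * \<rho> v) / \<kappa> + \<kappa> / 2 * (\<psi> v + gauss v) \<partial>lborel)"
    by (intro integral_mono integrable_abs d_int d_bd Bochner_Integration.integrable_diff
        Bochner_Integration.integrable_add integrable_mult_right integrable_divide
        integrable_gauss \<psi>_int \<rho>_int)
  also have "\<dots> = (2 - 2 * (\<integral>v. \<rho> v \<partial>lborel)) / \<kappa> + \<kappa>"
    using \<psi>_int \<psi>_1 integrable_gauss[where ?'n = 'n] integral_gauss[where ?'n = 'n] \<rho>_int by simp
  \<comment> \<open>The squared Hellinger distance is at most \<open>\<kappa>\<^sup>2\<close>, so
    choosing \<open>\<kappa>\<close> as the weight in Young's inequality balances the two
    terms.\<close>
  also have "\<dots> \<le> \<kappa>\<^sup>2 / \<kappa> + \<kappa>"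
    using aff \<kappa>(1) by (intro add_right_mono divide_right_mono) auto
  also have "\<dots> = 2 * \<kappa>" using \<kappa>(1) by (simp add: power2_eq_square)
  finally have l1: "(\<integral>v. \<bar>\<psi> v - gauss v\<bar> \<partial>lborel) \<le> 2 * \<kappa>" .
  have E[measurable]: "\<Phi> -` S \<in> sets borel" using measurable_sets[OF \<Phi>_meas S] by simp
  have ind_int: "integrable lborel (\<lambda>v. indicator R v * f v)"
    if "R \<in> sets borel" "integrable lborel f" for R and f :: "real ^ 'n::{finite,wellorder} \<Rightarrow> real"
    using integrable_mult_indicator[of R lborel f] that by simp
  define d where "d = (\<integral>v. indicator (\<Phi> -` S) v * (\<psi> v - gauss v) \<partial>lborel)"
  \<comment> \<open>Pulling \<open>S\<close> back by \<open>\<Phi>\<close> writes both measures as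
    integrals over the same set, of \<open>\<psi>\<close> and of \<open>gauss\<close>.\<close>
  have "measure std_gaussian S = (\<integral>v. \<bar>det (matrix (A v))\<bar> * (indicator S (\<Phi> v) * gauss (\<Phi> v)) \<partial>lborel)"
    using lborel_change_of_variables(2)[OF der bij ind_int[OF S integrable_gauss]]
    by (simp add: measure_std_gaussian)
  also have "\<dots> = (\<integral>v. indicator (\<Phi> -` S) v * \<psi> v \<partial>lborel)"
    by (intro Bochner_Integration.integral_cong) (auto simp: \<psi>_def indicator_def)
  finally have "measure std_gaussian S - measure std_gaussian (\<Phi> -` S) = d"
    using ind_int[OF E \<psi>_int] ind_int[OF E integrable_gauss]
    by (simp add: d_def measure_std_gaussian right_diff_distrib)
  \<comment> \<open>\<open>\<psi> - gauss\<close> has integral zero, so its integrals over a set and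
    over the complement are opposite, and each is at most half of the integral of the absolute
    value.\<close>
  moreover have "\<bar>d\<bar> \<le> \<kappa>"
  proof -
    have "(\<integral>v. indicator (- (\<Phi> -` S)) v * (\<psi> v - gauss v) \<partial>lborel)
        = (\<integral>v. (\<psi> v - gauss v) - indicator (\<Phi> -` S) v * (\<psi> v - gauss v) \<partial>lborel)"
      by (intro Bochner_Integration.integral_cong) (auto simp: indicator_def)
    also have "\<dots> = - d"
      using ind_int[OF E d_int] d_int \<psi>_int \<psi>_1 integrable_gauss[where ?'n = 'n] integral_gauss[where ?'n = 'n]
      by (simp add: d_def)
    finally have m: "(\<integral>v. indicator (- (\<Phi> -` S)) v * (\<psi> v - gauss v) \<partial>lborel) = - d" .
    have Ec: "- (\<Phi> -` S) \<in> sets borel" using E by (rule borel_comp)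
    have "\<bar>d\<bar> \<le> (\<integral>v. \<bar>indicator (\<Phi> -` S) v * (\<psi> v - gauss v)\<bar> \<partial>lborel)"
      unfolding d_def by (rule integral_abs_bound)
    moreover have "\<bar>- d\<bar> \<le> (\<integral>v. \<bar>indicator (- (\<Phi> -` S)) v * (\<psi> v - gauss v)\<bar> \<partial>lborel)"
      unfolding m[symmetric] by (rule integral_abs_bound)
    ultimately have "2 * \<bar>d\<bar> \<le> (\<integral>v. \<bar>indicator (\<Phi> -` S) v * (\<psi> v - gauss v)\<bar> \<partial>lborel)
       + (\<integral>v. \<bar>indicator (- (\<Phi> -` S)) v * (\<psi> v - gauss v)\<bar> \<partial>lborel)"
      by simp
    also have "\<dots> = (\<integral>v. \<bar>indicator (\<Phi> -` S) v * (\<psi> v - gauss v)\<bar>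
       + \<bar>indicator (- (\<Phi> -` S)) v * (\<psi> v - gauss v)\<bar> \<partial>lborel)"
      by (intro Bochner_Integration.integral_add[symmetric] integrable_abs ind_int E Ec d_int)
    also have "\<dots> = (\<integral>v. \<bar>\<psi> v - gauss v\<bar> \<partial>lborel)"
      by (intro Bochner_Integration.integral_cong) (auto simp: indicator_def)
    finally show ?thesis using l1 by simp
  qed
  ultimately show ?thesis by (simp add: \<kappa>_def)
qed

section \<open>Transfer to arbitrary finite index types\<close>

text \<open>The change of variables theorem of the library needs an index type of class
  \<open>wellorder\<close>; this copy of a finite type has one.\<close>

datatype 'n ordered = Ordered (unordered: 'n)

instance ordered :: (finite) finite
proof
  have "(UNIV :: 'a ordered set) = range Ordered" by (metis ordered.exhaust surjI)
  then show "finite (UNIV :: 'a ordered set)" by (metis finite finite_imageI)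
qed

instantiation ordered :: (finite) wellorder
begin

definition less_eq_ordered :: "'a ordered \<Rightarrow> 'a ordered \<Rightarrow> bool"
  where "x \<le> y \<longleftrightarrow> to_nat_on UNIV (unordered x) \<le> to_nat_on UNIV (unordered y)"

definition less_ordered :: "'a ordered \<Rightarrow> 'a ordered \<Rightarrow> bool"
  where "x < y \<longleftrightarrow> to_nat_on UNIV (unordered x) < to_nat_on UNIV (unordered y)"

instance
proof
  fix x y z :: "'a ordered"
  have inj: "inj (to_nat_on (UNIV :: 'a set))"
    by (intro inj_on_to_nat_on countable_finite finite)
  show "x < y \<longleftrightarrow> x \<le> y \<and> \<not> y \<le> x" "x \<le> x" "x \<le> y \<or> y \<le> x"
    by (auto simp: less_eq_ordered_def less_ordered_def)
  show "x \<le> y \<Longrightarrow> y \<le> z \<Longrightarrow> x \<le> z" by (simp add: less_eq_ordered_def)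
  show "x \<le> y \<Longrightarrow> y \<le> x \<Longrightarrow> x = y"
    unfolding less_eq_ordered_def by (metis inj injD ordered.expand order_antisym)
next
  fix P :: "'a ordered \<Rightarrow> bool" and a
  assume step: "\<And>x. (\<And>y. y < x \<Longrightarrow> P y) \<Longrightarrow> P x"
  show "P a"
  proof (induction a rule: measure_induct_rule[of "\<lambda>x. to_nat_on UNIV (unordered x)"])
    case (less x)
    show ?case by (rule step, rule less) (simp add: less_ordered_def)
  qed
qed

end

definition reindex :: "real ^ 'n \<Rightarrow> real ^ ('n::finite) ordered"
  where "reindex v = (\<chi> j. v $ unordered j)"

definition unindex :: "real ^ ('n::finite) ordered \<Rightarrow> real ^ 'n"
  where "unindex w = (\<chi> i. w $ Ordered i)"

lemma reindex_unindex [simp]: "reindex (unindex w) = w" "unindex (reindex v) = v"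
  by (simp_all add: reindex_def unindex_def vec_eq_iff)

lemma bij_betw_unordered: "bij_betw unordered UNIV UNIV"
  by (rule bij_betwI[of _ _ _ Ordered]) auto

lemma norm_reindex [simp]: "norm (reindex v) = norm v"
  unfolding norm_vec_def reindex_def L2_set_def
  using sum.reindex_bij_betw[OF bij_betw_unordered, of "\<lambda>i. (norm (v $ i))\<^sup>2"] by simp

lemma norm_unindex [simp]: "norm (unindex w) = norm w"
  by (metis norm_reindex reindex_unindex(1))

lemma linear_reindex: "linear reindex" "linear unindex"
  by (auto intro!: linearI simp: reindex_def unindex_def vec_eq_iff)

lemma bounded_linear_reindex: "bounded_linear reindex" "bounded_linear unindex"
  by (simp_all add: linear_reindex linear_conv_bounded_linear[symmetric])

lemma gauss_reindex: "gauss (reindex v) = gauss v"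
  unfolding gauss_def reindex_def
  using prod.reindex_bij_betw[OF bij_betw_unordered, of "\<lambda>i. std_normal_density (v $ i)"] by simp

lemma reindex_measurable [measurable]:
  "reindex \<in> borel_measurable borel" "unindex \<in> borel_measurable borel"
  by (auto intro!: borel_measurable_continuous_onI linear_continuous_on bounded_linear_reindex)

text \<open>Relabelling coordinates maps boxes to boxes with the same side lengths, and Lebesgue
  measure is determined by its values on boxes.\<close>

lemma distr_reindex: "distr lborel borel reindex = lborel"
proof (rule lborel_eqI[symmetric])
  fix l u :: "real ^ ('n::finite) ordered"
  assume le: "\<And>b. b \<in> Basis \<Longrightarrow> l \<bullet> b \<le> u \<bullet> b"
  have le': "l $ j \<le> u $ j" for j
    using le[of "axis j 1"] by (auto simp: inner_axis axis_in_Basis_iff)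
  have "reindex -` box l u = box (unindex l) (unindex u)"
    by (auto simp: mem_box_cart reindex_def unindex_def) (metis ordered.sel ordered.exhaust)+
  then have "emeasure (distr lborel borel reindex) (box l u) = emeasure lborel (box (unindex l) (unindex u))"
    by (subst emeasure_distr) auto
  also have "\<dots> = (\<Prod>b\<in>Basis. (unindex u - unindex l) \<bullet> b)"
    by (rule emeasure_lborel_box) (auto simp: Basis_vec_def inner_axis unindex_def le')
  also have "(\<Prod>b\<in>Basis. (unindex u - unindex l) \<bullet> b) = (\<Prod>b\<in>Basis. (u - l) \<bullet> b)"
    using prod.reindex_bij_betw[OF bij_betw_unordered, of "\<lambda>i. u $ Ordered i - l $ Ordered i"]
    by (simp add: prod_Basis_vec[where f = "\<lambda>x. x"] unindex_def)
  finally show "emeasure (distr lborel borel reindex) (box l u) = (\<Prod>b\<in>Basis. (u - l) \<bullet> b)" .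
qed simp

lemma measure_std_gaussian_reindex:
  assumes [measurable]: "S \<in> sets borel"
  shows "measure std_gaussian (reindex -` S) = measure std_gaussian S"
proof -
  have [measurable]: "reindex -` S \<in> sets borel"
    using measurable_sets[OF reindex_measurable(1) assms] by simp
  show ?thesis
    by (simp add: measure_std_gaussian, subst distr_reindex[symmetric], subst integral_distr)
      (auto simp: gauss_reindex indicator_def intro!: Bochner_Integration.integral_cong)
qed

text \<open>Conjugation with the linear isometries \<open>reindex\<close> and
  \<open>unindex\<close>, which preserve the Gaussian measure. Since the hypotheses are stated
  through norms and the index types have equal cardinality, no constant changes.\<close>

lemma gaussian_pushforward:
  fixes \<Phi> :: "real ^ 'n \<Rightarrow> real ^ 'n"
  assumes bij: "bij \<Phi>"
    and der: "\<And>v. (\<Phi> has_derivative A v) (at v)"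
    and lin: "\<And>v. linear (A' v)" and inv: "\<And>v u. A' v (A v u) = u"
    and bd: "\<And>v. norm (\<Phi> v - v) \<le> \<beta>"
    and bA: "\<And>v u. norm (A v u - u) \<le> b * norm u"
    and bA': "\<And>v u. norm (A' v u - u) \<le> b * norm u"
    and \<beta>: "0 < \<beta>" and b: "0 \<le> b" and S: "S \<in> sets borel"
  shows "\<bar>measure std_gaussian S - measure std_gaussian (\<Phi> -` S)\<bar>
    \<le> sqrt (\<beta>\<^sup>2 / 2 + 3 / 2 * real CARD('n) * b\<^sup>2)"
proof -
  define \<Phi>r where "\<Phi>r = reindex \<circ> \<Phi> \<circ> unindex"
  define Ar where "Ar w u = reindex (A (unindex w) (unindex u))" for w u
  define Ar' where "Ar' w u = reindex (A' (unindex w) (unindex u))" for w u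
  define Sr where "Sr = unindex -` S"
  note bl = bounded_linear_reindex
  have iso: "bij reindex" "bij (unindex :: _ \<Rightarrow> real ^ 'n)"
    using o_bij[of unindex reindex] o_bij[of reindex unindex] by (simp_all add: fun_eq_iff)
  have cancel: "norm (reindex a - w) = norm (a - unindex w)" for a :: "real ^ 'n" and w
  proof -
    have "reindex (a - unindex w) = reindex a - w"
      by (simp add: linear_diff[OF linear_reindex(1)])
    then show ?thesis by (metis norm_reindex)
  qed
  have "bij \<Phi>r" unfolding \<Phi>r_def by (intro bij_comp iso bij)
  moreover have "(\<Phi>r has_derivative Ar w) (at w)" for w
  proof -
    have "((\<lambda>w. \<Phi> (unindex w)) has_derivative (\<lambda>u. A (unindex w) (unindex u))) (at w)"
      by (rule has_derivative_compose[OF bounded_linear_imp_has_derivative[OF bl(2)] der])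
    from bounded_linear.has_derivative[OF bl(1) this]
    show ?thesis by (simp add: \<Phi>r_def Ar_def[abs_def] comp_def)
  qed
  moreover have "linear (Ar' w)" for w
    using linear_compose[OF linear_compose[OF linear_reindex(2) lin[of "unindex w"]] linear_reindex(1)]
    by (simp add: Ar'_def[abs_def] comp_def)
  moreover have "Ar' w (Ar w u) = u" for w u
    by (simp add: Ar_def Ar'_def inv)
  moreover have "norm (\<Phi>r w - w) \<le> \<beta>" for w
    using bd by (simp add: \<Phi>r_def cancel)
  moreover have "norm (Ar w u - u) \<le> b * norm u" "norm (Ar' w u - u) \<le> b * norm u" for w u
    using bA[of "unindex w" "unindex u"] bA'[of "unindex w" "unindex u"]
    by (simp_all add: Ar_def Ar'_def cancel)
  moreover have Sr: "Sr \<in> sets borel"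
    unfolding Sr_def using measurable_sets[OF reindex_measurable(2) S] by simp
  ultimately have *: "\<bar>measure std_gaussian Sr - measure std_gaussian (\<Phi>r -` Sr)\<bar>
    \<le> sqrt (\<beta>\<^sup>2 / 2 + 3 / 2 * real CARD('n ordered) * b\<^sup>2)"
    using \<beta> b by (intro gaussian_pushforward_wellorder[of \<Phi>r Ar Ar'])
  have "continuous_on UNIV \<Phi>"
    using der by (meson continuous_at_imp_continuous_on has_derivative_continuous)
  then have [measurable]: "\<Phi> \<in> borel_measurable borel"
    by (rule borel_measurable_continuous_onI)
  have "\<Phi>r \<in> borel_measurable borel" unfolding \<Phi>r_def by measurable
  then have Sr': "\<Phi>r -` Sr \<in> sets borel"
    using measurable_sets[OF _ Sr, of \<Phi>r borel] by simp
  have "measure std_gaussian Sr = measure std_gaussian S"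
    using measure_std_gaussian_reindex[OF Sr] by (simp add: Sr_def vimage_def)
  moreover have "measure std_gaussian (\<Phi>r -` Sr) = measure std_gaussian (\<Phi> -` S)"
    using measure_std_gaussian_reindex[OF Sr'] by (simp add: Sr_def \<Phi>r_def vimage_def)
  moreover have "CARD('n ordered) = CARD('n)"
    using bij_betw_same_card[OF bij_betw_unordered] by simp
  ultimately show ?thesis using * by simp
qed

section \<open>Integral equations for paths\<close>

text \<open>Banach's theorem in the supremum norm over \<open>X\<close>: the Picard iterates from
  zero converge uniformly by the Weierstrass test. It is used on the compact set \<open>I\<close>
  for a linearised equation and on \<open>{0..}\<close> for an ordinary differential equation, where
  boundedness is a genuine condition to carry along.\<close>

lemma contraction_fixpoint_on:
  fixes \<Gamma> :: "('a::topological_space \<Rightarrow> 'b::banach) \<Rightarrow> 'a \<Rightarrow> 'b"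
  assumes maps: "\<And>f. continuous_on X f \<Longrightarrow> bounded (f ` X) \<Longrightarrow> continuous_on X (\<Gamma> f) \<and> bounded (\<Gamma> f ` X)"
    and contr: "\<And>f g B t. continuous_on X f \<Longrightarrow> bounded (f ` X) \<Longrightarrow> continuous_on X g \<Longrightarrow> bounded (g ` X) \<Longrightarrow>
      (\<And>s. s \<in> X \<Longrightarrow> norm (f s - g s) \<le> B) \<Longrightarrow> t \<in> X \<Longrightarrow> norm (\<Gamma> f t - \<Gamma> g t) \<le> c * B"
    and c: "0 \<le> c" "c < 1"
  shows "\<exists>f. continuous_on X f \<and> bounded (f ` X) \<and> (\<forall>t\<in>X. \<Gamma> f t = f t)"
proof -
  define F where "F n = (\<Gamma> ^^ n) (\<lambda>_. 0)" for n
  have F_Suc: "F (Suc n) = \<Gamma> (F n)" for n by (simp add: F_def)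
  have F: "continuous_on X (F n)" "bounded (F n ` X)" for n
  proof (induction n)
    case 0
    show "continuous_on X (F 0)" "bounded (F 0 ` X)"
      by (auto simp: F_def bounded_iff)
  next
    case (Suc n)
    then show "continuous_on X (F (Suc n))" "bounded (F (Suc n) ` X)"
      using maps[of "F n"] by (auto simp: F_Suc)
  qed
  obtain B where B: "\<And>s. s \<in> X \<Longrightarrow> norm (F 1 s) \<le> B"
    using F(2)[of 1] by (auto simp: bounded_iff)
  have step: "norm (F (Suc n) s - F n s) \<le> B * c ^ n" if "s \<in> X" for n s
    using that
  proof (induction n arbitrary: s)
    case 0
    then show ?case using B by (simp add: F_def)
  next
    case (Suc n)
    have "norm (\<Gamma> (F (Suc n)) s - \<Gamma> (F n) s) \<le> c * (B * c ^ n)"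
      by (rule contr) (use Suc F in auto)
    then show ?case by (simp add: F_Suc mult_ac)
  qed
  define f where "f s = (\<Sum>i. F (Suc i) s - F i s)" for s
  have "uniform_limit X (\<lambda>n s. \<Sum>i<n. F (Suc i) s - F i s) f sequentially"
    unfolding f_def
    by (rule Weierstrass_m_test[OF step]) (use c in \<open>auto intro!: summable_mult summable_geometric\<close>)
  moreover have "(\<Sum>i<n. F (Suc i) s - F i s) = F n s" for n s
    using sum_lessThan_telescope[of "\<lambda>i. F i s" n] by (simp add: F_def)
  ultimately have lim: "uniform_limit X F f sequentially"
    by (simp only:)
  have cont: "continuous_on X f"
    by (rule uniform_limit_theorem[OF _ lim]) (use F in auto)
  have near: "\<exists>n. \<forall>s\<in>X. norm (F n s - f s) \<le> e \<and> norm (F (Suc n) s - f s) \<le> e" if "0 < e" for e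
  proof -
    obtain N where "\<And>n s. N \<le> n \<Longrightarrow> s \<in> X \<Longrightarrow> dist (F n s) (f s) < e"
      using lim \<open>0 < e\<close> unfolding uniform_limit_sequentially_iff by blast
    then have "\<forall>s\<in>X. norm (F N s - f s) \<le> e \<and> norm (F (Suc N) s - f s) \<le> e"
      by (auto simp: dist_norm less_imp_le)
    then show ?thesis by blast
  qed
  have bdd: "bounded (f ` X)"
  proof -
    obtain n where n: "\<And>s. s \<in> X \<Longrightarrow> norm (F n s - f s) \<le> 1"
      using near[of 1] by auto
    obtain C where C: "\<And>s. s \<in> X \<Longrightarrow> norm (F n s) \<le> C"
      using F(2)[of n] by (auto simp: bounded_iff)
    have "norm (f s) \<le> C + 1" if "s \<in> X" for s
      using n[OF that] C[OF that] norm_triangle_ineq4[of "F n s" "F n s - f s"] by simp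
    then show ?thesis by (auto simp: bounded_iff)
  qed
  have "\<Gamma> f t = f t" if t: "t \<in> X" for t
  proof -
    have "norm (\<Gamma> f t - f t) \<le> 0 + e" if e: "0 < e" for e
    proof -
      obtain n where n: "\<And>s. s \<in> X \<Longrightarrow> norm (F n s - f s) \<le> e / 2"
        "\<And>s. s \<in> X \<Longrightarrow> norm (F (Suc n) s - f s) \<le> e / 2"
        using near[of "e / 2"] e by auto
      have "norm (\<Gamma> (F n) t - \<Gamma> f t) \<le> c * (e / 2)"
        by (rule contr) (use F cont bdd n t in auto)
      also have "\<dots> \<le> 1 * (e / 2)" using c e by (intro mult_right_mono) auto
      finally show ?thesis
        using n(2)[OF t] norm_triangle_ineq4[of "F (Suc n) t - f t" "\<Gamma> (F n) t - \<Gamma> f t"]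
        by (simp add: F_Suc)
    qed
    then have "norm (\<Gamma> f t - f t) \<le> 0" by (rule field_le_epsilon)
    then show ?thesis by simp
  qed
  then show ?thesis using cont bdd by blast
qed

text \<open>Take \<open>t\<close> where \<open>norm (d t)\<close> is maximal and \<open>B\<close>
  equal to that maximum; the term \<open>k * B\<close> then moves to the left-hand side. This does
  the work of a Gronwall inequality.\<close>

lemma compact_norm_absorb:
  fixes d :: "'a::topological_space \<Rightarrow> 'b::real_normed_vector"
  assumes I: "compact I" and cont: "continuous_on I d" and k: "k < 1"
    and step: "\<And>B t. (\<And>s. s \<in> I \<Longrightarrow> norm (d s) \<le> B) \<Longrightarrow> t \<in> I \<Longrightarrow> norm (d t) \<le> a + k * B"
    and t: "t \<in> I"
  shows "norm (d t) \<le> a / (1 - k)"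
proof -
  obtain s where s: "s \<in> I" "\<And>r. r \<in> I \<Longrightarrow> norm (d r) \<le> norm (d s)"
    using continuous_attains_sup[OF I, of "\<lambda>s. norm (d s)"] t cont
    by (force intro: continuous_on_norm)
  have "norm (d s) \<le> a + k * norm (d s)" by (rule step) (use s in auto)
  then have "norm (d s) \<le> a / (1 - k)" using k by (simp add: field_simps)
  then show ?thesis using s(2)[OF t] by simp
qed

lemma has_derivative_quadratic_remainder:
  fixes f :: "'a::real_normed_vector \<Rightarrow> 'b::real_normed_vector"
  assumes "bounded_linear D" and bd: "\<And>y. norm (f y - f x - D (y - x)) \<le> K * (norm (y - x))\<^sup>2"
  shows "(f has_derivative D) (at x)"
  unfolding has_derivative_at_alt
proof (intro conjI allI impI)
  fix e :: real assume e: "0 < e"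
  let ?d = "e / (\<bar>K\<bar> + 1)"
  have "norm (f y - f x - D (y - x)) \<le> e * norm (y - x)" if y: "norm (y - x) < ?d" for y
  proof -
    have "K * norm (y - x) \<le> (\<bar>K\<bar> + 1) * norm (y - x)" by (intro mult_right_mono) auto
    also have "\<dots> \<le> (\<bar>K\<bar> + 1) * ?d" using y by (intro mult_left_mono) auto
    also have "\<dots> = e" using abs_ge_zero[of K] by (simp add: add_nonneg_eq_0_iff field_simps)
    finally have "K * norm (y - x) * norm (y - x) \<le> e * norm (y - x)" by (intro mult_right_mono) auto
    then show ?thesis using bd[of y] by (simp add: power2_eq_square mult.assoc)
  qed
  moreover have "0 < ?d" using e by (intro divide_pos_pos) auto
  ultimately show "\<exists>d>0. \<forall>y. norm (y - x) < d \<longrightarrow> norm (f y - f x - D (y - x)) \<le> e * norm (y - x)"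
    by blast
qed (fact assms(1))

text \<open>\<open>I\<close> is the set of times at which positions are observed (the interval \<open>{0..T}\<close>, or the grid
  points in it) and \<open>J f t\<close> is \<open>\<integral>\<^sub>0\<^sup>t (t - s) f s ds\<close>, or its trapezoidal approximation.\<close>

locale path_operator =
  fixes I :: "real set" and T :: real and J :: "(real \<Rightarrow> 'a::euclidean_space) \<Rightarrow> real \<Rightarrow> 'a"
  assumes T_pos: "0 < T" and compact_I: "compact I" and I_subset: "I \<subseteq> {0..T}" and T_in_I: "T \<in> I"
    and J_add: "\<And>f g t. continuous_on I f \<Longrightarrow> continuous_on I g \<Longrightarrow> t \<in> I \<Longrightarrow>
      J (\<lambda>s. f s + g s) t = J f t + J g t"
    and J_scale: "\<And>f c t. continuous_on I f \<Longrightarrow> t \<in> I \<Longrightarrow> J (\<lambda>s. c *\<^sub>R f s) t = c *\<^sub>R J f t"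
    and J_continuous: "\<And>f. continuous_on I f \<Longrightarrow> continuous_on I (J f)"
    and J_bound: "\<And>f t B. continuous_on I f \<Longrightarrow> (\<And>s. s \<in> I \<Longrightarrow> norm (f s) \<le> B) \<Longrightarrow> t \<in> I \<Longrightarrow>
      norm (J f t) \<le> T\<^sup>2 * B"
begin

lemma J_diff:
  assumes "continuous_on I f" "continuous_on I g" "t \<in> I"
  shows "J (\<lambda>s. f s - g s) t = J f t - J g t"
proof -
  have "J (\<lambda>s. f s + (-1) *\<^sub>R g s) t = J f t + J (\<lambda>s. (-1) *\<^sub>R g s) t"
    using assms by (intro J_add continuous_intros)
  then show ?thesis using J_scale[OF assms(2,3), of "-1"] by simp
qed

text \<open>Absorption with factor \<open>L * T\<^sup>2 \<le> 1 / 6\<close>, hence 6/5 = 1 / (1 -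
  1/6). In the applications \<open>d\<close> is a path or a difference of paths, \<open>r\<close>
  carries the difference of the data and \<open>c\<close> the source terms, such as Taylor
  remainders.\<close>

lemma volterra_bound:
  assumes L: "0 \<le> L" "L * T\<^sup>2 \<le> 1 / 6"
    and cont: "continuous_on I d" "continuous_on I f"
    and eq: "\<And>t. t \<in> I \<Longrightarrow> d t = r t - J f t"
    and r: "\<And>t. t \<in> I \<Longrightarrow> norm (r t) \<le> a"
    and f: "\<And>s. s \<in> I \<Longrightarrow> norm (f s) \<le> c + L * norm (d s)"
    and t: "t \<in> I"
  shows "norm (d t) \<le> 6 / 5 * (a + T\<^sup>2 * c)"
proof -
  have "norm (d t) \<le> (a + T\<^sup>2 * c) / (1 - 1 / 6)"
  proof (rule compact_norm_absorb[OF compact_I cont(1) _ _ t])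
    fix B t assume B: "\<And>s. s \<in> I \<Longrightarrow> norm (d s) \<le> B" and t: "t \<in> I"
    have B0: "0 \<le> B" using B[OF t] norm_ge_zero order_trans by blast
    have "norm (J f t) \<le> T\<^sup>2 * (c + L * B)"
      by (rule J_bound[OF cont(2) _ t]) (meson B L(1) add_left_mono f mult_left_mono order_trans)
    also have "\<dots> = T\<^sup>2 * c + (L * T\<^sup>2) * B" by (simp add: algebra_simps)
    also have "\<dots> \<le> T\<^sup>2 * c + 1 / 6 * B" using L B0 by (intro add_left_mono mult_right_mono) auto
    finally show "norm (d t) \<le> a + T\<^sup>2 * c + 1 / 6 * B"
      using eq[OF t] r[OF t] norm_triangle_ineq4[of "r t" "J f t"] by simp
  qed simp
  then show ?thesis by simp
qed

end

section \<open>Dependence of the position on the initial velocity\<close>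

text \<open>In the application \<open>g\<close> is the gradient of \<open>U\<close>,
  \<open>H\<close> its Hessian, and \<open>M\<close> the bound on the third derivative. Velocities
  are eliminated: a path enters only through its equation at the observed times, which has the same
  form for the exact flow and for the Verlet scheme.\<close>

locale position_flow = path_operator I T J
  for I :: "real set" and T :: real and J :: "(real \<Rightarrow> 'a::euclidean_space) \<Rightarrow> real \<Rightarrow> 'a" +
  fixes g :: "'a \<Rightarrow> 'a" and H :: "'a \<Rightarrow> 'a \<Rightarrow> 'a" and L M :: real
    and q :: "'a \<Rightarrow> 'a \<Rightarrow> real \<Rightarrow> 'a"
  assumes g_derivative: "\<And>a. (g has_derivative H a) (at a)"
    and H_bound: "\<And>a u. norm (H a u) \<le> L * norm u"
    and H_lipschitz: "\<And>a b u. norm (H a u - H b u) \<le> M * norm (a - b) * norm u"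
    and L_nonneg: "0 \<le> L" and M_nonneg: "0 \<le> M" and LT: "L * T\<^sup>2 \<le> 1 / 6"
    and q_continuous: "\<And>x v. continuous_on I (q x v)"
    and q_equation: "\<And>x v t. t \<in> I \<Longrightarrow> q x v t = x + t *\<^sub>R v - J (\<lambda>s. g (q x v s)) t"
begin

lemma I_bounds: "t \<in> I \<Longrightarrow> 0 \<le> t" "t \<in> I \<Longrightarrow> t \<le> T"
  using I_subset by auto

lemma norm_time_scale: "t \<in> I \<Longrightarrow> norm (t *\<^sub>R u) \<le> T * norm u"
  using I_bounds[of t] by (simp add: mult_right_mono)

lemma H_linear: "linear (H a)"
  using g_derivative has_derivative_linear by blast

lemma g_lipschitz: "norm (g a - g b) \<le> L * norm (a - b)"
  using differentiable_bound[of UNIV g H L b a] g_derivative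
  by (simp add: H_bound onorm_le norm_minus_commute)

lemma g_continuous: "continuous_on S g"
  using g_derivative by (meson continuous_at_imp_continuous_on has_derivative_continuous)

lemma g_path_continuous: "continuous_on I p \<Longrightarrow> continuous_on I (\<lambda>s. g (p s))"
  by (rule continuous_on_compose2[OF g_continuous[of UNIV]]) auto

lemma g_taylor: "norm (g b - g a - H a (b - a)) \<le> M * (norm (b - a))\<^sup>2"
proof -
  have "norm (g b - g a - H a (b - a)) \<le> norm (b - a) * (M * norm (b - a))"
  proof (rule differentiable_bound_linearization[where S = "closed_segment a b" and f' = H])
    show "a + t *\<^sub>R (b - a) \<in> closed_segment a b" if "t \<in> {0..1}" for t
      using that by (auto simp: closed_segment_def algebra_simps intro!: exI[of _ t])
    show "(g has_derivative H z) (at z within closed_segment a b)" for z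
      by (rule has_derivative_at_withinI[OF g_derivative])
    show "onorm (H z - H a) \<le> M * norm (b - a)" if z: "z \<in> closed_segment a b" for z
    proof (rule onorm_le)
      fix u :: 'a
      have "norm (z - a) \<le> norm (b - a)" using z by (rule segment_bound1)
      then have "M * norm (z - a) * norm u \<le> M * norm (b - a) * norm u"
        using M_nonneg by (intro mult_right_mono mult_left_mono) auto
      then show "norm ((H z - H a) u) \<le> M * norm (b - a) * norm u"
        using H_lipschitz[of z u a] by simp
    qed
  qed simp
  then show ?thesis by (simp add: power2_eq_square mult_ac)
qed

lemma H_path_continuous:
  assumes p: "continuous_on I p" and Q: "continuous_on I Q"
  shows "continuous_on I (\<lambda>s. H (p s) (Q s))"
proof -
  have "continuous_on UNIV (\<lambda>a. H a b)" for b
  proof (rule lipschitz_on_continuous_on[of "M * norm b"], rule lipschitz_onI)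
    show "dist (H x b) (H y b) \<le> M * norm b * dist x y" for x y
      using H_lipschitz[of x b y] by (simp add: dist_norm mult_ac)
  qed (use M_nonneg in auto)
  then have c: "continuous_on I (\<lambda>s. H (p s) b)" for b
    by (rule continuous_on_compose2[OF _ p]) auto
  \<comment> \<open>Expansion in a basis reduces joint continuity to that of
    \<open>H (p s) b\<close> for fixed \<open>b\<close>, which is Lipschitz in the position.\<close>
  have "H (p s) (Q s) = (\<Sum>b\<in>Basis. (Q s \<bullet> b) *\<^sub>R H (p s) b)" for s
  proof -
    have "H (p s) (\<Sum>b\<in>Basis. (Q s \<bullet> b) *\<^sub>R b) = (\<Sum>b\<in>Basis. (Q s \<bullet> b) *\<^sub>R H (p s) b)"
      using H_linear[of "p s"] by (simp add: linear_sum linear_cmul)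
    then show ?thesis by (simp add: euclidean_representation)
  qed
  then show ?thesis
    by (simp only:) (intro continuous_intros Q c)
qed

lemma q_lipschitz:
  assumes t: "t \<in> I"
  shows "norm (q x v t - q x v' t) \<le> 6 / 5 * T * norm (v - v')"
proof -
  let ?f = "\<lambda>s. g (q x v s) - g (q x v' s)"
  have "norm (q x v t - q x v' t) \<le> 6 / 5 * (T * norm (v - v') + T\<^sup>2 * 0)"
  proof (rule volterra_bound[OF L_nonneg LT _ _ _ _ _ t, where f = ?f and r = "\<lambda>t. t *\<^sub>R (v - v')"])
    show "q x v t - q x v' t = t *\<^sub>R (v - v') - J ?f t" if "t \<in> I" for t
      using that by (subst (1 2) q_equation)
        (simp_all add: J_diff g_path_continuous q_continuous algebra_simps)
  qed (use g_lipschitz norm_time_scale in \<open>auto intro!: continuous_intros q_continuous g_path_continuous\<close>)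
  then show ?thesis by simp
qed

text \<open>The equation for a path, linearised along \<open>q x v\<close> in the direction
  \<open>u\<close> of velocities. Its Picard map is a contraction with factor
  \<open>L * T\<^sup>2 \<le> 1 / 6\<close>.\<close>

lemma variational_exists:
  "\<exists>Q. continuous_on I Q \<and> (\<forall>t\<in>I. Q t = t *\<^sub>R u - J (\<lambda>s. H (q x v s) (Q s)) t)"
proof -
  define \<Gamma> where "\<Gamma> Q t = t *\<^sub>R u - J (\<lambda>s. H (q x v s) (Q s)) t" for Q t
  have "\<exists>Q. continuous_on I Q \<and> bounded (Q ` I) \<and> (\<forall>t\<in>I. \<Gamma> Q t = Q t)"
  proof (rule contraction_fixpoint_on[where c = "1/6"])
    fix Q :: "real \<Rightarrow> 'a" assume Q: "continuous_on I Q" "bounded (Q ` I)"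
    have "continuous_on I (\<Gamma> Q)" unfolding \<Gamma>_def
      by (intro continuous_intros J_continuous H_path_continuous Q q_continuous)
    then show "continuous_on I (\<Gamma> Q) \<and> bounded (\<Gamma> Q ` I)"
      using compact_I compact_continuous_image compact_imp_bounded by blast
  next
    fix P Q :: "real \<Rightarrow> 'a" and B t
    assume PQ: "continuous_on I P" "continuous_on I Q"
      and B: "\<And>s. s \<in> I \<Longrightarrow> norm (P s - Q s) \<le> B" and t: "t \<in> I"
    have B0: "0 \<le> B" using B[OF t] norm_ge_zero order_trans by blast
    let ?f = "\<lambda>s. H (q x v s) (P s) - H (q x v s) (Q s)"
    have "norm (\<Gamma> P t - \<Gamma> Q t) = norm (J ?f t)"
      using t PQ by (simp add: \<Gamma>_def J_diff H_path_continuous q_continuous norm_minus_commute)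
    also have "\<dots> \<le> T\<^sup>2 * (L * B)"
    proof (rule J_bound[OF _ _ t])
      show "continuous_on I ?f" by (intro continuous_intros H_path_continuous PQ q_continuous)
      fix s assume s: "s \<in> I"
      have "?f s = H (q x v s) (P s - Q s)" by (simp add: linear_diff[OF H_linear])
      then have "norm (?f s) \<le> L * norm (P s - Q s)" using H_bound by simp
      also have "\<dots> \<le> L * B" using B[OF s] L_nonneg by (rule mult_left_mono)
      finally show "norm (?f s) \<le> L * B" .
    qed
    also have "\<dots> = (L * T\<^sup>2) * B" by simp
    also have "\<dots> \<le> 1 / 6 * B" using LT B0 by (rule mult_right_mono)
    finally show "norm (\<Gamma> P t - \<Gamma> Q t) \<le> 1 / 6 * B" .
  qed auto
  then show ?thesis by (metis \<Gamma>_def)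
qed

text \<open>The candidate for the derivative of \<open>q x v t\<close> with respect to
  \<open>v\<close> in direction \<open>u\<close>; at \<open>t = T\<close> it is shown to be one in
  \<open>endpoint_has_derivative\<close>. Values at times outside \<open>I\<close> are
  unspecified.\<close>

definition variation :: "'a \<Rightarrow> 'a \<Rightarrow> 'a \<Rightarrow> real \<Rightarrow> 'a"
  where "variation x v u =
    (SOME Q. continuous_on I Q \<and> (\<forall>t\<in>I. Q t = t *\<^sub>R u - J (\<lambda>s. H (q x v s) (Q s)) t))"

lemma variation_continuous: "continuous_on I (variation x v u)"
  and variation_equation:
    "t \<in> I \<Longrightarrow> variation x v u t = t *\<^sub>R u - J (\<lambda>s. H (q x v s) (variation x v u s)) t"
  using someI_ex[OF variational_exists[of u x v], folded variation_def] by auto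

text \<open>The difference of two solutions obeys \<open>volterra_bound\<close> with zero data. Thus
  linearity in \<open>u\<close> can be proved by exhibiting a solution.\<close>

lemma variation_unique:
  assumes Q: "continuous_on I Q" "\<And>t. t \<in> I \<Longrightarrow> Q t = t *\<^sub>R u - J (\<lambda>s. H (q x v s) (Q s)) t"
    and t: "t \<in> I"
  shows "variation x v u t = Q t"
proof -
  let ?f = "\<lambda>s. H (q x v s) (variation x v u s) - H (q x v s) (Q s)"
  have "norm (variation x v u t - Q t) \<le> 6 / 5 * (0 + T\<^sup>2 * 0)"
  proof (rule volterra_bound[OF L_nonneg LT _ _ _ _ _ t, where f = ?f and r = "\<lambda>t. 0"])
    show "variation x v u t - Q t = 0 - J ?f t" if "t \<in> I" for t
      using that by (subst variation_equation, simp, subst Q(2))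
        (simp_all add: J_diff H_path_continuous variation_continuous q_continuous Q(1))
    show "norm (?f s) \<le> 0 + L * norm (variation x v u s - Q s)" for s
      using H_bound[of "q x v s" "variation x v u s - Q s"] by (simp add: linear_diff[OF H_linear])
  qed (auto intro!: continuous_intros H_path_continuous variation_continuous q_continuous Q)
  then show ?thesis by simp
qed

lemma variation_bound:
  assumes t: "t \<in> I"
  shows "norm (variation x v u t) \<le> 6 / 5 * T * norm u"
proof -
  have "norm (variation x v u t) \<le> 6 / 5 * (T * norm u + T\<^sup>2 * 0)"
    by (rule volterra_bound[OF L_nonneg LT variation_continuous _ variation_equation _ _ t])
      (use H_bound norm_time_scale in \<open>auto intro!: H_path_continuous variation_continuous q_continuous\<close>)
  then show ?thesis by simp
qed

section \<open>The endpoint map as a diffeomorphism\<close>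

definition endpoint :: "'a \<Rightarrow> 'a \<Rightarrow> 'a"
  where "endpoint x v = q x v T"

definition endpoint_derivative :: "'a \<Rightarrow> 'a \<Rightarrow> 'a \<Rightarrow> 'a"
  where "endpoint_derivative x v u = variation x v u T"

lemma endpoint_derivative_linear: "linear (endpoint_derivative x v)"
proof (rule linearI)
  note c = H_path_continuous variation_continuous q_continuous
  fix u w and r :: real
  show "endpoint_derivative x v (u + w) = endpoint_derivative x v u + endpoint_derivative x v w"
    unfolding endpoint_derivative_def
  proof (rule variation_unique[OF _ _ T_in_I])
    show "continuous_on I (\<lambda>t. variation x v u t + variation x v w t)"
      by (intro continuous_intros c)
    show "variation x v u t + variation x v w t
      = t *\<^sub>R (u + w) - J (\<lambda>s. H (q x v s) (variation x v u s + variation x v w s)) t" if "t \<in> I" for t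
      using that by (subst (1 2) variation_equation)
        (simp_all add: linear_add[OF H_linear] J_add c algebra_simps)
  qed
  show "endpoint_derivative x v (r *\<^sub>R u) = r *\<^sub>R endpoint_derivative x v u"
    unfolding endpoint_derivative_def
  proof (rule variation_unique[OF _ _ T_in_I])
    show "continuous_on I (\<lambda>t. r *\<^sub>R variation x v u t)"
      by (intro continuous_intros c)
    show "r *\<^sub>R variation x v u t
      = t *\<^sub>R (r *\<^sub>R u) - J (\<lambda>s. H (q x v s) (r *\<^sub>R variation x v u s)) t" if "t \<in> I" for t
      using that by (subst variation_equation)
        (simp_all add: linear_cmul[OF H_linear] J_scale c algebra_simps)
  qed
qed

text \<open>The size of the force term when paths grow by the factor 6/5:
  \<open>1 / 6 * (6 / 5) = 1 / 5\<close> relative to free motion \<open>T * n\<close>.\<close>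

lemma perturbation_bound: "T\<^sup>2 * (L * (6 / 5 * T * n)) \<le> T / 5 * n" if "0 \<le> n" for n
proof -
  have "T\<^sup>2 * (L * (6 / 5 * T * n)) = (L * T\<^sup>2) * (6 / 5 * T * n)" by simp
  also have "\<dots> \<le> 1 / 6 * (6 / 5 * T * n)" using LT T_pos that by (intro mult_right_mono) auto
  finally show ?thesis by simp
qed

lemma endpoint_derivative_near: "norm (endpoint_derivative x v u - T *\<^sub>R u) \<le> T / 5 * norm u"
proof -
  have "norm (J (\<lambda>s. H (q x v s) (variation x v u s)) T) \<le> T\<^sup>2 * (L * (6 / 5 * T * norm u))"
  proof (rule J_bound[OF _ _ T_in_I])
    show "continuous_on I (\<lambda>s. H (q x v s) (variation x v u s))"
      by (intro H_path_continuous variation_continuous q_continuous)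
    show "norm (H (q x v s) (variation x v u s)) \<le> L * (6 / 5 * T * norm u)" if "s \<in> I" for s
      using H_bound variation_bound[OF that] L_nonneg by (meson mult_left_mono order_trans)
  qed
  also have "\<dots> \<le> T / 5 * norm u" by (rule perturbation_bound) simp
  finally show ?thesis
    by (simp add: endpoint_derivative_def variation_equation[OF T_in_I, of x v u])
qed

text \<open>The force term is a Lipschitz perturbation, with constant \<open>T / 5\<close>, of the
  free motion \<open>x + T *\<^sub>R v\<close>. Expansion by \<open>4 / 5 * T\<close> and
  surjectivity both come from this.\<close>

lemma endpoint_near: "norm (endpoint x v - endpoint x v' - T *\<^sub>R (v - v')) \<le> T / 5 * norm (v - v')"
proof -
  let ?f = "\<lambda>s. g (q x v s) - g (q x v' s)"
  have "norm (J ?f T) \<le> T\<^sup>2 * (L * (6 / 5 * T * norm (v - v')))"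
  proof (rule J_bound[OF _ _ T_in_I])
    show "continuous_on I ?f" by (intro continuous_intros g_path_continuous q_continuous)
    show "norm (?f s) \<le> L * (6 / 5 * T * norm (v - v'))" if "s \<in> I" for s
      using g_lipschitz q_lipschitz[OF that] L_nonneg by (meson mult_left_mono order_trans)
  qed
  also have "\<dots> \<le> T / 5 * norm (v - v')" by (rule perturbation_bound) simp
  finally have "norm (J ?f T) \<le> T / 5 * norm (v - v')" .
  moreover have "endpoint x v - endpoint x v' - T *\<^sub>R (v - v') = - J ?f T"
    unfolding endpoint_def using T_in_I
    by (subst (1 2) q_equation) (simp_all add: J_diff g_path_continuous q_continuous algebra_simps)
  ultimately show ?thesis by simp
qed

lemma endpoint_expand: "4 / 5 * T * norm (v - v') \<le> norm (endpoint x v - endpoint x v')"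
  using endpoint_near[of x v v'] T_pos
    norm_triangle_ineq2[of "T *\<^sub>R (v - v')" "T *\<^sub>R (v - v') - (endpoint x v - endpoint x v')"]
  by (simp add: norm_minus_commute)

lemma endpoint_derivative_expand: "4 / 5 * T * norm u \<le> norm (endpoint_derivative x v u)"
  using endpoint_derivative_near[of x v u] T_pos
    norm_triangle_ineq2[of "T *\<^sub>R u" "T *\<^sub>R u - endpoint_derivative x v u"]
  by (simp add: norm_minus_commute)

lemma endpoint_bij: "bij (endpoint x)"
proof (rule bijI)
  show "inj (endpoint x)"
  proof (rule injI)
    fix v v' assume "endpoint x v = endpoint x v'"
    then show "v = v'" using endpoint_expand[of v v' x] T_pos by (simp add: mult_le_0_iff)
  qed
  have "\<exists>v. endpoint x v = b" for b
  proof -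
    \<comment> \<open>Newton's iteration for \<open>endpoint x v = b\<close> with the derivative
      replaced by \<open>T\<close> times the identity; by \<open>endpoint_near\<close> it contracts
      with factor 1/5.\<close>
    let ?\<phi> = "\<lambda>v. v - (1 / T) *\<^sub>R (endpoint x v - b)"
    have "\<exists>!v. ?\<phi> v = v"
    proof (rule banach_fix_type[of "1/5"])
      have "dist (?\<phi> v) (?\<phi> w) \<le> 1 / 5 * dist v w" for v w
      proof -
        have "?\<phi> v - ?\<phi> w = (- 1 / T) *\<^sub>R (endpoint x v - endpoint x w - T *\<^sub>R (v - w))"
          using T_pos by (simp add: algebra_simps)
        then have "norm (?\<phi> v - ?\<phi> w) = (1 / T) * norm (endpoint x v - endpoint x w - T *\<^sub>R (v - w))"
          using T_pos by simp
        also have "\<dots> \<le> (1 / T) * (T / 5 * norm (v - w))"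
          using T_pos endpoint_near by (intro mult_left_mono) auto
        finally show ?thesis using T_pos by (simp add: dist_norm)
      qed
      then show "\<forall>v w. dist (?\<phi> v) (?\<phi> w) \<le> 1 / 5 * dist v w" by blast
    qed auto
    then obtain v where "?\<phi> v = v" by blast
    then show ?thesis using T_pos by (intro exI[of _ v]) simp
  qed
  then show "surj (endpoint x)" by (metis surjI)
qed

text \<open>The remainder solves a Volterra equation with zero data, whose source is the Taylor
  remainder of \<open>g\<close> along the two paths. By \<open>q_lipschitz\<close> that source is
  quadratic in \<open>w - v\<close>.\<close>

lemma endpoint_has_derivative: "(endpoint x has_derivative endpoint_derivative x v) (at v)"
proof (rule has_derivative_quadratic_remainder)
  show "bounded_linear (endpoint_derivative x v)"
    using endpoint_derivative_linear by (simp add: linear_conv_bounded_linear)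
  fix w
  let ?Q = "variation x v (w - v)"
  let ?f = "\<lambda>s. g (q x w s) - g (q x v s) - H (q x v s) (?Q s)"
  let ?c = "M * (6 / 5 * T * norm (w - v))\<^sup>2"
  have "norm (q x w T - q x v T - ?Q T) \<le> 6 / 5 * (0 + T\<^sup>2 * ?c)"
  proof (rule volterra_bound[OF L_nonneg LT _ _ _ _ _ T_in_I, where f = ?f and r = "\<lambda>t. 0"])
    show "q x w t - q x v t - ?Q t = 0 - J ?f t" if t: "t \<in> I" for t
    proof -
      have "J ?f t = J (\<lambda>s. g (q x w s)) t - J (\<lambda>s. g (q x v s)) t - J (\<lambda>s. H (q x v s) (?Q s)) t"
        using t by (simp add: J_diff g_path_continuous q_continuous H_path_continuous
            variation_continuous continuous_on_diff)
      then show ?thesis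
        by (simp only: q_equation[OF t, of x w] q_equation[OF t, of x v]
            variation_equation[OF t, of x v "w - v"]) (simp add: scaleR_diff_right)
    qed
    fix s assume s: "s \<in> I"
    have "?f s = (g (q x w s) - g (q x v s) - H (q x v s) (q x w s - q x v s))
        + H (q x v s) (q x w s - q x v s - ?Q s)"
      by (simp add: linear_diff[OF H_linear])
    then have "norm (?f s) \<le> M * (norm (q x w s - q x v s))\<^sup>2 + L * norm (q x w s - q x v s - ?Q s)"
      using g_taylor H_bound by (metis (no_types, lifting) norm_add_rule_thm)
    also have "M * (norm (q x w s - q x v s))\<^sup>2 \<le> ?c"
      using q_lipschitz[OF s, of x w v] M_nonneg by (intro mult_left_mono power_mono) auto
    finally show "norm (?f s) \<le> ?c + L * norm (q x w s - q x v s - ?Q s)" by simp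
  qed (auto intro!: continuous_intros H_path_continuous g_path_continuous variation_continuous q_continuous)
  also have "6 / 5 * (0 + T\<^sup>2 * ?c) = (6 / 5 * T\<^sup>2 * M * (6 / 5 * T)\<^sup>2) * (norm (w - v))\<^sup>2"
    by (simp add: power2_eq_square)
  finally show "norm (endpoint x w - endpoint x v - endpoint_derivative x v (w - v))
     \<le> (6 / 5 * T\<^sup>2 * M * (6 / 5 * T)\<^sup>2) * (norm (w - v))\<^sup>2"
    by (simp only: endpoint_def endpoint_derivative_def)
qed

section \<open>Pairs of paths with a common endpoint\<close>

text \<open>The common endpoint determines \<open>T *\<^sub>R (v - w)\<close>; inserting it turns
  the difference at time \<open>t\<close> into an interpolation of \<open>x - y\<close> plus two
  force terms. Each force term has factor 1/6, so 3/2 = 1 / (1 - 1/3), and then 5/4 = 1 +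
  (1/6)(3/2).\<close>

lemma meeting_paths:
  assumes meet: "endpoint x v = endpoint y w"
  shows "t \<in> I \<Longrightarrow> norm (q x v t - q y w t) \<le> 3 / 2 * norm (x - y)"
    and "norm (v - w) \<le> 5 / 4 * norm (x - y) / T"
proof -
  let ?f = "\<lambda>s. g (q x v s) - g (q y w s)"
  have cf: "continuous_on I ?f" by (intro continuous_intros g_path_continuous q_continuous)
  have eq: "q x v t - q y w t = x - y + t *\<^sub>R (v - w) - J ?f t" if "t \<in> I" for t
    using that by (subst (1 2) q_equation) (simp_all add: J_diff g_path_continuous q_continuous algebra_simps)
  have vw: "T *\<^sub>R (v - w) = J ?f T - (x - y)"
    using eq[OF T_in_I] meet by (simp add: endpoint_def algebra_simps)
  have J_le: "norm (J ?f t) \<le> 1 / 6 * B"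
    if B: "\<And>s. s \<in> I \<Longrightarrow> norm (q x v s - q y w s) \<le> B" and t: "t \<in> I" for B t
  proof -
    have B0: "0 \<le> B" using B[OF t] norm_ge_zero order_trans by blast
    have "norm (J ?f t) \<le> T\<^sup>2 * (L * B)"
      by (rule J_bound[OF cf _ t]) (meson B L_nonneg g_lipschitz mult_left_mono order_trans)
    also have "\<dots> = (L * T\<^sup>2) * B" by simp
    also have "\<dots> \<le> 1 / 6 * B" using LT B0 by (rule mult_right_mono)
    finally show ?thesis .
  qed
  have D: "norm (q x v t - q y w t) \<le> norm (x - y) / (1 - 1 / 3)" if "t \<in> I" for t
  proof (rule compact_norm_absorb[OF compact_I _ _ _ that])
    show "continuous_on I (\<lambda>t. q x v t - q y w t)" by (intro continuous_intros q_continuous)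
    fix B t assume B: "\<And>s. s \<in> I \<Longrightarrow> norm (q x v s - q y w s) \<le> B" and t: "t \<in> I"
    have tT: "0 \<le> t / T" "t / T \<le> 1" using I_bounds[OF t] T_pos by auto
    have "t *\<^sub>R (v - w) = (t / T) *\<^sub>R (T *\<^sub>R (v - w))" using T_pos by simp
    then have "q x v t - q y w t = (1 - t / T) *\<^sub>R (x - y) + (t / T) *\<^sub>R J ?f T - J ?f t"
      unfolding eq[OF t] vw by (simp add: algebra_simps)
    then have "norm (q x v t - q y w t) \<le> norm ((1 - t / T) *\<^sub>R (x - y) + (t / T) *\<^sub>R J ?f T) + norm (J ?f t)"
      by (simp only: norm_triangle_ineq4)
    moreover have "norm ((1 - t / T) *\<^sub>R (x - y) + (t / T) *\<^sub>R J ?f T)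
        \<le> norm ((1 - t / T) *\<^sub>R (x - y)) + norm ((t / T) *\<^sub>R J ?f T)"
      by (rule norm_triangle_ineq)
    moreover have "norm ((1 - t / T) *\<^sub>R (x - y)) \<le> norm (x - y)"
      using tT by (simp add: mult_left_le_one_le)
    moreover have "norm ((t / T) *\<^sub>R J ?f T) \<le> norm (J ?f T)"
      using tT by (simp only: norm_scaleR abs_of_nonneg mult_left_le_one_le norm_ge_zero)
    ultimately show "norm (q x v t - q y w t) \<le> norm (x - y) + 1 / 3 * B"
      using J_le[OF B T_in_I] J_le[OF B t] by linarith
  qed simp
  then show "t \<in> I \<Longrightarrow> norm (q x v t - q y w t) \<le> 3 / 2 * norm (x - y)" by (simp add: mult.commute)
  have "T * norm (v - w) = norm (J ?f T - (x - y))" using vw T_pos by (metis abs_of_pos norm_scaleR)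
  also have "\<dots> \<le> 1 / 6 * (norm (x - y) / (1 - 1 / 3)) + norm (x - y)"
    using J_le[OF D T_in_I] norm_triangle_ineq4[of "J ?f T" "x - y"] by simp
  finally show "norm (v - w) \<le> 5 / 4 * norm (x - y) / T"
    using T_pos by (simp add: field_simps)
qed

text \<open>The two linearised equations differ through the Hessians along paths at distance
  \<open>3 / 2 * norm (x - y)\<close>, acting on a variation of size
  \<open>6 / 5 * T * norm u\<close>; \<open>volterra_bound\<close> adds another 6/5, and the product
  of the three is 54/25.\<close>

lemma meeting_derivatives:
  assumes meet: "endpoint x v = endpoint y w"
  shows "norm (endpoint_derivative x v u - endpoint_derivative y w u)
    \<le> 54 / 25 * M * T ^ 3 * norm (x - y) * norm u"
proof -
  let ?P = "variation x v u" and ?Q = "variation y w u"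
  let ?f = "\<lambda>s. H (q x v s) (?P s) - H (q y w s) (?Q s)"
  let ?c = "M * (3 / 2 * norm (x - y)) * (6 / 5 * T * norm u)"
  have "norm (?P T - ?Q T) \<le> 6 / 5 * (0 + T\<^sup>2 * ?c)"
  proof (rule volterra_bound[OF L_nonneg LT _ _ _ _ _ T_in_I, where f = ?f and r = "\<lambda>t. 0"])
    show "?P t - ?Q t = 0 - J ?f t" if "t \<in> I" for t
      using that by (subst (1 2) variation_equation)
        (simp_all add: J_diff q_continuous H_path_continuous variation_continuous)
    fix s assume s: "s \<in> I"
    have "?f s = (H (q x v s) (?P s) - H (q y w s) (?P s)) + H (q y w s) (?P s - ?Q s)"
      by (simp add: linear_diff[OF H_linear])
    then have "norm (?f s) \<le> M * norm (q x v s - q y w s) * norm (?P s) + L * norm (?P s - ?Q s)"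
      using H_lipschitz H_bound by (metis (no_types, lifting) norm_add_rule_thm)
    also have "M * norm (q x v s - q y w s) * norm (?P s) \<le> ?c"
      using meeting_paths(1)[OF meet s] variation_bound[OF s] M_nonneg
      by (intro mult_mono mult_left_mono mult_nonneg_nonneg) auto
    finally show "norm (?f s) \<le> ?c + L * norm (?P s - ?Q s)" by simp
  qed (auto intro!: continuous_intros H_path_continuous variation_continuous q_continuous)
  also have "6 / 5 * (0 + T\<^sup>2 * ?c) = 54 / 25 * M * T ^ 3 * norm (x - y) * norm u"
    by (simp add: power2_eq_square power3_eq_cube)
  finally show ?thesis by (simp add: endpoint_derivative_def)
qed

lemma endpoint_derivative_inverse:
  obtains G where "linear G" "\<And>u. G (endpoint_derivative x v u) = u" "\<And>u. endpoint_derivative x v (G u) = u"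
proof -
  have "inj (endpoint_derivative x v)"
  proof (rule injI)
    fix u w assume "endpoint_derivative x v u = endpoint_derivative x v w"
    then have "norm (endpoint_derivative x v (u - w)) = 0"
      by (simp add: linear_diff[OF endpoint_derivative_linear])
    then show "u = w" using endpoint_derivative_expand[of "u - w" x v] T_pos by (simp add: mult_le_0_iff)
  qed
  then show ?thesis
    using linear_injective_isomorphism[OF endpoint_derivative_linear[of x v]] that by metis
qed

text \<open>\<open>\<Phi>\<close> is \<open>inv (endpoint y) \<circ> endpoint x\<close>, so its
  derivative minus the identity is the inverse of one endpoint derivative applied to the difference
  of two. The inverse has norm at most \<open>5 / (4 * T)\<close>, which turns 54/25 into 27/10;
  exchanging the roles of the two paths gives \<open>A'\<close>.\<close>

lemma meeting_map:
  assumes meet: "\<And>v. endpoint x v = endpoint y (\<Phi> v)"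
  obtains A A' where
    "bij \<Phi>" "\<And>v. (\<Phi> has_derivative A v) (at v)"
    "\<And>v. linear (A' v)" "\<And>v u. A' v (A v u) = u"
    "\<And>v. norm (\<Phi> v - v) \<le> 5 / 4 * norm (x - y) / T"
    "\<And>v u. norm (A v u - u) \<le> 27 / 10 * M * T\<^sup>2 * norm (x - y) * norm u"
    "\<And>v u. norm (A' v u - u) \<le> 27 / 10 * M * T\<^sup>2 * norm (x - y) * norm u"
proof -
  have "\<exists>G. linear G \<and> (\<forall>u. G (endpoint_derivative a w u) = u) \<and> (\<forall>u. endpoint_derivative a w (G u) = u)"
    for a w
    by (rule endpoint_derivative_inverse[of a w]) blast
  then obtain G where "\<forall>a w. linear (G a w) \<and> (\<forall>u. G a w (endpoint_derivative a w u) = u)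
      \<and> (\<forall>u. endpoint_derivative a w (G a w u) = u)"
    by metis
  then have G: "linear (G a w)" "G a w (endpoint_derivative a w u) = u"
    "endpoint_derivative a w (G a w u) = u" for a w u
    by blast+
  define A where "A v = G y (\<Phi> v) \<circ> endpoint_derivative x v" for v
  define A' where "A' v = G x v \<circ> endpoint_derivative y (\<Phi> v)" for v
  define \<Psi> where "\<Psi> = inv (endpoint y)"
  have F\<Psi>: "endpoint y (\<Psi> b) = b" and \<Psi>F: "\<Psi> (endpoint y w) = w" for b w
    unfolding \<Psi>_def
    by (rule surj_f_inv_f[OF bij_is_surj[OF endpoint_bij]], rule inv_f_f[OF bij_is_inj[OF endpoint_bij]])
  have \<Phi>: "\<Phi> = \<Psi> \<circ> endpoint x"
    using \<Psi>F by (simp add: fun_eq_iff meet)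
  have "bij \<Phi>" unfolding \<Phi> \<Psi>_def by (intro bij_comp endpoint_bij bij_imp_bij_inv)
  moreover have "(\<Phi> has_derivative A v) (at v)" for v
  proof -
    \<comment> \<open>The inverse function rule asks for continuity of the inverse; expansion of the
      endpoint map makes it Lipschitz.\<close>
    have "continuous_on UNIV \<Psi>"
    proof (rule lipschitz_on_continuous_on[of "5 / 4 / T"], rule lipschitz_onI)
      show "dist (\<Psi> b) (\<Psi> c) \<le> 5 / 4 / T * dist b c" for b c
        using endpoint_expand[of "\<Psi> b" "\<Psi> c" y] T_pos by (simp add: F\<Psi> dist_norm field_simps)
    qed (use T_pos in auto)
    then have "isCont \<Psi> (endpoint x v)"
      by (simp add: continuous_on_eq_continuous_at)
    moreover have "(endpoint y has_derivative endpoint_derivative y (\<Phi> v)) (at (\<Psi> (endpoint x v)))"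
      using endpoint_has_derivative[of y "\<Phi> v"] by (simp add: \<Phi>)
    moreover have "bounded_linear (G y (\<Phi> v))"
      using G(1) by (simp add: linear_conv_bounded_linear)
    moreover have "G y (\<Phi> v) \<circ> endpoint_derivative y (\<Phi> v) = id"
      by (rule ext) (simp add: G(2))
    ultimately have "(\<Psi> has_derivative G y (\<Phi> v)) (at (endpoint x v))"
      using has_derivative_inverse_basic[of "endpoint y" "endpoint_derivative y (\<Phi> v)" \<Psi> "endpoint x v"
          "G y (\<Phi> v)" UNIV] F\<Psi> by blast
    from has_derivative_compose[OF endpoint_has_derivative this]
    show ?thesis by (simp add: A_def comp_def \<Phi>)
  qed
  moreover have "linear (A' v)" for v
    unfolding A'_def by (intro linear_compose endpoint_derivative_linear G)
  moreover have "A' v (A v u) = u" for v u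
    by (simp add: A_def A'_def G)
  moreover have "norm (\<Phi> v - v) \<le> 5 / 4 * norm (x - y) / T" for v
    using meeting_paths(2)[OF meet[of v]] by (simp add: norm_minus_commute)
  moreover have contract: "norm z \<le> 27 / 10 * M * T\<^sup>2 * norm (x - y) * norm u"
    if "norm (endpoint_derivative a w z) \<le> 54 / 25 * M * T ^ 3 * norm (x - y) * norm u" for a w z u
  proof -
    have "4 / 5 * T * norm z \<le> 54 / 25 * M * T ^ 3 * norm (x - y) * norm u"
      using endpoint_derivative_expand that by (rule order_trans)
    also have "\<dots> = 4 / 5 * T * (27 / 10 * M * T\<^sup>2 * norm (x - y) * norm u)"
      by (simp add: power2_eq_square power3_eq_cube)
    finally show ?thesis using T_pos by (simp add: mult_le_cancel_left_pos mult_ac)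
  qed
  moreover have "norm (A v u - u) \<le> 27 / 10 * M * T\<^sup>2 * norm (x - y) * norm u" for v u
    by (rule contract[of y "\<Phi> v"])
      (use meeting_derivatives[OF meet[of v], of u] in
        \<open>simp add: A_def linear_diff[OF endpoint_derivative_linear] G\<close>)
  moreover have "norm (A' v u - u) \<le> 27 / 10 * M * T\<^sup>2 * norm (x - y) * norm u" for v u
    by (rule contract[of x v])
      (use meeting_derivatives[OF meet[of v], of u] in
        \<open>simp add: A'_def linear_diff[OF endpoint_derivative_linear] G norm_minus_commute\<close>)
  ultimately show ?thesis using that by blast
qed

end

section \<open>Gradient and Hessian\<close>

lemma fderiv_has_derivative:
  "f differentiable (at x) \<Longrightarrow> (f has_derivative blinfun_apply (fderiv f x)) (at x)"
  unfolding fderiv_def frechet_derivative_works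
  by (subst bounded_linear_Blinfun_apply) (auto dest: has_derivative_bounded_linear)

text \<open>The Riesz representative of the derivative, in coordinates. Existence and uniqueness are
  both established, since \<open>grad\<close> is a definite description.\<close>

lemma grad_eq:
  fixes U :: "'a::euclidean_space \<Rightarrow> real"
  assumes "U differentiable (at x)"
  shows "grad U x = (\<Sum>b\<in>Basis. blinfun_apply (fderiv U x) b *\<^sub>R b)"
  unfolding grad_def
proof (rule the_equality)
  let ?g = "\<Sum>b\<in>Basis. blinfun_apply (fderiv U x) b *\<^sub>R b"
  have "blinfun_apply (fderiv U x) u = u \<bullet> ?g" for u
  proof -
    have "blinfun_apply (fderiv U x) (\<Sum>b\<in>Basis. (u \<bullet> b) *\<^sub>R b) = (\<Sum>b\<in>Basis. (u \<bullet> b) * blinfun_apply (fderiv U x) b)"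
      by (simp add: blinfun.sum_right blinfun.scaleR_right)
    then show ?thesis
      by (simp add: euclidean_representation inner_sum_right mult.commute)
  qed
  then have "blinfun_apply (fderiv U x) = (\<lambda>u. u \<bullet> ?g)" by (rule ext)
  with fderiv_has_derivative[OF assms] have D: "(U has_derivative (\<lambda>u. u \<bullet> ?g)) (at x)"
    by (rule has_derivative_eq_rhs)
  then show "GDERIV U x :> ?g" unfolding gderiv_def .
  fix g assume "GDERIV U x :> g"
  then have "(\<lambda>u. u \<bullet> g) = (\<lambda>u. u \<bullet> ?g)"
    unfolding gderiv_def by (rule has_derivative_unique[OF _ D])
  then have "\<forall>u. u \<bullet> g = u \<bullet> ?g" unfolding fun_eq_iff .
  then show "g = ?g" unfolding vector_eq_ldot .
qed

lemma bilinear_norm_bound: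
  fixes B :: "'a::real_normed_vector \<Rightarrow>\<^sub>L 'a \<Rightarrow>\<^sub>L real"
  shows "\<bar>blinfun_apply (blinfun_apply B u) v\<bar> \<le> bilinear_norm B * norm u * norm v"
proof (cases "u = 0 \<or> v = 0")
  case False
  let ?S = "sphere 0 1 :: 'a set"
  have bdd: "bdd_above ((\<lambda>(u, v). \<bar>blinfun_apply (blinfun_apply B u) v\<bar>) ` (?S \<times> ?S))"
  proof (rule bdd_aboveI2[of _ _ "norm B"], clarsimp)
    fix a b :: 'a assume "norm a = 1" "norm b = 1"
    then show "\<bar>blinfun_apply (blinfun_apply B a) b\<bar> \<le> norm B"
      using norm_blinfun[of "blinfun_apply B a" b] norm_blinfun[of B a] by simp
  qed
  have "\<bar>blinfun_apply (blinfun_apply B (sgn u)) (sgn v)\<bar> \<le> bilinear_norm B"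
    unfolding bilinear_norm_def
    using cSUP_upper[OF _ bdd, of "(sgn u, sgn v)"] False by (simp add: norm_sgn)
  then have "\<bar>blinfun_apply (blinfun_apply B u) v\<bar> / (norm u * norm v) \<le> bilinear_norm B"
    by (simp add: sgn_div_norm blinfun.scaleR_left blinfun.scaleR_right abs_mult divide_inverse mult_ac)
  then show ?thesis using False by (simp add: field_simps)
qed auto

lemma trilinear_norm_bound:
  fixes C :: "'a::real_normed_vector \<Rightarrow>\<^sub>L 'a \<Rightarrow>\<^sub>L 'a \<Rightarrow>\<^sub>L real"
  shows "\<bar>blinfun_apply (blinfun_apply (blinfun_apply C u) v) w\<bar> \<le> trilinear_norm C * norm u * norm v * norm w"
proof (cases "u = 0 \<or> v = 0 \<or> w = 0")
  case False
  let ?S = "sphere 0 1 :: 'a set"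
  have bdd: "bdd_above ((\<lambda>(u, v, w). \<bar>blinfun_apply (blinfun_apply (blinfun_apply C u) v) w\<bar>) ` (?S \<times> ?S \<times> ?S))"
  proof (rule bdd_aboveI2[of _ _ "norm C"], clarsimp)
    fix a b c :: 'a assume "norm a = 1" "norm b = 1" "norm c = 1"
    then show "\<bar>blinfun_apply (blinfun_apply (blinfun_apply C a) b) c\<bar> \<le> norm C"
      using norm_blinfun[of "blinfun_apply (blinfun_apply C a) b" c]
        norm_blinfun[of "blinfun_apply C a" b] norm_blinfun[of C a] by simp
  qed
  have "\<bar>blinfun_apply (blinfun_apply (blinfun_apply C (sgn u)) (sgn v)) (sgn w)\<bar> \<le> trilinear_norm C"
    unfolding trilinear_norm_def
    using cSUP_upper[OF _ bdd, of "(sgn u, sgn v, sgn w)"] False by (simp add: norm_sgn)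
  then have "\<bar>blinfun_apply (blinfun_apply (blinfun_apply C u) v) w\<bar> / (norm u * norm v * norm w) \<le> trilinear_norm C"
    by (simp add: sgn_div_norm blinfun.scaleR_left blinfun.scaleR_right abs_mult divide_inverse mult_ac)
  then show ?thesis using False by (simp add: field_simps)
qed auto


text \<open>The second derivative as an operator: the Riesz representative of the form in its second
  argument.\<close>

definition hess :: "('a::euclidean_space \<Rightarrow> real) \<Rightarrow> 'a \<Rightarrow> 'a \<Rightarrow> 'a"
  where "hess U x u = (\<Sum>b\<in>Basis. blinfun_apply (blinfun_apply (fderiv (fderiv U) x) u) b *\<^sub>R b)"

lemma inner_hess: "hess U x u \<bullet> w = blinfun_apply (blinfun_apply (fderiv (fderiv U) x) u) w"
proof -
  have "blinfun_apply (blinfun_apply (fderiv (fderiv U) x) u) (\<Sum>b\<in>Basis. (w \<bullet> b) *\<^sub>R b)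
      = hess U x u \<bullet> w"
    by (simp add: hess_def blinfun.sum_right blinfun.scaleR_right inner_sum_left inner_commute[of w] mult.commute)
  then show ?thesis by (simp add: euclidean_representation)
qed

lemma grad_has_derivative:
  fixes U :: "'a::euclidean_space \<Rightarrow> real"
  assumes "\<And>x. U differentiable (at x)" "fderiv U differentiable (at x)"
  shows "(grad U has_derivative hess U x) (at x)"
proof -
  have "((\<lambda>x. blinfun_apply (fderiv U x) b *\<^sub>R b) has_derivative
      (\<lambda>u. blinfun_apply (blinfun_apply (fderiv (fderiv U) x) u) b *\<^sub>R b)) (at x)" for b
    by (intro has_derivative_scaleR_left
        bounded_linear.has_derivative[OF blinfun.bounded_linear_left] fderiv_has_derivative assms)
  then have "((\<lambda>x. \<Sum>b\<in>Basis. blinfun_apply (fderiv U x) b *\<^sub>R b) has_derivative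
      (\<lambda>u. \<Sum>b\<in>Basis. blinfun_apply (blinfun_apply (fderiv (fderiv U) x) u) b *\<^sub>R b)) (at x)"
    by (intro has_derivative_sum)
  then show ?thesis
    by (simp add: grad_eq[OF assms(1), abs_def] hess_def[abs_def])
qed

text \<open>Testing the form against \<open>w = hess U x u\<close> turns the bound on the bilinear
  form into one on the operator. A unit basis vector in both slots shows that \<open>L\<close> is
  nonnegative.\<close>

lemma hess_bound:
  assumes bdd: "bdd_above (range (\<lambda>z. bilinear_norm (fderiv (fderiv U) z)))"
    and L: "L = (SUP z. bilinear_norm (fderiv (fderiv U) z))"
  shows "norm (hess U x u) \<le> L * norm u" and "0 \<le> L"
proof -
  have le: "\<bar>hess U x u \<bullet> w\<bar> \<le> L * norm u * norm w" for x u w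
  proof -
    have "bilinear_norm (fderiv (fderiv U) x) \<le> L"
      unfolding L by (rule cSUP_upper[OF UNIV_I bdd])
    then have "bilinear_norm (fderiv (fderiv U) x) * norm u * norm w \<le> L * norm u * norm w"
      by (intro mult_right_mono) auto
    then show ?thesis
      using bilinear_norm_bound[of "fderiv (fderiv U) x" u w] unfolding inner_hess by linarith
  qed
  show "0 \<le> L"
    using le[of undefined "SOME b. b \<in> Basis" "SOME b. b \<in> Basis"] norm_Basis[OF SOME_Basis] by simp
  have "norm (hess U x u) * norm (hess U x u) \<le> L * norm u * norm (hess U x u)"
    using le[of x u "hess U x u"] by (simp add: power2_norm_eq_inner[symmetric] power2_eq_square)
  then show "norm (hess U x u) \<le> L * norm u"
    using \<open>0 \<le> L\<close> by (cases "hess U x u = 0") auto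
qed

text \<open>The mean value inequality for the scalar functions
  \<open>hess U x u \<bullet> w\<close>, whose derivative in \<open>x\<close> is the third
  derivative form; then \<open>w\<close> is taken to be the difference of the two Hessian
  values.\<close>

lemma hess_lipschitz:
  fixes U :: "'a::euclidean_space \<Rightarrow> real"
  assumes dif: "\<And>x. fderiv (fderiv U) differentiable (at x)"
    and bdd: "bdd_above (range (\<lambda>z. trilinear_norm (fderiv (fderiv (fderiv U)) z)))"
    and M: "M = (SUP z. trilinear_norm (fderiv (fderiv (fderiv U)) z))"
  shows "norm (hess U a u - hess U c u) \<le> M * norm (a - c) * norm u" and "0 \<le> M"
proof -
  let ?D = "fderiv (fderiv (fderiv U))"
  have le: "\<bar>blinfun_apply (blinfun_apply (blinfun_apply (?D x) d) u) w\<bar> \<le> M * norm d * norm u * norm w" for x d u w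
  proof -
    have "trilinear_norm (?D x) \<le> M"
      unfolding M by (rule cSUP_upper[OF UNIV_I bdd])
    then have "trilinear_norm (?D x) * norm d * norm u * norm w \<le> M * norm d * norm u * norm w"
      by (intro mult_right_mono) auto
    then show ?thesis
      using trilinear_norm_bound[of "?D x" d u w] by linarith
  qed
  show M0: "0 \<le> M"
    using le[of undefined "SOME b. b \<in> Basis" "SOME b. b \<in> Basis" "SOME b. b \<in> Basis"]
      norm_Basis[OF SOME_Basis] by simp
  have inner_le: "\<bar>hess U a u \<bullet> w - hess U c u \<bullet> w\<bar> \<le> (M * norm u * norm w) * norm (a - c)" for w
  proof -
    have "((\<lambda>x. hess U x u \<bullet> w) has_derivative
        (\<lambda>d. blinfun_apply (blinfun_apply (blinfun_apply (?D x) d) u) w)) (at x)" for x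
      unfolding inner_hess
      by (intro bounded_linear.has_derivative[OF blinfun.bounded_linear_left] fderiv_has_derivative dif)
    moreover have "onorm (\<lambda>d. blinfun_apply (blinfun_apply (blinfun_apply (?D x) d) u) w) \<le> M * norm u * norm w" for x
    proof (rule onorm_le)
      show "norm (blinfun_apply (blinfun_apply (blinfun_apply (?D x) d) u) w) \<le> M * norm u * norm w * norm d" for d
        using le[of x d u w] by (simp add: mult_ac)
    qed
    ultimately have "norm (hess U a u \<bullet> w - hess U c u \<bullet> w) \<le> (M * norm u * norm w) * norm (a - c)"
      by (intro differentiable_bound[of UNIV _ "\<lambda>x d. blinfun_apply (blinfun_apply (blinfun_apply (?D x) d) u) w"]) auto
    then show ?thesis by simp
  qed
  let ?v = "hess U a u - hess U c u"
  have "norm ?v * norm ?v \<le> M * norm (a - c) * norm u * norm ?v"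
    using inner_le[of ?v] by (simp add: inner_diff_left[symmetric] power2_norm_eq_inner[symmetric]
        power2_eq_square mult_ac)
  then show "norm ?v \<le> M * norm (a - c) * norm u"
    using M0 by (cases "?v = 0") auto
qed

section \<open>The Hamiltonian flow\<close>

lemma integral_has_vector_derivative_atLeast:
  fixes f :: "real \<Rightarrow> 'a::banach"
  assumes "continuous_on {0..} f" and t: "0 \<le> t"
  shows "((\<lambda>u. integral {0..u} f) has_vector_derivative f t) (at t within {0..})"
proof -
  have "((\<lambda>u. integral {0..u} f) has_vector_derivative f t) (at t within {0..t + 1})"
    by (rule integral_has_vector_derivative) (use assms in \<open>auto intro: continuous_on_subset\<close>)
  moreover have "at t within {0..t + 1} = at t within {0..}"
    by (rule at_within_nhd[of _ "{..<t + 1}"]) auto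
  ultimately show ?thesis by simp
qed

text \<open>In the norm weighted by \<open>exp (- \<mu> * t)\<close>, integration from 0 has norm at
  most \<open>1 / \<mu>\<close> on the whole half-line. This makes a global solution possible
  without continuation of local ones.\<close>

lemma weighted_integral_bound:
  fixes f :: "real \<Rightarrow> 'a::banach"
  assumes "0 < \<mu>" and cont: "continuous_on {0..} f" and t: "0 \<le> t"
    and bd: "\<And>s. 0 \<le> s \<Longrightarrow> norm (f s) \<le> C * exp (\<mu> * s)"
  shows "norm (exp (- \<mu> * t) *\<^sub>R integral {0..t} f) \<le> C / \<mu>"
proof -
  have C: "0 \<le> C" using order_trans[OF norm_ge_zero bd[of 0]] by simp
  have "((\<lambda>s. C * exp (\<mu> * s)) has_integral (C / \<mu> * exp (\<mu> * t) - C / \<mu> * exp (\<mu> * 0))) {0..t}"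
    using t assms(1)
    by (intro fundamental_theorem_of_calculus)
      (auto intro!: derivative_eq_intros simp flip: has_real_derivative_iff_has_vector_derivative)
  then have int: "(\<lambda>s. C * exp (\<mu> * s)) integrable_on {0..t}"
    "integral {0..t} (\<lambda>s. C * exp (\<mu> * s)) = C / \<mu> * exp (\<mu> * t) - C / \<mu>"
    by (auto simp: has_integral_iff)
  have "norm (integral {0..t} f) \<le> integral {0..t} (\<lambda>s. C * exp (\<mu> * s))"
    by (rule integral_norm_bound_integral)
      (use bd int cont in \<open>auto intro!: integrable_continuous_real intro: continuous_on_subset\<close>)
  also have "\<dots> \<le> C / \<mu> * exp (\<mu> * t)" using int(2) C assms(1) by simp
  finally have "exp (- \<mu> * t) * norm (integral {0..t} f) \<le> exp (- \<mu> * t) * (C / \<mu> * exp (\<mu> * t))"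
    by (intro mult_left_mono) auto
  also have "\<dots> = C / \<mu>" by (simp add: exp_minus)
  finally show ?thesis by simp
qed

text \<open>The Picard map is a contraction of the bounded continuous functions \<open>exp (- \<mu> * t) *\<^sub>R z t\<close>
  on \<open>{0..}\<close> once \<open>\<mu>\<close> exceeds the Lipschitz constant.\<close>

lemma lipschitz_ode_global_solution:
  fixes f :: "'a::banach \<Rightarrow> 'a"
  assumes lip: "\<And>a b. norm (f a - f b) \<le> K * norm (a - b)" and K: "0 \<le> K"
  shows "\<exists>z. z 0 = z0 \<and> (\<forall>t\<ge>0. (z has_vector_derivative f (z t)) (at t within {0..}))"
proof -
  define \<mu> where "\<mu> = K + 1"
  have \<mu>: "0 < \<mu>" "K < \<mu>" using K by (auto simp: \<mu>_def)
  have "continuous_on UNIV f"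
    by (rule lipschitz_on_continuous_on[of K], rule lipschitz_onI) (auto simp: dist_norm lip K)
  then have fcont: "continuous_on {0..} (\<lambda>s. f (exp (\<mu> * s) *\<^sub>R y s))" if "continuous_on {0..} y" for y
    by (rule continuous_on_compose2) (auto intro!: continuous_intros that)
  define \<Gamma> where "\<Gamma> y t = exp (- \<mu> * t) *\<^sub>R (z0 + integral {0..t} (\<lambda>s. f (exp (\<mu> * s) *\<^sub>R y s)))" for y t
  have der: "((\<lambda>t. integral {0..t} (\<lambda>s. f (exp (\<mu> * s) *\<^sub>R y s))) has_vector_derivative f (exp (\<mu> * t) *\<^sub>R y t))
      (at t within {0..})" if "continuous_on {0..} y" "0 \<le> t" for y t
    by (rule integral_has_vector_derivative_atLeast[OF fcont[OF that(1)] that(2)])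
  have "\<exists>y. continuous_on {0..} y \<and> bounded (y ` {0..}) \<and> (\<forall>t\<in>{0..}. \<Gamma> y t = y t)"
  proof (rule contraction_fixpoint_on[where c = "K / \<mu>"])
    fix y :: "real \<Rightarrow> 'a" assume y: "continuous_on {0..} y" "bounded (y ` {0..})"
    obtain B where B: "\<And>s. 0 \<le> s \<Longrightarrow> norm (y s) \<le> B" using y(2) by (auto simp: bounded_iff)
    have "continuous_on {0..} (\<lambda>t. integral {0..t} (\<lambda>s. f (exp (\<mu> * s) *\<^sub>R y s)))"
      unfolding continuous_on_eq_continuous_within
      using has_vector_derivative_continuous[OF der[OF y(1)]] by auto
    then have "continuous_on {0..} (\<Gamma> y)"
      unfolding \<Gamma>_def by (intro continuous_intros)
    moreover have "norm (\<Gamma> y t) \<le> norm z0 + (norm (f 0) + K * B) / \<mu>" if t: "0 \<le> t" for t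
    proof -
      have "norm (f (exp (\<mu> * s) *\<^sub>R y s)) \<le> (norm (f 0) + K * B) * exp (\<mu> * s)" if s: "0 \<le> s" for s
      proof -
        have e: "1 \<le> exp (\<mu> * s)" using s \<mu> by simp
        have "norm (f (exp (\<mu> * s) *\<^sub>R y s)) \<le> norm (f 0) + K * (exp (\<mu> * s) * norm (y s))"
          using lip[of "exp (\<mu> * s) *\<^sub>R y s" 0] norm_triangle_sub[of "f (exp (\<mu> * s) *\<^sub>R y s)" "f 0"] by simp
        also have "\<dots> \<le> norm (f 0) * exp (\<mu> * s) + K * (exp (\<mu> * s) * B)"
          using e B[OF s] K by (intro add_mono mult_left_mono) (auto simp: mult_le_cancel_left1)
        finally show ?thesis by (simp add: algebra_simps)
      qed
      from weighted_integral_bound[OF \<mu>(1) fcont[OF y(1)] t this]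
      have "norm (exp (- \<mu> * t) *\<^sub>R integral {0..t} (\<lambda>s. f (exp (\<mu> * s) *\<^sub>R y s))) \<le> (norm (f 0) + K * B) / \<mu>" .
      moreover have "norm (exp (- \<mu> * t) *\<^sub>R z0) \<le> norm z0"
        using \<mu> t by (simp add: mult_left_le_one_le)
      ultimately show ?thesis
        unfolding \<Gamma>_def scaleR_add_right by (meson norm_triangle_mono)
    qed
    then have "bounded (\<Gamma> y ` {0..})" by (auto simp: bounded_iff)
    ultimately show "continuous_on {0..} (\<Gamma> y) \<and> bounded (\<Gamma> y ` {0..})" ..
  next
    fix y w :: "real \<Rightarrow> 'a" and B t
    assume yw: "continuous_on {0..} y" "continuous_on {0..} w"
      and B: "\<And>s. s \<in> {0..} \<Longrightarrow> norm (y s - w s) \<le> B" and t: "t \<in> {0::real..}"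
    let ?F = "\<lambda>s. f (exp (\<mu> * s) *\<^sub>R y s) - f (exp (\<mu> * s) *\<^sub>R w s)"
    have ci: "continuous_on {0..t} (\<lambda>s. f (exp (\<mu> * s) *\<^sub>R y s))" "continuous_on {0..t} (\<lambda>s. f (exp (\<mu> * s) *\<^sub>R w s))"
      by (auto intro: continuous_on_subset[OF fcont] yw)
    have "\<Gamma> y t - \<Gamma> w t = exp (- \<mu> * t) *\<^sub>R integral {0..t} ?F"
      unfolding \<Gamma>_def
      by (subst integral_diff) (auto intro!: integrable_continuous_real ci simp: scaleR_add_right scaleR_diff_right)
    also have "norm \<dots> \<le> K * B / \<mu>"
    proof (rule weighted_integral_bound[OF \<mu>(1)])
      show "continuous_on {0..} ?F" by (intro continuous_intros fcont yw)
      fix s :: real assume s: "0 \<le> s"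
      have "norm (?F s) \<le> K * norm (exp (\<mu> * s) *\<^sub>R (y s - w s))"
        using lip[of "exp (\<mu> * s) *\<^sub>R y s" "exp (\<mu> * s) *\<^sub>R w s"] by (simp add: scaleR_diff_right)
      also have "\<dots> \<le> K * (exp (\<mu> * s) * B)"
        using B[of s] s K by (intro mult_left_mono) auto
      finally show "norm (?F s) \<le> K * B * exp (\<mu> * s)" by (simp add: mult_ac)
    qed (use t in auto)
    finally show "norm (\<Gamma> y t - \<Gamma> w t) \<le> K / \<mu> * B" by simp
  qed (use \<mu> K in auto)
  then obtain y where y: "continuous_on {0..} y" "\<And>t. 0 \<le> t \<Longrightarrow> \<Gamma> y t = y t" by auto
  define z where "z t = z0 + integral {0..t} (\<lambda>s. f (exp (\<mu> * s) *\<^sub>R y s))" for t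
  have z: "z t = exp (\<mu> * t) *\<^sub>R y t" if "0 \<le> t" for t
    using y(2)[OF that] by (simp add: z_def \<Gamma>_def exp_minus flip: y(2)[OF that])
  have "(z has_vector_derivative f (z t)) (at t within {0..})" if "0 \<le> t" for t
  proof -
    have "(z has_vector_derivative f (exp (\<mu> * t) *\<^sub>R y t)) (at t within {0..})"
      unfolding z_def[abs_def]
      using has_vector_derivative_add[OF has_vector_derivative_const der[OF y(1) that]] by simp
    then show ?thesis by (simp add: z[OF that])
  qed
  moreover have "z 0 = z0" by (simp add: z_def)
  ultimately show ?thesis by blast
qed

text \<open>A first-order system on phase space with Lipschitz constant \<open>1 + L\<close>. At
  \<open>h = 0\<close> floor and ceiling are the identity, so the average of the two gradients is a
  single gradient.\<close>

lemma hamiltonian_solution_exists: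
  fixes U :: "'a::euclidean_space \<Rightarrow> real"
  assumes lip: "\<And>a b. norm (grad U a - grad U b) \<le> L * norm (a - b)" and L: "0 \<le> L"
  shows "\<exists>q p. verlet_solution U 0 x v q p"
proof -
  define f :: "'a \<times> 'a \<Rightarrow> 'a \<times> 'a" where "f = (\<lambda>(a, b). (b, - grad U a))"
  have "norm (f w - f z) \<le> (1 + L) * norm (w - z)" for w z
  proof -
    have "norm (f w - f z) \<le> norm (snd w - snd z) + norm (grad U (fst w) - grad U (fst z))"
      using norm_Pair_le[of "snd w - snd z" "- (grad U (fst w) - grad U (fst z))"]
      by (simp add: f_def case_prod_beta norm_minus_commute)
    also have "\<dots> \<le> norm (w - z) + L * norm (w - z)"
    proof (rule add_mono)
      show "norm (snd w - snd z) \<le> norm (w - z)"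
        by (metis norm_snd_le prod.collapse snd_diff)
      have "norm (fst w - fst z) \<le> norm (w - z)"
        by (metis norm_fst_le prod.collapse fst_diff)
      then show "norm (grad U (fst w) - grad U (fst z)) \<le> L * norm (w - z)"
        using lip L by (meson mult_left_mono order_trans)
    qed
    finally show ?thesis by (simp add: algebra_simps)
  qed
  from lipschitz_ode_global_solution[OF this, of "(x, v)"] L
  obtain z where z0: "z 0 = (x, v)"
    and z: "\<And>t. 0 \<le> t \<Longrightarrow> (z has_vector_derivative f (z t)) (at t within {0..})"
    by auto
  let ?q = "\<lambda>t. fst (z t)" and ?p = "\<lambda>t. snd (z t)"
  have q: "(?q has_vector_derivative ?p t) (at t within {0..})" if "0 \<le> t" for t
    using bounded_linear.has_vector_derivative[OF bounded_linear_fst z[OF that]]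
    by (simp add: f_def case_prod_beta)
  have p: "(?p has_vector_derivative - grad U (?q t)) (at t within {0..})" if "0 \<le> t" for t
    using bounded_linear.has_vector_derivative[OF bounded_linear_snd z[OF that]]
    by (simp add: f_def case_prod_beta)
  have "continuous_on {0..} ?q" "continuous_on {0..} ?p"
    unfolding continuous_on_eq_continuous_within
    using has_vector_derivative_continuous[OF q] has_vector_derivative_continuous[OF p] by auto
  then have "verlet_solution U 0 x v ?q ?p"
    using q p z0 by (simp add: verlet_solution_def grid_floor_def grid_ceiling_def flip: scaleR_2)
  then show ?thesis by blast
qed

section \<open>The velocity Verlet scheme\<close>

text \<open>The equations integrated over one cell, where the right-hand sides depend only on values
  at the two cell ends. The new position \<open>c\<close> uses left-end data alone, so the scheme is
  explicit although the velocity needs the gradient at \<open>c\<close>.\<close>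

fun verlet_step :: "('a::real_inner \<Rightarrow> real) \<Rightarrow> real \<Rightarrow> 'a \<times> 'a \<Rightarrow> 'a \<times> 'a"
  where "verlet_step U h (a, b) =
    (let c = a + h *\<^sub>R b - (h\<^sup>2 / 2) *\<^sub>R grad U a in (c, b - (h / 2) *\<^sub>R (grad U a + grad U c)))"

lemma mesh_cell:
  assumes h: "0 < h" and t: "0 \<le> t"
  obtains n :: nat where "h * real n \<le> t" "t < h * real (Suc n)"
proof
  have f: "0 \<le> \<lfloor>t / h\<rfloor>" using h t by simp
  then have n: "real (nat \<lfloor>t / h\<rfloor>) = of_int \<lfloor>t / h\<rfloor>" by simp
  show "h * real (nat \<lfloor>t / h\<rfloor>) \<le> t"
    using h mult_left_mono[OF of_int_floor_le[of "t / h"], of h] unfolding n by simp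
  show "t < h * real (Suc (nat \<lfloor>t / h\<rfloor>))"
    using h floor_correct[of "t / h"] f by (simp add: field_simps)
qed

lemma floor_mesh_cell:
  fixes t h :: real
  assumes h: "0 < h" and t: "h * real n \<le> t" "t < h * real (Suc n)"
  shows "\<lfloor>t / h\<rfloor> = int n"
  using assms by (intro floor_unique) (auto simp: field_simps)

lemma grid_mesh_cell:
  assumes h: "0 < h" and t: "h * real n < t" "t < h * real (Suc n)"
  shows "grid_floor h t = h * real n" "grid_ceiling h t = h * real (Suc n)" "t \<notin> grid h"
proof -
  show "grid_floor h t = h * real n"
    using floor_mesh_cell[of h n t] assms by (simp add: grid_floor_eq)
  have "\<lceil>t / h\<rceil> = int (Suc n)"
    using assms by (intro ceiling_unique) (auto simp: field_simps)
  then show "grid_ceiling h t = h * real (Suc n)"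
    using h by (simp only: grid_ceiling_eq of_int_of_nat_eq)
  show "t \<notin> grid h"
  proof
    assume "t \<in> grid h"
    then obtain k :: int where k: "t = h * of_int k" by (auto simp: grid_def)
    have "real_of_int (int n) < of_int k" "of_int k < real_of_int (int (Suc n))"
      using t h unfolding k by (auto simp: mult_less_cancel_left_pos)
    then show False unfolding of_int_less_iff by linarith
  qed
qed

lemma continuous_on_atLeast_mesh:
  fixes f :: "real \<Rightarrow> 'a::topological_space"
  assumes h: "0 < h" and cont: "\<And>n. continuous_on {h * real n..h * real (Suc n)} f"
  shows "continuous_on {0..} f"
proof -
  have part: "continuous_on {0..h * real n} f" for n
  proof (induction n)
    case 0
    show ?case by simp
  next
    case (Suc n)
    have "{0..h * real (Suc n)} = {0..h * real n} \<union> {h * real n..h * real (Suc n)}"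
      using h by (intro ivl_disj_un_two_touch(4)[symmetric]) auto
    then show ?case
      using continuous_on_closed_Un[OF _ _ Suc cont[of n]] by simp
  qed
  show ?thesis
    unfolding continuous_on_eq_continuous_within
  proof
    fix t :: real assume t: "t \<in> {0..}"
    then obtain n where n: "t < h * real (Suc n)" using mesh_cell[OF h, of t] by auto
    have "at t within {0..h * real (Suc n)} = at t within {0..}"
      by (rule at_within_nhd[of _ "{..<h * real (Suc n)}"]) (use n in auto)
    moreover have "continuous (at t within {0..h * real (Suc n)}) f"
      using part[of "Suc n"] n t unfolding continuous_on_eq_continuous_within by auto
    ultimately show "continuous (at t within {0..}) f" by (simp add: continuous_within)
  qed
qed

lemma quadratic_has_vector_derivative:
  "((\<lambda>t. (t - a) *\<^sub>R b - ((t - a)\<^sup>2 / 2) *\<^sub>R c) has_vector_derivative b - (t - a) *\<^sub>R c) (at t within S)"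
proof -
  have "((\<lambda>t. (t - a) *\<^sub>R b) has_vector_derivative (t - a) *\<^sub>R 0 + 1 *\<^sub>R b) (at t within S)"
    by (intro has_vector_derivative_scaleR) (auto intro!: derivative_eq_intros)
  moreover have "((\<lambda>t. ((t - a)\<^sup>2 / 2) *\<^sub>R c) has_vector_derivative
      ((t - a)\<^sup>2 / 2) *\<^sub>R 0 + (t - a) *\<^sub>R c) (at t within S)"
    by (intro has_vector_derivative_scaleR) (auto intro!: derivative_eq_intros)
  ultimately show ?thesis
    using has_vector_derivative_diff by fastforce
qed

text \<open>Iterating \<open>verlet_step\<close> gives the grid values; within a cell the position
  is the quadratic \<open>Q n\<close> and the velocity the affine function \<open>P n\<close>, read
  off from the constant data of that cell.\<close>

lemma verlet_solution_exists:
  fixes U :: "'a::real_inner \<Rightarrow> real"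
  assumes h: "0 < h"
  shows "\<exists>q p. verlet_solution U h x v q p"
proof -
  define z where "z n = (verlet_step U h ^^ n) (x, v)" for n
  define qn where "qn n = fst (z n)" for n
  define pn where "pn n = snd (z n)" for n
  have z_Suc: "z (Suc n) = verlet_step U h (qn n, pn n)" for n
    by (simp add: z_def qn_def pn_def)
  have qn_Suc: "qn (Suc n) = qn n + h *\<^sub>R pn n - (h\<^sup>2 / 2) *\<^sub>R grad U (qn n)" for n
    by (simp add: qn_def[of "Suc n"] z_Suc Let_def)
  have pn_Suc: "pn (Suc n) = pn n - (h / 2) *\<^sub>R (grad U (qn n) + grad U (qn (Suc n)))" for n
    by (simp add: pn_def[of "Suc n"] z_Suc Let_def qn_Suc)
  define Q where "Q n t = qn n + (t - h * real n) *\<^sub>R pn n - ((t - h * real n)\<^sup>2 / 2) *\<^sub>R grad U (qn n)" for n t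
  define P where "P n t = pn n - ((t - h * real n) / 2) *\<^sub>R (grad U (qn n) + grad U (qn (Suc n)))" for n t
  define q where "q t = Q (nat \<lfloor>t / h\<rfloor>) t" for t
  define p where "p t = P (nat \<lfloor>t / h\<rfloor>) t" for t
  have at_grid: "q (h * real n) = qn n" "p (h * real n) = pn n" for n
    using h by (simp_all add: q_def p_def Q_def P_def)
  \<comment> \<open>At a right end \<open>t = h * real (Suc n)\<close> the floor already selects the
    next cell; the recursions say that both polynomials agree there, which gives continuity.\<close>
  have inside: "q t = Q n t" "p t = P n t" if t: "t \<in> {h * real n..h * real (Suc n)}" for n t
  proof -
    have "q t = Q n t \<and> p t = P n t"
    proof (cases "t = h * real (Suc n)")
      case True
      have "t - h * real n = h" using True by (simp add: algebra_simps)
      then show ?thesis using at_grid[of "Suc n"] True by (simp add: Q_def P_def qn_Suc pn_Suc)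
    next
      case False
      then have "\<lfloor>t / h\<rfloor> = int n" using t h by (intro floor_mesh_cell) auto
      then show ?thesis by (simp add: q_def p_def)
    qed
    then show "q t = Q n t" "p t = P n t" by auto
  qed
  have QP_cont: "continuous_on S (Q n)" "continuous_on S (P n)" for S n
    unfolding Q_def P_def by (intro continuous_intros; simp)+
  have "continuous_on {0..} q"
    by (rule continuous_on_atLeast_mesh[OF h], rule continuous_on_eq[OF QP_cont(1)]) (simp only: inside)
  moreover have "continuous_on {0..} p"
    by (rule continuous_on_atLeast_mesh[OF h], rule continuous_on_eq[OF QP_cont(2)]) (simp only: inside)
  moreover have "q 0 = x" "p 0 = v"
    using at_grid[of 0] by (simp_all add: qn_def pn_def z_def)
  moreover have "(q has_vector_derivative
        p (grid_floor h t) - (t - grid_floor h t) *\<^sub>R grad U (q (grid_floor h t))) (at t within {0..}) \<and>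
      (p has_vector_derivative
        - ((1/2) *\<^sub>R (grad U (q (grid_floor h t)) + grad U (q (grid_ceiling h t))))) (at t within {0..})"
    if t: "0 \<le> t" "t \<notin> grid h" for t
  proof -
    obtain n where n: "h * real n \<le> t" "t < h * real (Suc n)" using mesh_cell[OF h t(1)] by auto
    have "h * real n \<in> grid h" unfolding grid_def by (metis of_int_of_nat_eq rangeI)
    then have n': "h * real n < t" using n t(2) by (cases "t = h * real n") auto
    note gr = grid_mesh_cell[OF h n' n(2)]
    let ?S = "{h * real n<..<h * real (Suc n)}"
    have tS: "t \<in> ?S" using n n' by simp
    have eqS: "Q n y = q y" "P n y = p y" if "y \<in> ?S" for y
      using that inside[of y n] by auto
    have "(Q n has_vector_derivative pn n - (t - h * real n) *\<^sub>R grad U (qn n)) (at t)"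
      using has_vector_derivative_add[OF has_vector_derivative_const
          quadratic_has_vector_derivative[of "h * real n" "pn n" "grad U (qn n)" t UNIV], of "qn n"]
      by (simp add: Q_def[abs_def] add_diff_eq)
    then have "(q has_vector_derivative pn n - (t - h * real n) *\<^sub>R grad U (qn n)) (at t)"
      by (rule has_vector_derivative_transform_within_open[OF _ open_greaterThanLessThan tS eqS(1)])
    moreover have "(P n has_vector_derivative - ((1/2) *\<^sub>R (grad U (qn n) + grad U (qn (Suc n))))) (at t)"
      unfolding P_def has_vector_derivative_def
      by (auto intro!: derivative_eq_intros simp: algebra_simps)
    then have "(p has_vector_derivative - ((1/2) *\<^sub>R (grad U (qn n) + grad U (qn (Suc n))))) (at t)"
      by (rule has_vector_derivative_transform_within_open[OF _ open_greaterThanLessThan tS eqS(2)])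
    ultimately show ?thesis
      unfolding gr at_grid by (blast intro: has_vector_derivative_at_within)
  qed
  ultimately have "verlet_solution U h x v q p"
    unfolding verlet_solution_def using h by blast
  then show ?thesis by blast
qed

text \<open>At grid points a solution is only continuous, so the fundamental theorem of calculus is
  applied with derivatives in the interior of a cell.\<close>

lemma verlet_solution_step:
  fixes U :: "'a::euclidean_space \<Rightarrow> real"
  assumes h: "0 < h" and sol: "verlet_solution U h x v q p"
  defines "\<tau> \<equiv> \<lambda>n. h * real n"
  shows "q (\<tau> (Suc n)) = q (\<tau> n) + h *\<^sub>R p (\<tau> n) - (h\<^sup>2 / 2) *\<^sub>R grad U (q (\<tau> n))"
    and "p (\<tau> (Suc n)) = p (\<tau> n) - (h / 2) *\<^sub>R (grad U (q (\<tau> n)) + grad U (q (\<tau> (Suc n))))"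
proof -
  have \<tau>: "\<tau> n \<le> \<tau> (Suc n)" "0 \<le> \<tau> n" "\<tau> (Suc n) - \<tau> n = h"
    using h by (auto simp: \<tau>_def algebra_simps)
  have cont: "continuous_on {\<tau> n..\<tau> (Suc n)} q" "continuous_on {\<tau> n..\<tau> (Suc n)} p"
    using sol \<tau> unfolding verlet_solution_def by (auto intro: continuous_on_subset)
  have der: "(q has_vector_derivative p (\<tau> n) - (t - \<tau> n) *\<^sub>R grad U (q (\<tau> n))) (at t)"
    "(p has_vector_derivative - ((1/2) *\<^sub>R (grad U (q (\<tau> n)) + grad U (q (\<tau> (Suc n)))))) (at t)"
    if t: "t \<in> {\<tau> n<..<\<tau> (Suc n)}" for t
  proof -
    note gr = grid_mesh_cell[of h n t]
    have "at t within {0..} = at t"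
      by (rule at_within_interior) (use t \<tau> in \<open>auto simp: interior_Ici\<close>)
    moreover have "0 \<le> t" using t \<tau> by auto
    ultimately show "(q has_vector_derivative p (\<tau> n) - (t - \<tau> n) *\<^sub>R grad U (q (\<tau> n))) (at t)"
      "(p has_vector_derivative - ((1/2) *\<^sub>R (grad U (q (\<tau> n)) + grad U (q (\<tau> (Suc n)))))) (at t)"
      using sol gr h t unfolding verlet_solution_def \<tau>_def by auto
  qed
  have "((\<lambda>t. p (\<tau> n) - (t - \<tau> n) *\<^sub>R grad U (q (\<tau> n))) has_integral (q (\<tau> (Suc n)) - q (\<tau> n))) {\<tau> n..\<tau> (Suc n)}"
    by (rule fundamental_theorem_of_calculus_interior[OF \<tau>(1) cont(1) der(1)])
  moreover have "((\<lambda>t. p (\<tau> n) - (t - \<tau> n) *\<^sub>R grad U (q (\<tau> n))) has_integral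
     (((\<tau> (Suc n) - \<tau> n) *\<^sub>R p (\<tau> n) - ((\<tau> (Suc n) - \<tau> n)\<^sup>2 / 2) *\<^sub>R grad U (q (\<tau> n)))
      - ((\<tau> n - \<tau> n) *\<^sub>R p (\<tau> n) - ((\<tau> n - \<tau> n)\<^sup>2 / 2) *\<^sub>R grad U (q (\<tau> n))))) {\<tau> n..\<tau> (Suc n)}"
    by (rule fundamental_theorem_of_calculus[OF \<tau>(1) quadratic_has_vector_derivative])
  ultimately have "q (\<tau> (Suc n)) - q (\<tau> n) = h *\<^sub>R p (\<tau> n) - (h\<^sup>2 / 2) *\<^sub>R grad U (q (\<tau> n))"
    unfolding \<tau>(3) by (simp add: has_integral_unique)
  then show "q (\<tau> (Suc n)) = q (\<tau> n) + h *\<^sub>R p (\<tau> n) - (h\<^sup>2 / 2) *\<^sub>R grad U (q (\<tau> n))"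
    by (simp add: algebra_simps)
  let ?c = "- ((1/2) *\<^sub>R (grad U (q (\<tau> n)) + grad U (q (\<tau> (Suc n)))))"
  have "((\<lambda>t. ?c) has_integral (p (\<tau> (Suc n)) - p (\<tau> n))) {\<tau> n..\<tau> (Suc n)}"
    by (rule fundamental_theorem_of_calculus_interior[OF \<tau>(1) cont(2) der(2)])
  moreover have "((\<lambda>t. ?c) has_integral (\<tau> (Suc n) - \<tau> n) *\<^sub>R ?c) {\<tau> n..\<tau> (Suc n)}"
    using has_integral_const_real[of ?c "\<tau> n" "\<tau> (Suc n)"] \<tau>(1) by simp
  ultimately have "p (\<tau> (Suc n)) - p (\<tau> n) = h *\<^sub>R ?c"
    unfolding \<tau>(3) by (rule has_integral_unique)
  then show "p (\<tau> (Suc n)) = p (\<tau> n) - (h / 2) *\<^sub>R (grad U (q (\<tau> n)) + grad U (q (\<tau> (Suc n))))"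
    by (simp add: algebra_simps)
qed

section \<open>Verlet solutions as solutions of integral equations\<close>

definition ham_operator :: "(real \<Rightarrow> 'a::euclidean_space) \<Rightarrow> real \<Rightarrow> 'a"
  where "ham_operator f t = integral {0..t} (\<lambda>s. (t - s) *\<^sub>R f s)"

text \<open>The composite trapezoidal rule with step \<open>h\<close> for
  \<open>(t - s) *\<^sub>R f s\<close>. At \<open>t = h * m\<close> the last node has weight zero,
  so only values at earlier grid points enter, as in the explicit scheme.\<close>

definition grid_operator :: "real \<Rightarrow> (real \<Rightarrow> 'a::euclidean_space) \<Rightarrow> real \<Rightarrow> 'a"
  where "grid_operator h f t = (\<Sum>k<nat \<lfloor>t / h\<rfloor>. (h / 2) *\<^sub>R
    ((t - h * real k) *\<^sub>R f (h * real k) + (t - h * real (Suc k)) *\<^sub>R f (h * real (Suc k))))"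

lemma path_operator_ham:
  assumes T: "0 < T"
  shows "path_operator {0..T} T (ham_operator :: (real \<Rightarrow> 'a::euclidean_space) \<Rightarrow> real \<Rightarrow> 'a)"
proof
  fix f g :: "real \<Rightarrow> 'a" and t c B :: real
  assume f: "continuous_on {0..T} f"
  have int: "(\<lambda>s. (t - s) *\<^sub>R f s) integrable_on {0..t}" if "continuous_on {0..T} f" "t \<in> {0..T}" for t and f :: "real \<Rightarrow> 'a"
    by (intro integrable_continuous_real continuous_intros continuous_on_subset[OF that(1)]) (use that in auto)
  show "ham_operator (\<lambda>s. c *\<^sub>R f s) t = c *\<^sub>R ham_operator f t" if "t \<in> {0..T}"
    using integral_cmul[of "{0..t}" c "\<lambda>s. (t - s) *\<^sub>R f s"]
    by (simp add: ham_operator_def mult.commute)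
  show "continuous_on {0..T} (ham_operator f)"
  proof -
    \<comment> \<open>Splitting \<open>t - s\<close> removes \<open>t\<close> from the integrand, so
      continuity follows from that of indefinite integrals.\<close>
    have "continuous_on {0..T} (\<lambda>t. t *\<^sub>R integral {0..t} f - integral {0..t} (\<lambda>s. s *\<^sub>R f s))"
      by (intro continuous_intros indefinite_integral_continuous_1 integrable_continuous_real f)
    moreover have "t *\<^sub>R integral {0..t} f - integral {0..t} (\<lambda>s. s *\<^sub>R f s) = ham_operator f t"
      if t: "t \<in> {0..T}" for t
    proof -
      have ft: "continuous_on {0..t} f" using t by (intro continuous_on_subset[OF f]) auto
      have "ham_operator f t = integral {0..t} (\<lambda>s. t *\<^sub>R f s - s *\<^sub>R f s)"
        by (simp add: ham_operator_def scaleR_diff_left)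
      also have "\<dots> = integral {0..t} (\<lambda>s. t *\<^sub>R f s) - integral {0..t} (\<lambda>s. s *\<^sub>R f s)"
        by (intro integral_diff integrable_continuous_real continuous_intros ft)
      finally show ?thesis by simp
    qed
    ultimately show ?thesis by (rule continuous_on_eq)
  qed
  show "norm (ham_operator f t) \<le> T\<^sup>2 * B"
    if B: "\<And>s. s \<in> {0..T} \<Longrightarrow> norm (f s) \<le> B" and t: "t \<in> {0..T}"
  proof -
    have B0: "0 \<le> B" using order_trans[OF norm_ge_zero B[OF t]] .
    have "norm (ham_operator f t) \<le> (T * B) * (t - 0)"
      unfolding ham_operator_def
    proof (rule integral_bound)
      show "continuous_on {0..t} (\<lambda>s. (t - s) *\<^sub>R f s)"
        by (intro continuous_intros continuous_on_subset[OF f]) (use t in auto)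
      show "norm ((t - s) *\<^sub>R f s) \<le> T * B" if "s \<in> {0..t}" for s
        using that t B[of s] by (auto intro!: mult_mono)
    qed (use t in auto)
    also have "\<dots> \<le> (T * B) * T" using t T B0 by (intro mult_left_mono) auto
    finally show ?thesis by (simp add: power2_eq_square mult_ac)
  qed
  assume g: "continuous_on {0..T} g"
  show "ham_operator (\<lambda>s. f s + g s) t = ham_operator f t + ham_operator g t" if t: "t \<in> {0..T}"
    unfolding ham_operator_def scaleR_add_right by (rule integral_add[OF int[OF f t] int[OF g t]])
qed (use T in auto)

lemma nat_floor_grid: "0 < h \<Longrightarrow> nat \<lfloor>h * real m / h\<rfloor> = m"
  by simp

text \<open>The observed times form a finite set, so continuity is automatic. For the bound, each of
  the \<open>m\<close> cells contributes at most \<open>h * (T * B)\<close> with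
  \<open>T = h * real N\<close>, and \<open>h * m\<close> is at most \<open>T\<close>.\<close>

lemma path_operator_grid:
  assumes h: "0 < h" and N: "0 < N"
  shows "path_operator ((\<lambda>k. h * real k) ` {..N}) (h * real N)
    (grid_operator h :: (real \<Rightarrow> 'a::euclidean_space) \<Rightarrow> real \<Rightarrow> 'a)"
proof
  let ?I = "(\<lambda>k. h * real k) ` {..N}" and ?T = "h * real N"
  show "0 < ?T" using h N by simp
  show "compact ?I" by (simp add: finite_imp_compact)
  show "?I \<subseteq> {0..?T}" using h by auto
  show "?T \<in> ?I" by (rule imageI) simp
  fix f g :: "real \<Rightarrow> 'a" and t c B :: real
  show "continuous_on ?I (grid_operator h f)" by (simp add: continuous_on_finite)
  show "grid_operator h (\<lambda>s. f s + g s) t = grid_operator h f t + grid_operator h g t"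
    unfolding grid_operator_def sum.distrib[symmetric]
    by (intro sum.cong refl) (simp only: scaleR_add_right ac_simps)
  show "grid_operator h (\<lambda>s. c *\<^sub>R f s) t = c *\<^sub>R grid_operator h f t"
    by (simp add: grid_operator_def scaleR_sum_right scaleR_add_right mult_ac)
  show "norm (grid_operator h f t) \<le> ?T\<^sup>2 * B"
    if B: "\<And>s. s \<in> ?I \<Longrightarrow> norm (f s) \<le> B" and t: "t \<in> ?I"
  proof -
    obtain m where m: "t = h * real m" "m \<le> N" using t by auto
    have B0: "0 \<le> B" using order_trans[OF norm_ge_zero B[OF t]] .
    have mT: "h * real m \<le> ?T" using m h by simp
    have w: "norm ((t - h * real j) *\<^sub>R f (h * real j)) \<le> ?T * B" if "j \<le> m" for j
    proof -
      have "norm (f (h * real j)) \<le> B" using that m by (intro B) auto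
      moreover have "0 \<le> h * real j" "h * real j \<le> h * real m" using that h by auto
      then have "\<bar>t - h * real j\<bar> \<le> ?T" using m(1) mT by linarith
      ultimately show ?thesis using B0 by (simp add: mult_mono)
    qed
    have "norm (grid_operator h f t) \<le> (\<Sum>k<m. h * (?T * B))"
      unfolding grid_operator_def m(1) nat_floor_grid[OF h]
    proof (rule sum_norm_le)
      fix k assume k: "k \<in> {..<m}"
      let ?a = "(h * real m - h * real k) *\<^sub>R f (h * real k)"
      let ?b = "(h * real m - h * real (Suc k)) *\<^sub>R f (h * real (Suc k))"
      have "norm (?a + ?b) \<le> ?T * B + ?T * B"
        using k w[of k] w[of "Suc k"] unfolding m(1) by (intro norm_triangle_mono) auto
      then have "(h / 2) * norm (?a + ?b) \<le> (h / 2) * (?T * B + ?T * B)"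
        using h by (intro mult_left_mono) auto
      also have "\<dots> = h * (?T * B)" by (simp add: field_simps)
      finally show "norm ((h / 2) *\<^sub>R (?a + ?b)) \<le> h * (?T * B)"
        using h by simp
    qed
    also have "\<dots> = (h * real m) * (?T * B)" by simp
    also have "\<dots> \<le> ?T * (?T * B)" using mT B0 h by (intro mult_right_mono) auto
    finally show ?thesis by (simp add: power2_eq_square mult_ac)
  qed
qed

text \<open>The function \<open>(t - s) *\<^sub>R p s + q s\<close> of \<open>s\<close> runs from
  \<open>t *\<^sub>R v + x\<close> to \<open>q t\<close>, and in its derivative the velocity
  cancels, leaving the weighted gradient.\<close>

lemma verlet_path_ham:
  fixes U :: "'a::euclidean_space \<Rightarrow> real"
  assumes sol: "verlet_solution U 0 x v q p" and t: "0 \<le> t"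
  shows "q t = x + t *\<^sub>R v - ham_operator (\<lambda>s. grad U (q s)) t"
proof -
  have cont: "continuous_on {0..t} q" "continuous_on {0..t} p" and init: "q 0 = x" "p 0 = v"
    using sol unfolding verlet_solution_def by (auto intro: continuous_on_subset)
  have "((\<lambda>s. (t - s) *\<^sub>R p s + q s) has_vector_derivative - ((t - s) *\<^sub>R grad U (q s))) (at s)"
    if s: "s \<in> {0<..<t}" for s
  proof -
    have "at s within {0..} = at s"
      by (rule at_within_interior) (use s in \<open>auto simp: interior_Ici\<close>)
    moreover have "0 \<le> s" using s by simp
    ultimately have q: "(q has_vector_derivative p s) (at s)"
      and p: "(p has_vector_derivative - grad U (q s)) (at s)"
      using sol by (simp_all add: verlet_solution_def grid_floor_def grid_ceiling_def flip: scaleR_2)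
        metis+
    have "((\<lambda>s. (t - s) *\<^sub>R p s) has_vector_derivative (t - s) *\<^sub>R (- grad U (q s)) + (- 1) *\<^sub>R p s) (at s)"
      by (intro has_vector_derivative_scaleR p) (auto intro!: derivative_eq_intros)
    from has_vector_derivative_add[OF this q] show ?thesis by simp
  qed
  then have "((\<lambda>s. - ((t - s) *\<^sub>R grad U (q s))) has_integral
      (((t - t) *\<^sub>R p t + q t) - ((t - 0) *\<^sub>R p 0 + q 0))) {0..t}"
    by (intro fundamental_theorem_of_calculus_interior t continuous_intros cont)
  then have "((\<lambda>s. (t - s) *\<^sub>R grad U (q s)) has_integral - (q t - (t *\<^sub>R v + x))) {0..t}"
    using has_integral_neg by (force simp: init)
  then show ?thesis
    unfolding ham_operator_def by (simp add: integral_unique)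
qed

text \<open>The discrete form of the same argument: the increments of
  \<open>(t - \<tau> k) *\<^sub>R p (\<tau> k) + q (\<tau> k)\<close> are exactly the trapezoidal
  terms, and they telescope.\<close>

lemma verlet_path_grid:
  fixes U :: "'a::euclidean_space \<Rightarrow> real"
  assumes h: "0 < h" and sol: "verlet_solution U h x v q p"
  shows "q (h * real m) = x + (h * real m) *\<^sub>R v - grid_operator h (\<lambda>s. grad U (q s)) (h * real m)"
proof -
  let ?\<tau> = "\<lambda>k. h * real k" and ?t = "h * real m"
  let ?S = "\<lambda>k. (?t - ?\<tau> k) *\<^sub>R p (?\<tau> k) + q (?\<tau> k)"
  have step: "?S (Suc k) - ?S k = - ((h / 2) *\<^sub>R ((?t - ?\<tau> k) *\<^sub>R grad U (q (?\<tau> k))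
      + (?t - ?\<tau> (Suc k)) *\<^sub>R grad U (q (?\<tau> (Suc k)))))" for k
  proof -
    define a where "a = ?t - ?\<tau> (Suc k)"
    have a: "?t - ?\<tau> (Suc k) = a" "?t - ?\<tau> k = a + h" by (simp_all add: a_def algebra_simps)
    show ?thesis
      unfolding a verlet_solution_step[OF h sol, of k]
      by (simp add: algebra_simps power2_eq_square flip: scaleR_add_left)
  qed
  have "(\<Sum>k<m. ?S (Suc k) - ?S k) = ?S m - ?S 0"
    by (rule sum_lessThan_telescope)
  then have "?S m - ?S 0 = - grid_operator h (\<lambda>s. grad U (q s)) ?t"
    unfolding grid_operator_def nat_floor_grid[OF h] step by (simp add: sum_negf)
  moreover have "q 0 = x" "p 0 = v" using sol by (auto simp: verlet_solution_def)
  ultimately show ?thesis by (simp add: algebra_simps)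
qed

text \<open>Uniqueness of the position at observed times, which is what the definite description in
  \<open>verlet_pos\<close> requires at time \<open>T\<close>.\<close>

lemma (in path_operator) path_unique:
  assumes L: "0 \<le> L" "L * T\<^sup>2 \<le> 1 / 6"
    and lip: "\<And>a b. norm (g a - g b) \<le> L * norm (a - b)"
    and q: "continuous_on I q" "\<And>t. t \<in> I \<Longrightarrow> q t = x + t *\<^sub>R v - J (\<lambda>s. g (q s)) t"
    and q': "continuous_on I q'" "\<And>t. t \<in> I \<Longrightarrow> q' t = x + t *\<^sub>R v - J (\<lambda>s. g (q' s)) t"
    and t: "t \<in> I"
  shows "q t = q' t"
proof -
  have "continuous_on UNIV g"
    by (rule lipschitz_on_continuous_on[of L], rule lipschitz_onI) (auto simp: dist_norm lip L)
  then have c: "continuous_on I (\<lambda>s. g (r s))" if "continuous_on I r" for r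
    by (rule continuous_on_compose2[OF _ that]) auto
  let ?f = "\<lambda>s. g (q s) - g (q' s)"
  have "norm (q t - q' t) \<le> 6 / 5 * (0 + T\<^sup>2 * 0)"
  proof (rule volterra_bound[OF L _ _ _ _ _ t, where f = ?f and r = "\<lambda>t. 0"])
    show "q t - q' t = 0 - J ?f t" if "t \<in> I" for t
      using q(2)[OF that] q'(2)[OF that] J_diff[OF c[OF q(1)] c[OF q'(1)] that] by simp
  qed (use lip in \<open>auto intro!: continuous_intros c q(1) q'(1)\<close>)
  then show ?thesis by simp
qed

text \<open>The two cases of \<open>h\<close> meet here: all times in \<open>{0..T}\<close> are
  observed for \<open>h = 0\<close>, and the grid points in that interval for \<open>h > 0\<close>,
  where \<open>T / h \<in> \<nat>\<close> makes \<open>T\<close> an observed time.\<close>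

lemma verlet_path_operator:
  fixes U :: "'a::euclidean_space \<Rightarrow> real"
  assumes T: "0 < T" and h: "0 \<le> h" and Th: "h > 0 \<longrightarrow> T / h \<in> \<nat>"
    and lip: "\<And>a b. norm (grad U a - grad U b) \<le> L * norm (a - b)" and L: "0 \<le> L"
  obtains I and J :: "(real \<Rightarrow> 'a) \<Rightarrow> real \<Rightarrow> 'a" where "path_operator I T J"
    "\<And>x v q p. verlet_solution U h x v q p \<Longrightarrow> continuous_on I q"
    "\<And>x v q p t. verlet_solution U h x v q p \<Longrightarrow> t \<in> I \<Longrightarrow> q t = x + t *\<^sub>R v - J (\<lambda>s. grad U (q s)) t"
    "\<And>x v. \<exists>q p. verlet_solution U h x v q p"
proof (cases "h = 0")
  case True
  show ?thesis
  proof (rule that[OF path_operator_ham[OF T]])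
    show "\<exists>q p. verlet_solution U h x v q p" for x v
      unfolding True by (rule hamiltonian_solution_exists[OF lip L])
    show "continuous_on {0..T} q" if "verlet_solution U h x v q p" for x v q p
      using that unfolding verlet_solution_def by (auto intro: continuous_on_subset)
    show "q t = x + t *\<^sub>R v - ham_operator (\<lambda>s. grad U (q s)) t"
      if "verlet_solution U h x v q p" "t \<in> {0..T}" for x v q p t
      using that unfolding True by (intro verlet_path_ham) auto
  qed
next
  case False
  then have h: "0 < h" using h by simp
  then obtain N where "T / h = real N" using Th Nats_cases by metis
  then have TN: "T = h * real N" using h by (simp add: field_simps)
  with T h have N: "0 < N" by (cases N) auto
  show ?thesis
    unfolding TN
  proof (rule that[unfolded TN, OF path_operator_grid[OF h N]])
    show "\<exists>q p. verlet_solution U h x v q p" for x v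
      by (rule verlet_solution_exists[OF h])
    show "continuous_on ((\<lambda>k. h * real k) ` {..N}) q" for q :: "real \<Rightarrow> 'a"
      by (simp add: continuous_on_finite)
    show "q t = x + t *\<^sub>R v - grid_operator h (\<lambda>s. grad U (q s)) t"
      if "verlet_solution U h x v q p" "t \<in> (\<lambda>k. h * real k) ` {..N}" for x v q p t
      using that verlet_path_grid[OF h that(1)] by auto
  qed
qed

lemma verlet_position_flow:
  fixes U :: "'a::euclidean_space \<Rightarrow> real"
  assumes C3: "C3 U"
    and "bdd_above (range (\<lambda>z. bilinear_norm (fderiv (fderiv U) z)))"
    and "L = (SUP z. bilinear_norm (fderiv (fderiv U) z))"
    and "bdd_above (range (\<lambda>z. trilinear_norm (fderiv (fderiv (fderiv U)) z)))"
    and "M = (SUP z. trilinear_norm (fderiv (fderiv (fderiv U)) z))"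
    and T: "0 < T" and h: "0 \<le> h" and LT: "L * (T\<^sup>2 + T * h) \<le> 1 / 6" and Th: "h > 0 \<longrightarrow> T / h \<in> \<nat>"
  obtains I J q where "position_flow I T J (grad U) (hess U) L M q"
    "\<And>x v. verlet_pos U h T x v = q x v T"
proof -
  have dif: "\<And>x. U differentiable (at x)" "\<And>x. fderiv U differentiable (at x)"
    "\<And>x. fderiv (fderiv U) differentiable (at x)"
    using C3 by (auto simp: C3_def)
  note Hb = hess_bound[OF assms(2,3)] and Hl = hess_lipschitz[OF dif(3) assms(4,5)]
  have der: "(grad U has_derivative hess U a) (at a)" for a
    by (rule grad_has_derivative[OF dif(1,2)])
  have lip: "norm (grad U a - grad U b) \<le> L * norm (a - b)" for a b
    using differentiable_bound[of UNIV "grad U" "hess U" L b a] der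
    by (simp add: Hb onorm_le norm_minus_commute)
  have "0 \<le> L * (T * h)" using Hb(2) T h by simp
  then have LT2: "L * T\<^sup>2 \<le> 1 / 6" using LT by (simp add: distrib_left)
  obtain I and J :: "(real \<Rightarrow> 'a) \<Rightarrow> real \<Rightarrow> 'a" where po: "path_operator I T J"
    and cont: "\<And>x v q p. verlet_solution U h x v q p \<Longrightarrow> continuous_on I q"
    and eq: "\<And>x v q p t. verlet_solution U h x v q p \<Longrightarrow> t \<in> I \<Longrightarrow>
      q t = x + t *\<^sub>R v - J (\<lambda>s. grad U (q s)) t"
    and ex: "\<And>x v. \<exists>q p. verlet_solution U h x v q p"
    using verlet_path_operator[OF T h Th lip Hb(2)] by blast
  interpret path_operator I T J by (rule po)
  define q where "q x v = (SOME q. \<exists>p. verlet_solution U h x v q p)" for x v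
  have q: "\<exists>p. verlet_solution U h x v (q x v) p" for x v
    unfolding q_def using ex[of x v] by (rule someI_ex)
  have qc: "continuous_on I (q x v)" for x v using q cont by blast
  have qe: "q x v t = x + t *\<^sub>R v - J (\<lambda>s. grad U (q x v s)) t" if "t \<in> I" for x v t
    using q[of x v] eq that by blast
  have "position_flow I T J (grad U) (hess U) L M q"
    by unfold_locales (use der Hb Hl LT2 qc qe in auto)
  moreover have "verlet_pos U h T x v = q x v T" for x v
    unfolding verlet_pos_def
  proof (rule the_equality)
    show "\<exists>r p. verlet_solution U h x v r p \<and> q x v T = r T" using q by blast
    fix a assume "\<exists>r p. verlet_solution U h x v r p \<and> a = r T"
    then obtain r p where r: "verlet_solution U h x v r p" "a = r T" by blast
    have "r T = q x v T"
      by (rule path_unique[OF Hb(2) LT2 lip cont[OF r(1)] eq[OF r(1)] qc qe T_in_I])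
    then show "a = q x v T" using r by simp
  qed
  ultimately show ?thesis using that by blast
qed

section \<open>Total variation distance and the final estimate\<close>

lemma tv_dist_le:
  assumes "\<And>A. A \<in> sets borel \<Longrightarrow> \<bar>measure \<nu> A - measure \<eta> A\<bar> \<le> c"
  shows "tv_dist \<nu> \<eta> \<le> c"
  unfolding tv_dist_def by (rule cSUP_least) (use assms in auto)

lemma abs_measure_diff_le_tv_dist:
  assumes "prob_space \<nu>" "prob_space \<eta>" "A \<in> sets borel"
  shows "\<bar>measure \<nu> A - measure \<eta> A\<bar> \<le> tv_dist \<nu> \<eta>"
  unfolding tv_dist_def
proof (rule cSUP_upper[OF assms(3)])
  show "bdd_above ((\<lambda>A. \<bar>measure \<nu> A - measure \<eta> A\<bar>) ` sets borel)"
  proof (rule bdd_aboveI2)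
    show "\<bar>measure \<nu> A - measure \<eta> A\<bar> \<le> 1" for A
      using prob_space.prob_le_1[OF assms(1), of A] prob_space.prob_le_1[OF assms(2), of A]
        measure_nonneg[of \<nu> A] measure_nonneg[of \<eta> A] by linarith
  qed
qed

theorem lemma16:
  fixes U :: "real ^ 'n \<Rightarrow> real"
    and L L_H T h :: real
    and x y :: "real ^ 'n"
    and \<Phi> :: "real ^ 'n \<Rightarrow> real ^ 'n"
    and M :: "'w measure"
    and \<xi> :: "'w \<Rightarrow> real ^ 'n"
  assumes "C3 U"
    and "\<And>z. U 0 \<le> U z"
    and "U 0 = 0"
    and "bdd_above (range (\<lambda>z. bilinear_norm (fderiv (fderiv U) z)))"
    and "L = (SUP z. bilinear_norm (fderiv (fderiv U) z))"
    and "bdd_above (range (\<lambda>z. trilinear_norm (fderiv (fderiv (fderiv U)) z)))"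
    and "L_H = (SUP z. trilinear_norm (fderiv (fderiv (fderiv U)) z))"
    and "T > 0"
    and "h \<ge> 0"
    and "L * (T\<^sup>2 + T * h) \<le> 1 / 6"
    and "h > 0 \<longrightarrow> T / h \<in> \<nat>"
    and "prob_space M"
    and "\<xi> \<in> borel_measurable M"
    and "distr M borel \<xi> = std_gaussian"
    and "\<And>v. verlet_pos U h T x v = verlet_pos U h T y (\<Phi> v)"
  shows "tv_dist (uhmc_kernel U T h x) (uhmc_kernel U T h y)
           \<le> tv_dist (distr M borel \<xi>) (distr M borel (\<lambda>\<omega>. \<Phi> (\<xi> \<omega>))) \<and>
         tv_dist (distr M borel \<xi>) (distr M borel (\<lambda>\<omega>. \<Phi> (\<xi> \<omega>)))
           \<le> 3 / 2 * sqrt (1 / T\<^sup>2 + 27 * real CARD('n) * L_H\<^sup>2 * T ^ 4) * norm (x - y)"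
proof -
  note T = \<open>T > 0\<close>
  obtain I J q where flow: "position_flow I T J (grad U) (hess U) L L_H q"
    and pos: "\<And>x v. verlet_pos U h T x v = q x v T"
    using verlet_position_flow[OF assms(1,4,5,6,7,8,9,10,11)] by blast
  interpret position_flow I T J "grad U" "hess U" L L_H q by (rule flow)
  have pos': "verlet_pos U h T z = endpoint z" for z
    by (simp add: fun_eq_iff endpoint_def pos)
  have meet: "endpoint x v = endpoint y (\<Phi> v)" for v
    using assms(15)[of v] by (simp add: pos')
  obtain A A' where bij: "bij \<Phi>" and der: "\<And>v. (\<Phi> has_derivative A v) (at v)"
    and inv: "\<And>v. linear (A' v)" "\<And>v u. A' v (A v u) = u"
    and bd: "\<And>v. norm (\<Phi> v - v) \<le> 5 / 4 * norm (x - y) / T"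
    and bA: "\<And>v u. norm (A v u - u) \<le> 27 / 10 * L_H * T\<^sup>2 * norm (x - y) * norm u"
    and bA': "\<And>v u. norm (A' v u - u) \<le> 27 / 10 * L_H * T\<^sup>2 * norm (x - y) * norm u"
    using meeting_map[OF meet] by blast
  have "continuous_on UNIV \<Phi>"
    using der by (meson continuous_at_imp_continuous_on has_derivative_continuous)
  then have \<Phi>_meas: "\<Phi> \<in> borel_measurable borel"
    by (rule borel_measurable_continuous_onI)
  have end_meas: "endpoint z \<in> borel_measurable borel" for z
    by (rule borel_measurable_continuous_onI)
      (meson continuous_at_imp_continuous_on endpoint_has_derivative has_derivative_continuous)
  let ?\<gamma> = "std_gaussian :: (real ^ 'n) measure"
  have law: "distr M borel (\<lambda>\<omega>. \<Phi> (\<xi> \<omega>)) = distr ?\<gamma> borel \<Phi>"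
    unfolding assms(14)[symmetric] using \<Phi>_meas assms(13)
    by (subst distr_distr) (auto simp: comp_def)
  have push: "measure (distr ?\<gamma> borel f) S = measure ?\<gamma> (f -` S)"
    if "f \<in> borel_measurable borel" "S \<in> sets borel" for f :: "real ^ 'n \<Rightarrow> real ^ 'n" and S
    using that by (subst measure_distr) auto
  have \<gamma>_\<Phi>: "prob_space (distr ?\<gamma> borel \<Phi>)"
    using \<Phi>_meas by (intro prob_space.prob_space_distr prob_space_std_gaussian) auto
  have "tv_dist (uhmc_kernel U T h x) (uhmc_kernel U T h y) \<le> tv_dist ?\<gamma> (distr ?\<gamma> borel \<Phi>)"
  proof (rule tv_dist_le)
    fix S :: "(real ^ 'n) set" assume S: "S \<in> sets borel"
    let ?S = "endpoint y -` S"
    have S': "?S \<in> sets borel" using measurable_sets[OF end_meas S] by simp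
    have "endpoint x -` S = \<Phi> -` ?S" using meet by auto
    then have "measure (uhmc_kernel U T h x) S = measure (distr ?\<gamma> borel \<Phi>) ?S"
      "measure (uhmc_kernel U T h y) S = measure ?\<gamma> ?S"
      using S S' by (simp_all add: uhmc_kernel_def pos' push end_meas \<Phi>_meas)
    then show "\<bar>measure (uhmc_kernel U T h x) S - measure (uhmc_kernel U T h y) S\<bar>
        \<le> tv_dist ?\<gamma> (distr ?\<gamma> borel \<Phi>)"
      using abs_measure_diff_le_tv_dist[OF prob_space_std_gaussian \<gamma>_\<Phi> S'] by (simp add: abs_minus_commute)
  qed
  moreover have "tv_dist ?\<gamma> (distr ?\<gamma> borel \<Phi>)
      \<le> 3 / 2 * sqrt (1 / T\<^sup>2 + 27 * real CARD('n) * L_H\<^sup>2 * T ^ 4) * norm (x - y)"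
  proof (rule tv_dist_le)
    fix S :: "(real ^ 'n) set" assume S: "S \<in> sets borel"
    let ?d = "\<bar>measure ?\<gamma> S - measure (distr ?\<gamma> borel \<Phi>) S\<bar>"
    let ?z = "norm (x - y)" and ?n = "real CARD('n)"
    show "?d \<le> 3 / 2 * sqrt (1 / T\<^sup>2 + 27 * ?n * L_H\<^sup>2 * T ^ 4) * ?z"
    \<comment> \<open>\<open>gaussian_pushforward\<close> asks for a positive displacement bound,
      which fails exactly for \<open>x = y\<close>; then \<open>\<Phi>\<close> is the identity and
      the two measures agree.\<close>
    proof (cases "x = y")
      case True
      then have "\<Phi> v = v" for v using bd[of v] by simp
      then have "\<Phi> -` S = S" by auto
      then show ?thesis using True by (simp add: push \<Phi>_meas S)
    next
      case False
      let ?\<beta> = "5 / 4 * ?z / T" and ?b = "27 / 10 * L_H * T\<^sup>2 * ?z"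
      have "?d \<le> sqrt (?\<beta>\<^sup>2 / 2 + 3 / 2 * ?n * ?b\<^sup>2)"
        unfolding push[OF \<Phi>_meas S]
        using False T M_nonneg
        by (intro gaussian_pushforward[OF bij der inv bd bA bA' _ _ S]) auto
      also have "\<dots> \<le> sqrt ((3 / 2 * ?z)\<^sup>2 * (1 / T\<^sup>2 + 27 * ?n * L_H\<^sup>2 * T ^ 4))"
      proof (rule real_sqrt_le_mono)
        \<comment> \<open>\<open>X\<close> comes from the displacement, with 25/32 = (5/4)^2 / 2,
          and \<open>Y\<close> from the derivative, with 2187/200 = (3/2)(27/10)^2. They stay below
          9/4 and 27 (9/4), the coefficients in the square of the claimed bound.\<close>
        define X where "X = ?z\<^sup>2 / T\<^sup>2"
        define Y where "Y = ?n * L_H\<^sup>2 * T ^ 4 * ?z\<^sup>2"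
        have XY: "0 \<le> X" "0 \<le> Y" using T by (auto simp: X_def Y_def)
        have "?\<beta>\<^sup>2 / 2 + 3 / 2 * ?n * ?b\<^sup>2 = 25 / 32 * X + 2187 / 200 * Y"
          by (simp add: X_def Y_def power_mult_distrib power_divide)
        also have "\<dots> \<le> 9 / 4 * X + 243 / 4 * Y" using XY by linarith
        also have "\<dots> = (3 / 2 * ?z)\<^sup>2 * (1 / T\<^sup>2 + 27 * ?n * L_H\<^sup>2 * T ^ 4)"
          by (simp add: X_def Y_def power_mult_distrib power_divide algebra_simps)
        finally show "?\<beta>\<^sup>2 / 2 + 3 / 2 * ?n * ?b\<^sup>2
          \<le> (3 / 2 * ?z)\<^sup>2 * (1 / T\<^sup>2 + 27 * ?n * L_H\<^sup>2 * T ^ 4)" .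
      qed
      also have "\<dots> = 3 / 2 * sqrt (1 / T\<^sup>2 + 27 * ?n * L_H\<^sup>2 * T ^ 4) * ?z"
        by (simp add: real_sqrt_mult)
      finally show ?thesis .
    qed
  qed
  ultimately show ?thesis by (simp add: law assms(14))
qed

end
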